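(* Let $\Gamma$ be a finite graph with vertex set $V$. (1) If $G_v$ is a surface group for each $v\in V$, then the graph product $\Pi_\Gamma (G_v)_{v\in V}$ is a linear group. (2) If for each $v\in V$, $G_v$ is a finite group and $A_v<G_v$ is a subgroup, then the graph product of pairs $\Pi_\Gamma(G_v,A_v)$ is a linear group.
   Context: A graph $\Gamma$ on the vertex set $V$ is an antireflexive symmetric relation on $V$. A complete subgraph is a subset $S\subset V$ whose elements are pairwise adjacent (the empty set and singletons are included). Given for each $v\in V$ a group $G_v$ with a subgroup $A_v<G_v$, put $G_S=\prod_{v\in S}G_v\times\prod_{v\in V\setminus S}A_v$ for each complete subgraph $S$. The graph product of pairs $\Pi_\Gamma(G_v,A_v)$ is the direct limit (colimit in groups) of the groups $G_S$, with the obvious inclusions, over the poset of complete subgraphs of $\Gamma$ ordered by inclusion. When all $A_v$ are trivial one obtains the ordinary graph product $\Pi_\Gamma (G_v)_{v\in V}$. A surface group is the fundamental group $M_g$ of a closed orientable surface of genus $g\geq 2$ (different vertices may carry different genera). A group is linear if it admits a faithful finite-dimensional linear representation over some field. *)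

theory Defs
  imports
    "HOL-Analysis.Analysis"
    "HOL-Algebra.Product_Groups"
    "HOL-Algebra.Ring"
begin

section \<open>Colimits of diagrams of groups over a poset\<close>

text \<open>
  The diagram consists of groups \<open>G i\<close> for \<open>i \<in> I\<close> and transition maps \<open>\<phi> i j\<close> for
  \<open>below i j\<close>. Its colimit is realised as words in the disjoint union of the \<open>G i\<close> modulo the
  least congruence that makes every \<open>G i\<close> map homomorphically and identifies \<open>x\<close> with \<open>\<phi> i j x\<close>.
\<close>

abbreviation colimit_letters :: "'i set \<Rightarrow> ('i \<Rightarrow> ('a, 'm) monoid_scheme) \<Rightarrow> ('i \<times> 'a) set"
  where "colimit_letters I G \<equiv> (SIGMA i:I. carrier (G i))"

inductive colimit_cong ::
  "'i set \<Rightarrow> ('i \<Rightarrow> 'i \<Rightarrow> bool) \<Rightarrow> ('i \<Rightarrow> ('a, 'm) monoid_scheme) \<Rightarrow> ('i \<Rightarrow> 'i \<Rightarrow> 'a \<Rightarrow> 'a)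
    \<Rightarrow> ('i \<times> 'a) list \<Rightarrow> ('i \<times> 'a) list \<Rightarrow> bool"
  for I below G \<phi>
  where
    cong_refl: "w \<in> lists (colimit_letters I G) \<Longrightarrow> colimit_cong I below G \<phi> w w"
  | cong_sym: "colimit_cong I below G \<phi> u w \<Longrightarrow> colimit_cong I below G \<phi> w u"
  | cong_trans: "colimit_cong I below G \<phi> u v \<Longrightarrow> colimit_cong I below G \<phi> v w \<Longrightarrow> colimit_cong I below G \<phi> u w"
  | cong_append: "colimit_cong I below G \<phi> u u' \<Longrightarrow> colimit_cong I below G \<phi> w w'
      \<Longrightarrow> colimit_cong I below G \<phi> (u @ w) (u' @ w')"
  | cong_mult: "i \<in> I \<Longrightarrow> x \<in> carrier (G i) \<Longrightarrow> y \<in> carrier (G i)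
      \<Longrightarrow> colimit_cong I below G \<phi> [(i, x), (i, y)] [(i, x \<otimes>\<^bsub>G i\<^esub> y)]"
  | cong_one: "i \<in> I \<Longrightarrow> colimit_cong I below G \<phi> [(i, \<one>\<^bsub>G i\<^esub>)] []"
  | cong_transition: "i \<in> I \<Longrightarrow> j \<in> I \<Longrightarrow> below i j \<Longrightarrow> x \<in> carrier (G i)
      \<Longrightarrow> \<phi> i j x \<in> carrier (G j) \<Longrightarrow> colimit_cong I below G \<phi> [(i, x)] [(j, \<phi> i j x)]"

definition colimit_rel ::
  "'i set \<Rightarrow> ('i \<Rightarrow> 'i \<Rightarrow> bool) \<Rightarrow> ('i \<Rightarrow> ('a, 'm) monoid_scheme) \<Rightarrow> ('i \<Rightarrow> 'i \<Rightarrow> 'a \<Rightarrow> 'a)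
    \<Rightarrow> ('i \<times> 'a) list rel"
  where "colimit_rel I below G \<phi> = {(u, w). colimit_cong I below G \<phi> u w}"

definition group_colimit ::
  "'i set \<Rightarrow> ('i \<Rightarrow> 'i \<Rightarrow> bool) \<Rightarrow> ('i \<Rightarrow> ('a, 'm) monoid_scheme) \<Rightarrow> ('i \<Rightarrow> 'i \<Rightarrow> 'a \<Rightarrow> 'a)
    \<Rightarrow> ('i \<times> 'a) list set monoid"
  where "group_colimit I below G \<phi> =
    \<lparr>carrier = lists (colimit_letters I G) // colimit_rel I below G \<phi>,
     monoid.mult = (\<lambda>X Y. \<Union>x\<in>X. \<Union>y\<in>Y. colimit_rel I below G \<phi> `` {x @ y}),
     one = colimit_rel I below G \<phi> `` {[]}\<rparr>"

definition colimit_inj ::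
  "'i set \<Rightarrow> ('i \<Rightarrow> 'i \<Rightarrow> bool) \<Rightarrow> ('i \<Rightarrow> ('a, 'm) monoid_scheme) \<Rightarrow> ('i \<Rightarrow> 'i \<Rightarrow> 'a \<Rightarrow> 'a)
    \<Rightarrow> 'i \<Rightarrow> 'a \<Rightarrow> ('i \<times> 'a) list set"
  where "colimit_inj I below G \<phi> i x = colimit_rel I below G \<phi> `` {[(i, x)]}"

lemma colimit_cong_lists:
  assumes "\<And>i. i \<in> I \<Longrightarrow> group (G i)" and "colimit_cong I below G \<phi> u w"
  shows "u \<in> lists (colimit_letters I G) \<and> w \<in> lists (colimit_letters I G)"
  using assms(2)
  by induction (auto simp: assms(1) group.is_monoid intro: monoid.m_closed monoid.one_closed)

lemma equiv_colimit_rel: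
  assumes "\<And>i. i \<in> I \<Longrightarrow> group (G i)"
  shows "equiv (lists (colimit_letters I G)) (colimit_rel I below G \<phi>)"
proof (rule equivI)
  show "colimit_rel I below G \<phi> \<subseteq> lists (colimit_letters I G) \<times> lists (colimit_letters I G)"
    using colimit_cong_lists[of I G below \<phi>] assms unfolding colimit_rel_def by fast
  show "refl_on (lists (colimit_letters I G)) (colimit_rel I below G \<phi>)"
    by (auto simp: refl_on_def colimit_rel_def intro: cong_refl)
  show "sym_on UNIV (colimit_rel I below G \<phi>)"
    unfolding colimit_rel_def sym_def by (blast intro: cong_sym)
  show "trans_on UNIV (colimit_rel I below G \<phi>)"
    unfolding colimit_rel_def trans_def by (blast intro: cong_trans)
qed

lemma UN_eq_const: "A \<noteq> {} \<Longrightarrow> (\<And>x. x \<in> A \<Longrightarrow> f x = c) \<Longrightarrow> (\<Union>x\<in>A. f x) = c"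
  by auto

lemma colimit_mult:
  assumes "\<And>i. i \<in> I \<Longrightarrow> group (G i)"
    and "u \<in> lists (colimit_letters I G)" "w \<in> lists (colimit_letters I G)"
  shows "colimit_rel I below G \<phi> `` {u} \<otimes>\<^bsub>group_colimit I below G \<phi>\<^esub> colimit_rel I below G \<phi> `` {w}
    = colimit_rel I below G \<phi> `` {u @ w}"
proof -
  let ?R = "colimit_rel I below G \<phi>"
  have eq: "equiv (lists (colimit_letters I G)) ?R"
    by (rule equiv_colimit_rel) (rule assms(1))
  have cls: "?R `` {x @ y} = ?R `` {u @ w}" if "x \<in> ?R `` {u}" "y \<in> ?R `` {w}" for x y
    using that by (intro equiv_class_eq[OF eq])
      (auto simp: colimit_rel_def intro: cong_append cong_sym)
  have "?R `` {u} \<noteq> {}" "?R `` {w} \<noteq> {}"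
    using equiv_class_self[OF eq] assms(2,3) by blast+
  then have "(\<Union>x\<in>?R `` {u}. \<Union>y\<in>?R `` {w}. ?R `` {x @ y}) = ?R `` {u @ w}"
    by (intro UN_eq_const[OF _ UN_eq_const] cls)
  then show ?thesis
    by (simp add: group_colimit_def)
qed

lemma colimit_carrier_cases:
  assumes "X \<in> carrier (group_colimit I below G \<phi>)"
  obtains w where "w \<in> lists (colimit_letters I G)" "X = colimit_rel I below G \<phi> `` {w}"
  using assms that unfolding group_colimit_def by (auto elim!: quotientE)

lemma colimit_class_in_carrier:
  "w \<in> lists (colimit_letters I G)
    \<Longrightarrow> colimit_rel I below G \<phi> `` {w} \<in> carrier (group_colimit I below G \<phi>)"
  by (simp add: group_colimit_def quotientI)

lemma colimit_inverse_word:
  assumes "\<And>i. i \<in> I \<Longrightarrow> group (G i)" "w \<in> lists (colimit_letters I G)"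
  shows "\<exists>w' \<in> lists (colimit_letters I G). colimit_cong I below G \<phi> (w' @ w) []"
  using assms(2)
proof (induction w)
  case Nil
  then show ?case by (auto intro!: bexI[of _ "[]"] cong_refl)
next
  case (Cons a w)
  obtain i x where a: "a = (i, x)" "i \<in> I" "x \<in> carrier (G i)" using Cons.hyps by auto
  obtain w' where w': "w' \<in> lists (colimit_letters I G)" "colimit_cong I below G \<phi> (w' @ w) []"
    using Cons.IH by blast
  interpret group "G i" using assms(1) a by blast
  let ?y = "inv\<^bsub>G i\<^esub> x"
  have "colimit_cong I below G \<phi> [(i, ?y), (i, x)] [(i, ?y \<otimes>\<^bsub>G i\<^esub> x)]"
    using a by (intro cong_mult) auto
  then have "colimit_cong I below G \<phi> [(i, ?y), (i, x)] []"
    using cong_trans cong_one[OF a(2)] a l_inv by metis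
  from cong_append[OF cong_refl[OF w'(1)] cong_append[OF this cong_refl]]
  have "colimit_cong I below G \<phi> (w' @ [(i, ?y), (i, x)] @ w) (w' @ [] @ w)"
    using Cons.hyps by auto
  then have "colimit_cong I below G \<phi> ((w' @ [(i, ?y)]) @ a # w) []"
    using w'(2) cong_trans a by fastforce
  moreover have "w' @ [(i, ?y)] \<in> lists (colimit_letters I G)" using w' a by auto
  ultimately show ?case by blast
qed

lemma group_group_colimit:
  assumes "\<And>i. i \<in> I \<Longrightarrow> group (G i)"
  shows "group (group_colimit I below G \<phi>)"
proof (rule groupI)
  let ?C = "group_colimit I below G \<phi>" and ?R = "colimit_rel I below G \<phi>"
  note mult = colimit_mult[of I G, OF assms]
  have one: "\<one>\<^bsub>?C\<^esub> = ?R `` {[]}" by (simp add: group_colimit_def)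
  show "\<one>\<^bsub>?C\<^esub> \<in> carrier ?C" unfolding one by (rule colimit_class_in_carrier) auto
  show "x \<otimes>\<^bsub>?C\<^esub> y \<in> carrier ?C" if "x \<in> carrier ?C" "y \<in> carrier ?C" for x y
    using that by (elim colimit_carrier_cases) (simp add: mult colimit_class_in_carrier)
  show "x \<otimes>\<^bsub>?C\<^esub> y \<otimes>\<^bsub>?C\<^esub> z = x \<otimes>\<^bsub>?C\<^esub> (y \<otimes>\<^bsub>?C\<^esub> z)"
    if "x \<in> carrier ?C" "y \<in> carrier ?C" "z \<in> carrier ?C" for x y z
    using that by (elim colimit_carrier_cases) (simp add: mult)
  show "\<one>\<^bsub>?C\<^esub> \<otimes>\<^bsub>?C\<^esub> x = x" if "x \<in> carrier ?C" for x
    using that unfolding one by (elim colimit_carrier_cases) (simp add: mult)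
  show "\<exists>y\<in>carrier ?C. y \<otimes>\<^bsub>?C\<^esub> x = \<one>\<^bsub>?C\<^esub>" if x: "x \<in> carrier ?C" for x
  proof -
    obtain w where w: "w \<in> lists (colimit_letters I G)" "x = ?R `` {w}"
      using x by (rule colimit_carrier_cases)
    obtain w' where w': "w' \<in> lists (colimit_letters I G)" "colimit_cong I below G \<phi> (w' @ w) []"
      using colimit_inverse_word[of I G, OF assms w(1)] by blast
    have "?R `` {w' @ w} = ?R `` {[]}"
      by (rule equiv_class_eq[OF equiv_colimit_rel]) (use assms w' in \<open>auto simp: colimit_rel_def\<close>)
    then show ?thesis unfolding one w(2)
      by (intro bexI[OF _ colimit_class_in_carrier[OF w'(1)]]) (simp add: mult w'(1) w(1))
  qed
qed

text \<open>
  The next three facts are the universal property: the \<open>G i\<close> form a cocone over the diagram, and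
  every cocone, with values in a group of any type, factors uniquely through it.
\<close>

lemma colimit_inj_hom:
  assumes "\<And>i. i \<in> I \<Longrightarrow> group (G i)" "i \<in> I"
  shows "colimit_inj I below G \<phi> i \<in> hom (G i) (group_colimit I below G \<phi>)"
proof (rule homI)
  fix x y assume xy: "x \<in> carrier (G i)" "y \<in> carrier (G i)"
  show "colimit_inj I below G \<phi> i x \<in> carrier (group_colimit I below G \<phi>)"
    unfolding colimit_inj_def by (rule colimit_class_in_carrier) (use assms xy in auto)
  have "colimit_rel I below G \<phi> `` {[(i, x \<otimes>\<^bsub>G i\<^esub> y)]} = colimit_rel I below G \<phi> `` {[(i, x), (i, y)]}"
    by (rule equiv_class_eq[OF equiv_colimit_rel])
      (use assms xy in \<open>auto simp: colimit_rel_def intro: cong_mult cong_sym\<close>)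
  then show "colimit_inj I below G \<phi> i (x \<otimes>\<^bsub>G i\<^esub> y)
    = colimit_inj I below G \<phi> i x \<otimes>\<^bsub>group_colimit I below G \<phi>\<^esub> colimit_inj I below G \<phi> i y"
    unfolding colimit_inj_def using assms xy by (simp add: colimit_mult)
qed

lemma colimit_inj_transition:
  assumes "\<And>i. i \<in> I \<Longrightarrow> group (G i)"
    and "i \<in> I" "j \<in> I" "below i j" "x \<in> carrier (G i)" "\<phi> i j x \<in> carrier (G j)"
  shows "colimit_inj I below G \<phi> j (\<phi> i j x) = colimit_inj I below G \<phi> i x"
  unfolding colimit_inj_def
  by (rule equiv_class_eq[OF equiv_colimit_rel])
    (use assms in \<open>auto simp: colimit_rel_def intro: cong_transition cong_sym\<close>)

lemma colimit_universal:
  fixes H :: "'h monoid"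
  assumes G: "\<And>i. i \<in> I \<Longrightarrow> group (G i)" and H: "group H"
    and f: "\<And>i. i \<in> I \<Longrightarrow> f i \<in> hom (G i) H"
    and cocone: "\<And>i j x. i \<in> I \<Longrightarrow> j \<in> I \<Longrightarrow> below i j \<Longrightarrow> x \<in> carrier (G i) \<Longrightarrow> f j (\<phi> i j x) = f i x"
  shows "\<exists>!h. h \<in> hom (group_colimit I below G \<phi>) H \<inter> extensional (carrier (group_colimit I below G \<phi>))
    \<and> (\<forall>i\<in>I. \<forall>x\<in>carrier (G i). h (colimit_inj I below G \<phi> i x) = f i x)"
proof -
  let ?C = "group_colimit I below G \<phi>" and ?R = "colimit_rel I below G \<phi>" and ?L = "lists (colimit_letters I G)"
  interpret H: group H by (rule H)
  interpret C: group ?C by (rule group_group_colimit) (rule G)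
  note mult = colimit_mult[of I G, OF G]
  define e where "e w = foldr (\<lambda>(i, x) y. f i x \<otimes>\<^bsub>H\<^esub> y) w \<one>\<^bsub>H\<^esub>" for w
  have e_simps: "e [] = \<one>\<^bsub>H\<^esub>" "e ((i, x) # w) = f i x \<otimes>\<^bsub>H\<^esub> e w" for i x w
    by (auto simp: e_def)
  have fc: "f i x \<in> carrier H" if "i \<in> I" "x \<in> carrier (G i)" for i x
    using f[OF that(1)] that(2) by (auto simp: hom_def)
  have ec: "e w \<in> carrier H" if "w \<in> ?L" for w
    using that by (induction w) (auto simp: e_simps fc)
  have e_app: "e (u @ w) = e u \<otimes>\<^bsub>H\<^esub> e w" if "u \<in> ?L" "w \<in> ?L" for u w
    using that(1)
  proof (induction u)
    case (Cons a u)
    then show ?case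
      using ec[OF Cons.hyps(2)] ec[OF that(2)] by (auto simp: e_simps fc H.m_assoc)
  qed (simp add: e_simps ec that(2))
  have e_cong: "e u = e w" if "colimit_cong I below G \<phi> u w" for u w
    using that
  proof induction
    case (cong_append u u' w w')
    have "u \<in> ?L \<and> u' \<in> ?L" "w \<in> ?L \<and> w' \<in> ?L"
      by (rule colimit_cong_lists[OF G]; use cong_append in blast)+
    then show ?case using cong_append.IH e_app by simp
  next
    case (cong_mult i x y)
    then show ?case using f[OF cong_mult(1)] cong_mult fc by (auto simp: e_simps hom_def)
  next
    case (cong_one i)
    then show ?case using hom_one[OF f[OF cong_one] G[OF cong_one] H] by (simp add: e_simps)
  next
    case (cong_transition i j x)
    then show ?case using cocone cong_transition by (simp add: e_simps)
  qed auto
  define h where "h = (\<lambda>X\<in>carrier ?C. e (SOME w. w \<in> X))"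
  have h_class: "h (?R `` {w}) = e w" if w: "w \<in> ?L" for w
  proof -
    have "w \<in> ?R `` {w}" using w by (auto simp: colimit_rel_def intro: cong_refl)
    then have "(SOME v. v \<in> ?R `` {w}) \<in> ?R `` {w}" by (rule someI)
    then have "colimit_cong I below G \<phi> w (SOME v. v \<in> ?R `` {w})" by (simp add: colimit_rel_def)
    then show ?thesis using colimit_class_in_carrier[OF w, of below \<phi>] e_cong by (simp add: h_def)
  qed
  have h_hom: "h \<in> hom ?C H"
  proof (rule homI)
    fix X Y assume X: "X \<in> carrier ?C" and Y: "Y \<in> carrier ?C"
    obtain u where u: "u \<in> ?L" "X = ?R `` {u}" using X by (rule colimit_carrier_cases)
    obtain w where w: "w \<in> ?L" "Y = ?R `` {w}" using Y by (rule colimit_carrier_cases)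
    show "h X \<in> carrier H" using u h_class ec by simp
    have uw: "u @ w \<in> ?L" using u w by simp
    show "h (X \<otimes>\<^bsub>?C\<^esub> Y) = h X \<otimes>\<^bsub>H\<^esub> h Y"
      unfolding u(2) w(2) mult[OF _ u(1) w(1), simplified]
      using u w uw h_class e_app by simp
  qed
  have h_inj: "h (colimit_inj I below G \<phi> i x) = f i x" if "i \<in> I" "x \<in> carrier (G i)" for i x
    unfolding colimit_inj_def using that fc by (subst h_class) (auto simp: e_simps)
  have unique: "k X = e w" if k: "k \<in> hom ?C H"
    "\<forall>i\<in>I. \<forall>x\<in>carrier (G i). k (colimit_inj I below G \<phi> i x) = f i x"
    and w: "w \<in> ?L" "X = ?R `` {w}" for k X w
    using w
  proof (induction w arbitrary: X)
    case Nil
    then have "X = \<one>\<^bsub>?C\<^esub>" by (simp add: group_colimit_def)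
    then show ?case using hom_one[OF k(1) C.is_group H] by (simp add: e_simps)
  next
    case (Cons a w)
    obtain i x where a: "a = (i, x)" "i \<in> I" "x \<in> carrier (G i)" using Cons.hyps by auto
    have "X = colimit_inj I below G \<phi> i x \<otimes>\<^bsub>?C\<^esub> ?R `` {w}"
      unfolding colimit_inj_def using mult[of "[a]" w] Cons a by simp
    moreover have "colimit_inj I below G \<phi> i x \<in> carrier ?C" "?R `` {w} \<in> carrier ?C"
      unfolding colimit_inj_def using Cons a by (auto intro!: colimit_class_in_carrier)
    ultimately have "k X = k (colimit_inj I below G \<phi> i x) \<otimes>\<^bsub>H\<^esub> k (?R `` {w})"
      using k(1) by (simp add: hom_mult)
    then show ?case using Cons.IH[OF refl] k(2) a by (simp add: e_simps)
  qed
  show ?thesis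
  proof (rule ex1I[of _ h])
    show "h \<in> hom ?C H \<inter> extensional (carrier ?C)
      \<and> (\<forall>i\<in>I. \<forall>x\<in>carrier (G i). h (colimit_inj I below G \<phi> i x) = f i x)"
      using h_hom h_inj by (simp add: h_def)
  next
    fix k assume k: "k \<in> hom ?C H \<inter> extensional (carrier ?C)
      \<and> (\<forall>i\<in>I. \<forall>x\<in>carrier (G i). k (colimit_inj I below G \<phi> i x) = f i x)"
    show "k = h"
    proof (rule extensionalityI)
      show "k \<in> extensional (carrier ?C)" using k by blast
      show "h \<in> extensional (carrier ?C)" by (simp add: h_def)
      fix X assume "X \<in> carrier ?C"
      then obtain w where w: "w \<in> ?L" "X = ?R `` {w}" by (rule colimit_carrier_cases)
      show "k X = h X" using unique[of k w X] k w h_class by simp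
    qed
  qed
qed


section \<open>Graph products of pairs\<close>

definition finite_graph :: "'v set \<Rightarrow> 'v rel \<Rightarrow> bool"
  where "finite_graph V E \<longleftrightarrow> finite V \<and> E \<subseteq> V \<times> V \<and> sym E \<and> irrefl E"

definition complete_subgraphs :: "'v set \<Rightarrow> 'v rel \<Rightarrow> 'v set set"
  where "complete_subgraphs V E = {S. S \<subseteq> V \<and> (\<forall>u\<in>S. \<forall>v\<in>S. u \<noteq> v \<longrightarrow> (u, v) \<in> E)}"

definition clique_group ::
  "'v set \<Rightarrow> ('v \<Rightarrow> 'a monoid) \<Rightarrow> ('v \<Rightarrow> 'a set) \<Rightarrow> 'v set \<Rightarrow> ('v \<Rightarrow> 'a) monoid"
  where "clique_group V G A S =
    product_group V (\<lambda>v. if v \<in> S then G v else (G v)\<lparr>carrier := A v\<rparr>)"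

text \<open>
  For \<open>S \<subseteq> T\<close> the carrier of \<open>clique_group V G A S\<close> is a subset of that of
  \<open>clique_group V G A T\<close>, so the transition maps are identities.
\<close>

definition graph_product_of_pairs ::
  "'v set \<Rightarrow> 'v rel \<Rightarrow> ('v \<Rightarrow> 'a monoid) \<Rightarrow> ('v \<Rightarrow> 'a set) \<Rightarrow> ('v set \<times> ('v \<Rightarrow> 'a)) list set monoid"
  where "graph_product_of_pairs V E G A =
    group_colimit (complete_subgraphs V E) (\<subseteq>) (clique_group V G A) (\<lambda>S T x. x)"

definition graph_product ::
  "'v set \<Rightarrow> 'v rel \<Rightarrow> ('v \<Rightarrow> 'a monoid) \<Rightarrow> ('v set \<times> ('v \<Rightarrow> 'a)) list set monoid"
  where "graph_product V E G = graph_product_of_pairs V E G (\<lambda>v. {\<one>\<^bsub>G v\<^esub>})"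

lemma group_clique_group:
  assumes "\<And>v. v \<in> V \<Longrightarrow> group (G v)" "\<And>v. v \<in> V \<Longrightarrow> subgroup (A v) (G v)"
  shows "group (clique_group V G A S)"
  unfolding clique_group_def
  by (rule product_group) (use assms in \<open>auto intro: subgroup.subgroup_is_group\<close>)

lemma group_graph_product_of_pairs:
  assumes "\<And>v. v \<in> V \<Longrightarrow> group (G v)" "\<And>v. v \<in> V \<Longrightarrow> subgroup (A v) (G v)"
  shows "group (graph_product_of_pairs V E G A)"
  unfolding graph_product_of_pairs_def
  by (rule group_group_colimit) (rule group_clique_group, use assms in auto)


section \<open>Fundamental groups and surface groups\<close>

definition loops_at :: "'a::topological_space set \<Rightarrow> 'a \<Rightarrow> (real \<Rightarrow> 'a) set"
  where "loops_at S a = {p. path p \<and> path_image p \<subseteq> S \<and> pathstart p = a \<and> pathfinish p = a}"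

definition loop_homotopy :: "'a::topological_space set \<Rightarrow> 'a \<Rightarrow> (real \<Rightarrow> 'a) rel"
  where "loop_homotopy S a = {(p, q). p \<in> loops_at S a \<and> q \<in> loops_at S a \<and> homotopic_paths S p q}"

definition fundamental_group :: "'a::topological_space set \<Rightarrow> 'a \<Rightarrow> (real \<Rightarrow> 'a) set monoid"
  where "fundamental_group S a =
    \<lparr>carrier = loops_at S a // loop_homotopy S a,
     monoid.mult = (\<lambda>P Q. \<Union>p\<in>P. \<Union>q\<in>Q. loop_homotopy S a `` {p +++ q}),
     one = loop_homotopy S a `` {\<lambda>t. a}\<rparr>"

lemma equiv_loop_homotopy: "equiv (loops_at S a) (loop_homotopy S a)"
proof (rule equivI)
  show "refl_on (loops_at S a) (loop_homotopy S a)"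
    by (auto simp: refl_on_def loop_homotopy_def loops_at_def)
  show "sym_on UNIV (loop_homotopy S a)"
    by (auto simp: sym_def loop_homotopy_def intro: homotopic_paths_sym)
  show "trans_on UNIV (loop_homotopy S a)"
    unfolding trans_def loop_homotopy_def by (blast intro: homotopic_paths_trans)
qed (auto simp: loop_homotopy_def)

lemma loops_at_join: "p \<in> loops_at S a \<Longrightarrow> q \<in> loops_at S a \<Longrightarrow> p +++ q \<in> loops_at S a"
  by (auto simp: loops_at_def path_image_join)

lemma group_fundamental_group:
  fixes S :: "'a::real_normed_vector set"
  assumes "a \<in> S"
  shows "group (fundamental_group S a)"
proof -
  let ?R = "loop_homotopy S a" and ?P = "fundamental_group S a" and ?L = "loops_at S a"
  note eq = equiv_loop_homotopy[of S a]
  have one: "\<one>\<^bsub>?P\<^esub> = ?R `` {\<lambda>t. a}" by (simp add: fundamental_group_def)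
  have const: "(\<lambda>t. a) \<in> ?L"
    using assms by (auto simp: loops_at_def path_def path_image_def pathstart_def pathfinish_def)
  have const': "linepath a a = (\<lambda>t. a)" by (rule linepath_refl)
  have cls: "?R `` {p} \<in> carrier ?P" if "p \<in> ?L" for p
    using that by (simp add: fundamental_group_def quotientI)
  have mult: "?R `` {p} \<otimes>\<^bsub>?P\<^esub> ?R `` {q} = ?R `` {p +++ q}" if "p \<in> ?L" "q \<in> ?L" for p q
  proof -
    have c: "?R `` {p' +++ q'} = ?R `` {p +++ q}" if "p' \<in> ?R `` {p}" "q' \<in> ?R `` {q}" for p' q'
    proof (rule equiv_class_eq[OF eq])
      have "p' \<in> ?L" "q' \<in> ?L" "homotopic_paths S p' p" "homotopic_paths S q' q" "pathfinish p' = pathstart q'"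
        using that by (auto simp: loop_homotopy_def homotopic_paths_sym_eq loops_at_def)
      then show "(p' +++ q', p +++ q) \<in> ?R"
        using \<open>p \<in> ?L\<close> \<open>q \<in> ?L\<close>
        by (simp add: loop_homotopy_def loops_at_join homotopic_paths_join)
    qed
    have "?R `` {p} \<noteq> {}" "?R `` {q} \<noteq> {}" using equiv_class_self[OF eq] that by blast+
    then have "(\<Union>p'\<in>?R `` {p}. \<Union>q'\<in>?R `` {q}. ?R `` {p' +++ q'}) = ?R `` {p +++ q}"
      by (intro UN_eq_const[OF _ UN_eq_const] c)
    then show ?thesis by (simp add: fundamental_group_def)
  qed
  have cases: "\<exists>p\<in>?L. X = ?R `` {p}" if "X \<in> carrier ?P" for X
    using that by (auto simp: fundamental_group_def elim: quotientE)
  have eqI: "?R `` {p} = ?R `` {q}" if "p \<in> ?L" "q \<in> ?L" "homotopic_paths S p q" for p q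
    by (rule equiv_class_eq[OF eq]) (use that in \<open>auto simp: loop_homotopy_def\<close>)
  show ?thesis
  proof (rule groupI)
    show "\<one>\<^bsub>?P\<^esub> \<in> carrier ?P" unfolding one by (rule cls[OF const])
    show "x \<otimes>\<^bsub>?P\<^esub> y \<in> carrier ?P" if "x \<in> carrier ?P" "y \<in> carrier ?P" for x y
      using cases[OF that(1)] cases[OF that(2)] mult cls loops_at_join by metis
    show "x \<otimes>\<^bsub>?P\<^esub> y \<otimes>\<^bsub>?P\<^esub> z = x \<otimes>\<^bsub>?P\<^esub> (y \<otimes>\<^bsub>?P\<^esub> z)"
      if xyz: "x \<in> carrier ?P" "y \<in> carrier ?P" "z \<in> carrier ?P" for x y z
    proof -
      obtain p q r where pqr: "p \<in> ?L" "q \<in> ?L" "r \<in> ?L"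
        "x = ?R `` {p}" "y = ?R `` {q}" "z = ?R `` {r}"
        using cases[OF xyz(1)] cases[OF xyz(2)] cases[OF xyz(3)] by blast
      have "homotopic_paths S (p +++ (q +++ r)) ((p +++ q) +++ r)"
        using pqr by (intro homotopic_paths_assoc) (auto simp: loops_at_def)
      then show ?thesis
        using pqr by (simp add: mult loops_at_join) (intro eqI, auto intro: loops_at_join homotopic_paths_sym)
    qed
    show "\<one>\<^bsub>?P\<^esub> \<otimes>\<^bsub>?P\<^esub> x = x" if x: "x \<in> carrier ?P" for x
    proof -
      obtain p where p: "p \<in> ?L" "x = ?R `` {p}" using cases[OF x] by blast
      have "homotopic_paths S (linepath (pathstart p) (pathstart p) +++ p) p"
        using p by (intro homotopic_paths_lid) (auto simp: loops_at_def)
      then have "homotopic_paths S ((\<lambda>t. a) +++ p) p" using p const' by (simp add: loops_at_def)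
      then show ?thesis unfolding one p(2) mult[OF const p(1)]
        by (intro eqI) (auto intro: loops_at_join const p)
    qed
    show "\<exists>y\<in>carrier ?P. y \<otimes>\<^bsub>?P\<^esub> x = \<one>\<^bsub>?P\<^esub>" if x: "x \<in> carrier ?P" for x
    proof -
      obtain p where p: "p \<in> ?L" "x = ?R `` {p}" using cases[OF x] by blast
      have r: "reversepath p \<in> ?L" using p by (auto simp: loops_at_def)
      have "homotopic_paths S (reversepath p +++ p) (linepath (pathfinish p) (pathfinish p))"
        using p by (intro homotopic_paths_linv) (auto simp: loops_at_def)
      then have "homotopic_paths S (reversepath p +++ p) (\<lambda>t. a)"
        using p const' by (simp add: loops_at_def)
      then have "?R `` {reversepath p +++ p} = ?R `` {\<lambda>t. a}"
        by (intro eqI loops_at_join r p const)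
      then show ?thesis using p r cls mult one by metis
    qed
  qed
qed

text \<open>
  The closed unit disc is viewed as a polygon with \<open>4 g\<close> sides, the \<open>n\<close>-th side being the arc
  \<open>polygon_boundary g ` {n..n + 1}\<close>. Sides are glued in pairs according to the boundary word
  \<open>a\<^sub>1 b\<^sub>1 a\<^sub>1\<inverse> b\<^sub>1\<inverse> \<dots> a\<^sub>g b\<^sub>g a\<^sub>g\<inverse> b\<^sub>g\<inverse>\<close>: sides \<open>4 k\<close> and \<open>4 k + 2\<close>, and sides
  \<open>4 k + 1\<close> and \<open>4 k + 3\<close>, are identified with reversed orientation.
\<close>

definition polygon_boundary :: "nat \<Rightarrow> real \<Rightarrow> complex"
  where "polygon_boundary g s = cis (2 * pi * s / (4 * real g))"

definition side_pairing :: "nat \<Rightarrow> complex rel"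
  where "side_pairing g =
    (\<Union>k\<in>{..<g}. \<Union>t\<in>{0..1}.
      {(polygon_boundary g (4 * real k + t), polygon_boundary g (4 * real k + 3 - t)),
       (polygon_boundary g (4 * real k + 1 + t), polygon_boundary g (4 * real k + 4 - t))})"

definition polygon_gluing :: "nat \<Rightarrow> complex rel"
  where "polygon_gluing g = (side_pairing g \<union> (side_pairing g)\<inverse>)\<^sup>*"

text \<open>
  The closed orientable surface of genus \<open>g \<ge> 1\<close>, up to homeomorphism: a space that is the quotient
  of the polygon by exactly the gluing above.
\<close>

definition closed_orientable_surface :: "nat \<Rightarrow> 'a::topological_space set \<Rightarrow> bool"
  where "closed_orientable_surface g S \<longleftrightarrow>
    (\<exists>q. quotient_map (top_of_set (cball 0 1)) (top_of_set S) q \<and>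
         (\<forall>z\<in>cball 0 1. \<forall>w\<in>cball 0 1. q z = q w \<longleftrightarrow> (z, w) \<in> polygon_gluing g))"

text \<open>
  Taking surfaces in \<open>\<real>\<^sup>3\<close> is no restriction: every closed orientable surface embeds there, and the
  fundamental group is a homeomorphism invariant.
\<close>

definition surface_group :: "('a, 'm) monoid_scheme \<Rightarrow> bool"
  where "surface_group G \<longleftrightarrow> group G \<and>
    (\<exists>g\<ge>2. \<exists>S :: (real ^ 3) set. closed_orientable_surface g S \<and>
      (\<exists>a\<in>S. G \<cong> fundamental_group S a))"


section \<open>Linear groups\<close>

definition matrix_monoid :: "('k, 'm) ring_scheme \<Rightarrow> nat \<Rightarrow> (nat \<times> nat \<Rightarrow> 'k) monoid"
  where "matrix_monoid K n =
    \<lparr>carrier = ({..<n} \<times> {..<n}) \<rightarrow>\<^sub>E carrier K,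
     monoid.mult = (\<lambda>A B. \<lambda>(i, j)\<in>{..<n} \<times> {..<n}. \<Oplus>\<^bsub>K\<^esub>k\<in>{..<n}. A (i, k) \<otimes>\<^bsub>K\<^esub> B (k, j)),
     one = (\<lambda>(i, j)\<in>{..<n} \<times> {..<n}. if i = j then \<one>\<^bsub>K\<^esub> else \<zero>\<^bsub>K\<^esub>)\<rparr>"

definition GL :: "('k, 'm) ring_scheme \<Rightarrow> nat \<Rightarrow> (nat \<times> nat \<Rightarrow> 'k) monoid"
  where "GL K n = units_of (matrix_monoid K n)"

text \<open>
  HOL cannot quantify over the type carrying the field. The type \<open>'a list\<close> loses no generality: if
  a group on \<open>'a\<close> has a faithful representation over some field, it has one over the subfield
  generated by the matrix entries, and this subfield has cardinality at most
  \<open>max |'a| \<aleph>\<^sub>0 = |'a list|\<close>, hence an isomorphic copy with carrier in \<open>'a list\<close>.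
\<close>

definition linear_group :: "('a, 'm) monoid_scheme \<Rightarrow> bool"
  where "linear_group G \<longleftrightarrow>
    (\<exists>(K :: 'a list ring) n. field K \<and> mon G (GL K n) \<noteq> {})"

end

theory Submission
  imports Defs "HOL-Algebra.Bij"
begin

text \<open>
  Suppose each \<open>G\<^sub>v\<close> acts faithfully on a real vector space \<open>W\<^sub>v\<close> with an \<open>A\<^sub>v\<close>-invariant vector
  \<open>u\<^sub>v\<close>, an \<open>A\<^sub>v\<close>-invariant functional \<open>lam\<^sub>v\<close> and a \<open>G\<^sub>v\<close>-invariant functional \<open>phi\<^sub>v\<close> such that
  \<open>phi\<^sub>v u\<^sub>v = 1\<close>, \<open>lam\<^sub>v u\<^sub>v = 2\<close> and \<open>lam\<^sub>v (g u\<^sub>v) \<le> -2\<close> for \<open>g \<notin> A\<^sub>v\<close>. On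
  \<open>\<real> f \<oplus> \<Oplus> W\<^sub>v\<close> there is a reflection \<open>s\<^sub>v\<close> in \<open>u\<^sub>v\<close>, as in Tits's representation of a
  right-angled Coxeter group; letting \<open>g \<in> G\<^sub>v\<close> act by \<open>s\<^sub>v g s\<^sub>v\<close> defines a representation of the
  graph product of pairs, and following the vector \<open>f\<close> along a reduced word shows that it is faithful
  and has the same kind of separating data. Finite pairs have such data on \<open>\<real>[G\<^sub>v]\<close>.

  The group of a surface of genus \<open>g\<close> embeds into the right-angled Coxeter group \<open>W\<close> of a
  \<open>(2 g + 2)\<close>-cycle. The homomorphism to \<open>W\<close> is the holonomy of a local system on the glued
  polygon, given by elements \<open>a\<^sub>i, b\<^sub>i\<close> of \<open>W\<close> with trivial product of commutators. It is
  injective because \<open>W\<close> acts on four copies of the surface group in such a way that \<open>a\<^sub>i\<close> and \<open>b\<^sub>i\<close>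
  act on the first copy as left translations by the corresponding generators: the surface is
  tiled by four right-angled \<open>(2 g + 2)\<close>-gons. Hence surface groups inherit separating data from \<open>W\<close>.
\<close>

section \<open>Finite-dimensional real representations\<close>

text \<open>A surface group is given as homotopy classes of loops on a quotient of the disc, so no
  presentation of it is at hand, and none is computed. Holonomy in the Coxeter group is well defined
  on classes because transport is invariant under homotopy. For injectivity it is enough that the
  classes of the sides in the fundamental group satisfy the boundary relation: the holonomy in the
  Coxeter group and the tautological holonomy in the fundamental group are followed along the same
  path, and a subgroup of the product of both groups ties the second to the first. The numbers 2 and
  -2 are those of Tits's form: a coroot is 2 on its own root and -2 on a root whose reflection
  generates with its own an infinite dihedral group. The separating data of a graph product have the
  shape of those of its vertex groups, so the construction can be iterated: groups of order two give
  the Coxeter group, its subgroups inherit the data, and surface groups can then be vertex groups.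
  The four copies are labelled by two parities, counting odd- and even-numbered generators; as the
  cycle has even length, neighbouring generators change different labels.\<close>

definition linear_op :: "'i set \<Rightarrow> (('i \<Rightarrow> real) \<Rightarrow> 'i \<Rightarrow> real) \<Rightarrow> bool"
  where "linear_op I T \<longleftrightarrow>
    (\<forall>x y. T (\<lambda>i. x i + y i) = (\<lambda>i. T x i + T y i)) \<and>
    (\<forall>c x. T (\<lambda>i. c * x i) = (\<lambda>i. c * T x i)) \<and>
    (\<forall>x. (\<forall>i. i \<notin> I \<longrightarrow> x i = 0) \<longrightarrow> (\<forall>i. i \<notin> I \<longrightarrow> T x i = 0))"

definition linear_functional :: "(('i \<Rightarrow> real) \<Rightarrow> real) \<Rightarrow> bool"
  where "linear_functional f \<longleftrightarrow>
    (\<forall>x y. f (\<lambda>i. x i + y i) = f x + f y) \<and> (\<forall>c x. f (\<lambda>i. c * x i) = c * f x)"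

definition op_group :: "'i set \<Rightarrow> (('i \<Rightarrow> real) \<Rightarrow> 'i \<Rightarrow> real) monoid"
  where "op_group I =
    \<lparr>carrier = {T. linear_op I T \<and> (\<exists>T'. linear_op I T' \<and> T \<circ> T' = id \<and> T' \<circ> T = id)},
     monoid.mult = (\<circ>), one = id\<rparr>"

lemma linear_op_add: "linear_op I T \<Longrightarrow> T (\<lambda>i. x i + y i) = (\<lambda>i. T x i + T y i)"
  and linear_op_scale: "linear_op I T \<Longrightarrow> T (\<lambda>i. c * x i) = (\<lambda>i. c * T x i)"
  and linear_op_supp: "linear_op I T \<Longrightarrow> (\<And>i. i \<notin> I \<Longrightarrow> x i = 0) \<Longrightarrow> j \<notin> I \<Longrightarrow> T x j = 0"
  by (auto simp: linear_op_def)

lemma linear_op_comp: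
  assumes "linear_op I T" "linear_op I T'" shows "linear_op I (T \<circ> T')"
  using assms unfolding linear_op_def by (auto simp: comp_def)

lemma linear_op_id: "linear_op I id"
  by (simp add: linear_op_def)

lemma group_op_group: "group (op_group I)"
proof (rule groupI)
  show "x \<otimes>\<^bsub>op_group I\<^esub> y \<in> carrier (op_group I)"
    if xy: "x \<in> carrier (op_group I)" "y \<in> carrier (op_group I)" for x y
  proof -
    obtain x' y' where *: "linear_op I x'" "x \<circ> x' = id" "x' \<circ> x = id"
      "linear_op I y'" "y \<circ> y' = id" "y' \<circ> y = id"
      using xy by (auto simp: op_group_def)
    have "(x \<circ> y) \<circ> (y' \<circ> x') = id" "(y' \<circ> x') \<circ> (x \<circ> y) = id"
      using * by (metis comp_assoc comp_id)+
    then show ?thesis using xy * linear_op_comp by (auto simp: op_group_def)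
  qed
  show "\<exists>y\<in>carrier (op_group I). y \<otimes>\<^bsub>op_group I\<^esub> x = \<one>\<^bsub>op_group I\<^esub>"
    if "x \<in> carrier (op_group I)" for x
    using that by (auto simp: op_group_def)
qed (auto simp: op_group_def linear_op_id comp_assoc)

lemma linear_op_zero: "linear_op I T \<Longrightarrow> T (\<lambda>i. 0) = (\<lambda>i. 0)"
  using linear_op_scale[of I T 0 "\<lambda>i. 0"] by simp

lemma linear_op_sum:
  assumes "linear_op I T" "finite J"
  shows "T (\<lambda>i. \<Sum>k\<in>J. c k * x k i) = (\<lambda>i. \<Sum>k\<in>J. c k * T (x k) i)"
  using assms(2)
proof (induction J)
  case empty
  then show ?case using linear_op_zero[OF assms(1)] by simp
next
  case (insert k J)
  then show ?case
    by (simp add: linear_op_add[OF assms(1), of "\<lambda>i. c k * x k i"] linear_op_scale[OF assms(1)])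
qed

text \<open>Operators act on all real functions on the index type. The finite-dimensional space is
  the subspace supported in \<open>I\<close>, and faithfulness is required there, where matrices can
  see it.\<close>

definition faithful_rep :: "('a, 'm) monoid_scheme \<Rightarrow> 'i set \<Rightarrow> ('a \<Rightarrow> ('i \<Rightarrow> real) \<Rightarrow> 'i \<Rightarrow> real) \<Rightarrow> bool"
  where "faithful_rep G I \<rho> \<longleftrightarrow> finite I \<and> \<rho> \<in> hom G (op_group I) \<and>
    (\<forall>g\<in>carrier G. (\<forall>x. (\<forall>i. i \<notin> I \<longrightarrow> x i = 0) \<longrightarrow> \<rho> g x = x) \<longrightarrow> g = \<one>\<^bsub>G\<^esub>)"

lemma faithful_rep_linear_op: "faithful_rep G I \<rho> \<Longrightarrow> g \<in> carrier G \<Longrightarrow> linear_op I (\<rho> g)"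
  by (auto simp: faithful_rep_def hom_def op_group_def)

lemma faithful_rep_mult:
  "faithful_rep G I \<rho> \<Longrightarrow> g \<in> carrier G \<Longrightarrow> h \<in> carrier G \<Longrightarrow> \<rho> (g \<otimes>\<^bsub>G\<^esub> h) x = \<rho> g (\<rho> h x)"
  by (auto simp: faithful_rep_def hom_def op_group_def)

lemma faithful_rep_one: "faithful_rep G I \<rho> \<Longrightarrow> group G \<Longrightarrow> \<rho> \<one>\<^bsub>G\<^esub> x = x"
  using hom_one[of \<rho> G "op_group I"] group_op_group[of I]
  by (simp add: faithful_rep_def op_group_def)

text \<open>\<open>linear_group\<close> asks for a field whose carrier lies in lists over the type
  of the group, so the real field is carried there along an injection \<kappa>.\<close>

definition real_copy :: "(real \<Rightarrow> 'k) \<Rightarrow> 'k ring"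
  where "real_copy \<kappa> = \<lparr>carrier = range \<kappa>, monoid.mult = (\<lambda>x y. \<kappa> (the_inv \<kappa> x * the_inv \<kappa> y)), one = \<kappa> 1,
    zero = \<kappa> 0, add = (\<lambda>x y. \<kappa> (the_inv \<kappa> x + the_inv \<kappa> y))\<rparr>"

lemma field_real_copy:
  assumes "inj \<kappa>"
  shows "field (real_copy \<kappa>)"
proof -
  have [simp]: "the_inv \<kappa> (\<kappa> x) = x" for x by (rule the_inv_f_f[OF assms])
  have [simp]: "\<kappa> x = \<kappa> y \<longleftrightarrow> x = y" for x y using assms by (auto dest: injD)
  have "abelian_group (real_copy \<kappa>)"
  proof (rule abelian_groupI)
    show "\<exists>y\<in>carrier (real_copy \<kappa>). y \<oplus>\<^bsub>real_copy \<kappa>\<^esub> x = \<zero>\<^bsub>real_copy \<kappa>\<^esub>"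
      if "x \<in> carrier (real_copy \<kappa>)" for x
    proof -
      obtain r where "x = \<kappa> r" using \<open>x \<in> carrier _\<close> by (auto simp: real_copy_def)
      then show ?thesis by (intro bexI[of _ "\<kappa> (- r)"]) (auto simp: real_copy_def)
    qed
  qed (auto simp: real_copy_def add_ac)
  moreover have "comm_monoid (real_copy \<kappa>)"
    by (rule comm_monoidI) (auto simp: real_copy_def mult_ac)
  ultimately have "cring (real_copy \<kappa>)"
    by (rule cringI) (auto simp: real_copy_def algebra_simps)
  then show ?thesis
  proof (rule cring.cring_fieldI)
    have "\<exists>y. y * r = 1 \<and> r * y = 1" if "r \<noteq> 0" for r :: real
      using that by (intro exI[of _ "inverse r"]) simp
    then show "Units (real_copy \<kappa>) = carrier (real_copy \<kappa>) - {\<zero>\<^bsub>real_copy \<kappa>\<^esub>}"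
      by (auto simp: Units_def real_copy_def)
  qed
qed

lemma finsum_real_copy:
  assumes "inj \<kappa>" "finite J"
  shows "(\<Oplus>\<^bsub>real_copy \<kappa>\<^esub>k\<in>J. \<kappa> (f k)) = \<kappa> (\<Sum>k\<in>J. f k)"
proof -
  interpret field "real_copy \<kappa>" by (rule field_real_copy[OF assms(1)])
  have c: "\<kappa> x \<in> carrier (real_copy \<kappa>)" for x by (simp add: real_copy_def)
  show ?thesis using assms(2)
  proof (induction J)
    case empty
    show ?case unfolding finsum_empty by (simp add: real_copy_def)
  next
    case (insert k J)
    then show ?case using assms(1)
      by (subst finsum_insert) (auto simp: c, simp add: real_copy_def the_inv_f_f)
  qed
qed

text \<open>The matrices of \<open>\<rho> g\<close> in the basis \<open>\<delta> k\<close>, k \<in>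
  \<open>I\<close>, enumerated by \<open>b\<close>, give the homomorphism. Operators preserve
  supports in \<open>I\<close>, so the columns are complete, and equal matrices mean equal operators
  on the subspace where faithfulness is required.\<close>

lemma linear_group_faithful_rep:
  fixes G :: "('a, 'm) monoid_scheme" and \<kappa> :: "real \<Rightarrow> 'a list" and I :: "'i set"
  assumes G: "group G" and \<kappa>: "inj \<kappa>" and rep: "faithful_rep G I \<rho>"
  shows "linear_group G"
proof -
  have finI: "finite I" using rep by (simp add: faithful_rep_def)
  define n where "n = card I"
  obtain b where b: "bij_betw b {..<n} I"
    using finI ex_bij_betw_nat_finite[of I] by (auto simp: n_def atLeast0LessThan)
  let ?K = "real_copy \<kappa>" and ?M = "matrix_monoid (real_copy \<kappa>) n"
  define \<delta> :: "'i \<Rightarrow> 'i \<Rightarrow> real" where "\<delta> = (\<lambda>k j. if j = k then 1 else 0)"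
  have [simp]: "the_inv \<kappa> (\<kappa> x) = x" for x by (rule the_inv_f_f[OF \<kappa>])
  have bI: "b i \<in> I" if "i < n" for i using b that by (auto simp: bij_betw_def)
  have expand: "x = (\<lambda>i. \<Sum>k\<in>I. x k * \<delta> k i)" if "\<And>i. i \<notin> I \<Longrightarrow> x i = 0" for x
    using that finI by (auto simp: \<delta>_def fun_eq_iff if_distrib cong: if_cong)
  define m where "m g = (\<lambda>(i, j)\<in>{..<n} \<times> {..<n}. \<kappa> (\<rho> g (\<delta> (b j)) (b i)))" for g
  have mM: "m g \<in> carrier ?M" for g
    by (auto simp: m_def matrix_monoid_def real_copy_def)
  have mmult: "m (g \<otimes>\<^bsub>G\<^esub> h) = m g \<otimes>\<^bsub>?M\<^esub> m h" if g: "g \<in> carrier G" and h: "h \<in> carrier G" for g h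
  proof -
    \<comment> \<open>Matrix multiplication: expand the column
      \<open>\<rho> h (\<delta> (b j))\<close> in the basis, then apply linearity of
      \<open>\<rho> g\<close>.\<close>
    have *: "\<rho> (g \<otimes>\<^bsub>G\<^esub> h) (\<delta> (b j)) (b i) = (\<Sum>k<n. \<rho> g (\<delta> (b k)) (b i) * \<rho> h (\<delta> (b j)) (b k))"
      if "i < n" "j < n" for i j
    proof -
      let ?x = "\<rho> h (\<delta> (b j))"
      have "?x l = 0" if "l \<notin> I" for l
        by (rule linear_op_supp[OF faithful_rep_linear_op[OF rep h] _ that])
          (use \<open>j < n\<close> bI in \<open>auto simp: \<delta>_def\<close>)
      then have "\<rho> g ?x = \<rho> g (\<lambda>i. \<Sum>k\<in>I. ?x k * \<delta> k i)" using expand[of ?x] by simp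
      also have "\<dots> = (\<lambda>i. \<Sum>k\<in>I. ?x k * \<rho> g (\<delta> k) i)"
        by (rule linear_op_sum[OF faithful_rep_linear_op[OF rep g] finI])
      finally have "\<rho> g ?x (b i) = (\<Sum>k\<in>I. ?x k * \<rho> g (\<delta> k) (b i))" by simp
      also have "\<dots> = (\<Sum>k<n. ?x (b k) * \<rho> g (\<delta> (b k)) (b i))"
        using sum.reindex_bij_betw[OF b, of "\<lambda>k. ?x k * \<rho> g (\<delta> k) (b i)"] by simp
      finally show ?thesis by (simp add: faithful_rep_mult[OF rep g h] mult.commute)
    qed
    show ?thesis
    proof
      fix ij :: "nat \<times> nat"
      obtain i j where ij: "ij = (i, j)" by force
      show "m (g \<otimes>\<^bsub>G\<^esub> h) ij = (m g \<otimes>\<^bsub>?M\<^esub> m h) ij"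
      proof (cases "i < n \<and> j < n")
        case True
        have "(m g \<otimes>\<^bsub>?M\<^esub> m h) ij
          = (\<Oplus>\<^bsub>?K\<^esub>k\<in>{..<n}. \<kappa> (\<rho> g (\<delta> (b k)) (b i) * \<rho> h (\<delta> (b j)) (b k)))"
          using True unfolding ij matrix_monoid_def
          by (simp, intro abelian_monoid.finsum_cong' abelian_group.axioms ring.is_abelian_group
              cring.axioms(1) domain.axioms field.axioms field_real_copy \<kappa> refl)
            (auto simp: m_def real_copy_def)
        then show ?thesis using True * by (simp add: finsum_real_copy[OF \<kappa>] ij m_def)
      next
        case False
        then show ?thesis by (auto simp: ij m_def matrix_monoid_def)
      qed
    qed
  qed
  have mone: "m \<one>\<^bsub>G\<^esub> = \<one>\<^bsub>?M\<^esub>"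
    using b by (auto simp: m_def matrix_monoid_def fun_eq_iff real_copy_def faithful_rep_one[OF rep G]
        \<delta>_def bij_betw_def inj_on_def)
  have "m g \<in> Units ?M" if g: "g \<in> carrier G" for g
  proof -
    have "m g \<otimes>\<^bsub>?M\<^esub> m (inv\<^bsub>G\<^esub> g) = \<one>\<^bsub>?M\<^esub>" "m (inv\<^bsub>G\<^esub> g) \<otimes>\<^bsub>?M\<^esub> m g = \<one>\<^bsub>?M\<^esub>"
      using g G mmult[symmetric] mone by (simp_all add: group.inv_closed group.r_inv group.l_inv)
    then show ?thesis using mM unfolding Units_def by blast
  qed
  then have hom: "m \<in> hom G (GL ?K n)"
    using mmult by (auto simp: hom_def GL_def units_of_def)
  have "inj_on m (carrier G)"
  proof (rule inj_onI)
    fix g h assume gh: "g \<in> carrier G" "h \<in> carrier G" "m g = m h"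
    let ?k = "g \<otimes>\<^bsub>G\<^esub> inv\<^bsub>G\<^esub> h"
    have k: "?k \<in> carrier G" using gh G by (simp add: group.is_monoid monoid.m_closed group.inv_closed)
    have hi: "inv\<^bsub>G\<^esub> h \<in> carrier G" using gh G by (simp add: group.inv_closed)
    have "m ?k = m h \<otimes>\<^bsub>?M\<^esub> m (inv\<^bsub>G\<^esub> h)" using gh hi by (simp add: mmult)
    also have "\<dots> = m \<one>\<^bsub>G\<^esub>" using gh hi G by (simp add: mmult[symmetric] group.r_inv)
    finally have mk: "m ?k = m \<one>\<^bsub>G\<^esub>" .
    have col: "\<rho> ?k (\<delta> j) = \<delta> j" if "j \<in> I" for j
    proof
      fix i
      show "\<rho> ?k (\<delta> j) i = \<delta> j i"
      proof (cases "i \<in> I")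
        case True
        have "i \<in> b ` {..<n}" "j \<in> b ` {..<n}"
          using True \<open>j \<in> I\<close> b by (auto simp: bij_betw_def)
        then obtain i' j' where "i' < n" "b i' = i" "j' < n" "b j' = j" by auto
        then show ?thesis using fun_cong[OF mk, of "(i', j')"] \<kappa>
          by (auto simp: m_def faithful_rep_one[OF rep G] dest: injD)
      next
        case False
        have "\<rho> ?k (\<delta> j) i = 0"
          by (rule linear_op_supp[OF faithful_rep_linear_op[OF rep k] _ False])
            (use that in \<open>auto simp: \<delta>_def\<close>)
        then show ?thesis using False that by (auto simp: \<delta>_def)
      qed
    qed
    have "\<rho> ?k x = x" if "\<forall>i. i \<notin> I \<longrightarrow> x i = 0" for x
    proof -
      have x: "x = (\<lambda>i. \<Sum>k\<in>I. x k * \<delta> k i)" using expand[of x] that by blast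
      have "\<rho> ?k x = \<rho> ?k (\<lambda>i. \<Sum>k\<in>I. x k * \<delta> k i)" using x by simp
      also have "\<dots> = (\<lambda>i. \<Sum>k\<in>I. x k * \<rho> ?k (\<delta> k) i)"
        by (rule linear_op_sum[OF faithful_rep_linear_op[OF rep k] finI])
      also have "\<dots> = x" using x col by simp
      finally show ?thesis .
    qed
    then have "?k = \<one>\<^bsub>G\<^esub>" using rep k by (simp add: faithful_rep_def)
    then show "g = h" using gh G by (metis group.inv_equality group.inv_inv group.inv_closed)
  qed
  then have "mon G (GL ?K n) \<noteq> {}" using hom by (auto simp: mon_def)
  then show ?thesis unfolding linear_group_def using field_real_copy[OF \<kappa>] by blast
qed

text \<open>The elements of a graph product are sets of words. Lists are told apart by their lengths
  even over a one-element type, so sets of naturals, and with them the reals, embed into sets of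
  lists.\<close>

lemma inj_real_list_set: "\<exists>\<kappa> :: real \<Rightarrow> 'c list set list. inj \<kappa>"
proof -
  obtain f :: "nat set \<Rightarrow> real" where "bij f"
    using nat_sets_eqpoll_reals by (auto simp: eqpoll_def)
  then have f: "inj (inv_into UNIV f)" by (simp add: bij_imp_bij_inv bij_is_inj)
  have inj: "inj (\<lambda>n. replicate n (undefined :: 'c))" by (metis injI length_replicate)
  have "inj (\<lambda>r. [(\<lambda>n. replicate n (undefined :: 'c)) ` inv_into UNIV f r])"
    using f by (auto simp: inj_def inj_image_eq_iff[OF inj])
  then show ?thesis by blast
qed

section \<open>Representations of graph products of pairs\<close>

text \<open>\<open>lam\<close> is a coroot for the root \<open>u\<close>: the value 2 makes x -
  lam(x) u an involution, which commutes with \<open>A\<close>. The bound -2 on the translates of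
  \<open>u\<close> by elements outside \<open>A\<close> drives the ping-pong argument, and
  \<open>phi\<close> is an invariant measure of size.\<close>

definition pair_rep :: "('a, 'm) monoid_scheme \<Rightarrow> 'a set \<Rightarrow> 'i set \<Rightarrow> ('a \<Rightarrow> ('i \<Rightarrow> real) \<Rightarrow> 'i \<Rightarrow> real)
    \<Rightarrow> ('i \<Rightarrow> real) \<Rightarrow> (('i \<Rightarrow> real) \<Rightarrow> real) \<Rightarrow> (('i \<Rightarrow> real) \<Rightarrow> real) \<Rightarrow> bool"
  where "pair_rep G A I \<rho> u lam phi \<longleftrightarrow> faithful_rep G I \<rho> \<and>
    linear_functional lam \<and> linear_functional phi \<and>
    (\<forall>i. i \<notin> I \<longrightarrow> u i = 0) \<and> phi u = 1 \<and> lam u = 2 \<and>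
    (\<forall>g\<in>carrier G. \<forall>x. phi (\<rho> g x) = phi x) \<and>
    (\<forall>a\<in>A. \<rho> a u = u \<and> (\<forall>x. lam (\<rho> a x) = lam x)) \<and>
    (\<forall>g\<in>carrier G - A. lam (\<rho> g u) \<le> - 2)"

lemma linear_functional_add: "linear_functional f \<Longrightarrow> f (\<lambda>i. x i + y i) = f x + f y"
  and linear_functional_scale: "linear_functional f \<Longrightarrow> f (\<lambda>i. c * x i) = c * f x"
  by (auto simp: linear_functional_def)

lemma linear_functional_diff: "linear_functional f \<Longrightarrow> f (\<lambda>i. x i - c * y i) = f x - c * f y"
  using linear_functional_add[of f x "\<lambda>i. (- c) * y i"] linear_functional_scale[of f "- c" y] by simp

lemma linear_functional_zero: "linear_functional f \<Longrightarrow> f (\<lambda>i. 0) = 0"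
  using linear_functional_scale[of f 0 "\<lambda>i. 0"] by simp

lemma linear_op_diff: "linear_op I T \<Longrightarrow> T (\<lambda>i. x i - c * y i) = (\<lambda>i. T x i - c * T y i)"
  using linear_op_add[of I T x "\<lambda>i. (- c) * y i"] linear_op_scale[of I T "- c" y] by simp

text \<open>An occurrence of \<open>v\<close> commutes with everything before it, so its syllable
  can be brought to the front. When \<open>E\<close> is irreflexive, this can only be the first
  occurrence of \<open>v\<close>.\<close>

definition descent :: "'v rel \<Rightarrow> 'v \<Rightarrow> 'v list \<Rightarrow> bool"
  where "descent E v vs \<longleftrightarrow> (\<exists>us ws. vs = us @ v # ws \<and> (\<forall>w\<in>set us. (v, w) \<in> E))"

lemma descent_Cons_self: "descent E v (v # vs)"
  unfolding descent_def by (intro exI[of _ "[]"] exI[of _ vs]) simp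

lemma descent_Cons: "descent E v vs \<Longrightarrow> (v, w) \<in> E \<Longrightarrow> descent E v (w # vs)"
  unfolding descent_def by (metis append_Cons set_ConsD)

locale graph_pair_rep =
  fixes V :: "'v set" and E :: "'v rel" and G :: "'v \<Rightarrow> 'a monoid" and A :: "'v \<Rightarrow> 'a set"
    and I :: "'v \<Rightarrow> 'i set" and \<rho> :: "'v \<Rightarrow> 'a \<Rightarrow> ('i \<Rightarrow> real) \<Rightarrow> 'i \<Rightarrow> real"
    and u :: "'v \<Rightarrow> 'i \<Rightarrow> real" and lam phi :: "'v \<Rightarrow> ('i \<Rightarrow> real) \<Rightarrow> real"
  assumes graph: "finite_graph V E"
    and grp: "\<And>v. v \<in> V \<Longrightarrow> group (G v)"
    and sub: "\<And>v. v \<in> V \<Longrightarrow> subgroup (A v) (G v)"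
    and rep: "\<And>v. v \<in> V \<Longrightarrow> pair_rep (G v) (A v) (I v) (\<rho> v) (u v) (lam v) (phi v)"
begin

definition comp :: "'v \<Rightarrow> (('v \<times> 'i) option \<Rightarrow> real) \<Rightarrow> 'i \<Rightarrow> real"
  where "comp v y = (\<lambda>i. y (Some (v, i)))"

definition far :: "'v \<Rightarrow> 'v set"
  where "far v = {w \<in> V. w \<noteq> v \<and> (v, w) \<notin> E}"

text \<open>The coroot of \<open>u v\<close> on the whole space. Vertices not joined to
  \<open>v\<close> couple with the Tits coefficient -2, vertices joined to it with 0. The coordinate
  \<open>None\<close> is that of f and behaves like a further vertex joined to no other.\<close>

definition Lam :: "'v \<Rightarrow> (('v \<times> 'i) option \<Rightarrow> real) \<Rightarrow> real"
  where "Lam v y = lam v (comp v y) - 2 * (\<Sum>w\<in>far v. phi w (comp w y)) - 2 * y None"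

text \<open>All reflections in \<open>u v\<close>, v \<in> S, are performed at once, with every
  \<open>Lam v\<close> evaluated at the original vector. For a clique this is the product of
  commuting reflections.\<close>

definition refl :: "'v set \<Rightarrow> (('v \<times> 'i) option \<Rightarrow> real) \<Rightarrow> ('v \<times> 'i) option \<Rightarrow> real"
  where "refl S y = (\<lambda>j. case j of None \<Rightarrow> y None
    | Some (v, i) \<Rightarrow> if v \<in> S then comp v y i - Lam v y * u v i else comp v y i)"

definition diag :: "('v \<Rightarrow> 'a) \<Rightarrow> (('v \<times> 'i) option \<Rightarrow> real) \<Rightarrow> ('v \<times> 'i) option \<Rightarrow> real"
  where "diag x y = (\<lambda>j. case j of None \<Rightarrow> y None
    | Some (v, i) \<Rightarrow> if v \<in> V then \<rho> v (x v) (comp v y) i else comp v y i)"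

definition rop :: "'v set \<Rightarrow> ('v \<Rightarrow> 'a) \<Rightarrow> (('v \<times> 'i) option \<Rightarrow> real) \<Rightarrow> ('v \<times> 'i) option \<Rightarrow> real"
  where "rop S x = refl S \<circ> diag x \<circ> refl S"

definition J :: "('v \<times> 'i) option set"
  where "J = insert None (Some ` (SIGMA v:V. I v))"

abbreviation "K \<equiv> complete_subgraphs V E"
abbreviation "GC \<equiv> clique_group V G A"
abbreviation "P \<equiv> graph_product_of_pairs V E G A"
abbreviation "\<iota> \<equiv> colimit_inj K (\<subseteq>) GC (\<lambda>S T x. x)"

lemma finV: "finite V" and E_sub: "E \<subseteq> V \<times> V" and symE: "sym E" and irrE: "(v, v) \<notin> E"
  using graph by (auto simp: finite_graph_def irrefl_def)

lemma fin_far: "finite (far v)"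
  using finV by (simp add: far_def)

lemma faithful: "v \<in> V \<Longrightarrow> faithful_rep (G v) (I v) (\<rho> v)"
  and lin_lam: "v \<in> V \<Longrightarrow> linear_functional (lam v)"
  and lin_phi: "v \<in> V \<Longrightarrow> linear_functional (phi v)"
  and u_supp: "v \<in> V \<Longrightarrow> i \<notin> I v \<Longrightarrow> u v i = 0"
  and phi_u: "v \<in> V \<Longrightarrow> phi v (u v) = 1"
  and lam_u: "v \<in> V \<Longrightarrow> lam v (u v) = 2"
  and phi_inv: "v \<in> V \<Longrightarrow> g \<in> carrier (G v) \<Longrightarrow> phi v (\<rho> v g z) = phi v z"
  and A_u: "v \<in> V \<Longrightarrow> a \<in> A v \<Longrightarrow> \<rho> v a (u v) = u v"
  and A_lam: "v \<in> V \<Longrightarrow> a \<in> A v \<Longrightarrow> lam v (\<rho> v a z) = lam v z"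
  and sep: "v \<in> V \<Longrightarrow> g \<in> carrier (G v) \<Longrightarrow> g \<notin> A v \<Longrightarrow> lam v (\<rho> v g (u v)) \<le> - 2"
  using rep[of v] by (auto simp: pair_rep_def)

lemma lin_\<rho>: "v \<in> V \<Longrightarrow> g \<in> carrier (G v) \<Longrightarrow> linear_op (I v) (\<rho> v g)"
  and \<rho>_mult: "v \<in> V \<Longrightarrow> g \<in> carrier (G v) \<Longrightarrow> h \<in> carrier (G v) \<Longrightarrow> \<rho> v (g \<otimes>\<^bsub>G v\<^esub> h) z = \<rho> v g (\<rho> v h z)"
  and \<rho>_one: "v \<in> V \<Longrightarrow> \<rho> v \<one>\<^bsub>G v\<^esub> z = z"
  using faithful[of v] grp[of v]
  by (auto simp: faithful_rep_linear_op faithful_rep_mult faithful_rep_one)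

lemma A_carrier: "v \<in> V \<Longrightarrow> a \<in> A v \<Longrightarrow> a \<in> carrier (G v)"
  using sub[of v] by (auto dest: subgroup.mem_carrier)

lemma one_A: "v \<in> V \<Longrightarrow> \<one>\<^bsub>G v\<^esub> \<in> A v"
  using sub[of v] by (auto dest: subgroup.one_closed)

lemma mult_carrier: "v \<in> V \<Longrightarrow> g \<in> carrier (G v) \<Longrightarrow> h \<in> carrier (G v) \<Longrightarrow> g \<otimes>\<^bsub>G v\<^esub> h \<in> carrier (G v)"
  using grp[of v] by (simp add: group.is_monoid monoid.m_closed)

lemma comp_eqI: "y None = y' None \<Longrightarrow> (\<And>v. comp v y = comp v y') \<Longrightarrow> y = y'"
proof (rule ext)
  fix j assume *: "y None = y' None" "\<And>v. comp v y = comp v y'"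
  show "y j = y' j"
  proof (cases j)
    case (Some p)
    then show ?thesis using fun_cong[OF *(2)[of "fst p"], of "snd p"] by (simp add: comp_def)
  qed (simp add: *)
qed

lemma clique_carrier: "x \<in> carrier (GC S) \<longleftrightarrow>
  x \<in> extensional V \<and> (\<forall>v\<in>V. if v \<in> S then x v \<in> carrier (G v) else x v \<in> A v)"
  by (auto simp: clique_group_def PiE_def Pi_def split: if_splits)

lemma clique_carrier_G: "x \<in> carrier (GC S) \<Longrightarrow> v \<in> V \<Longrightarrow> x v \<in> carrier (G v)"
  using A_carrier by (auto simp: clique_carrier split: if_splits)

lemma clique_mult: "v \<in> V \<Longrightarrow> (x \<otimes>\<^bsub>GC S\<^esub> y) v = x v \<otimes>\<^bsub>G v\<^esub> y v"
  by (auto simp: clique_group_def)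

lemma clique_one: "v \<in> V \<Longrightarrow> \<one>\<^bsub>GC S\<^esub> v = \<one>\<^bsub>G v\<^esub>"
  by (auto simp: clique_group_def)

lemma group_GC: "group (GC S)"
  by (rule group_clique_group) (auto simp: grp sub)

lemma group_P: "group P"
  by (rule group_graph_product_of_pairs) (auto simp: grp sub)

lemma clique_subset: "S \<in> K \<Longrightarrow> S \<subseteq> V"
  by (simp add: complete_subgraphs_def)

lemma clique_far: "S \<in> K \<Longrightarrow> v \<in> S \<Longrightarrow> w \<in> far v \<Longrightarrow> w \<notin> S"
  by (auto simp: complete_subgraphs_def far_def)

lemma comp_refl: "comp v (refl S y) = (if v \<in> S then \<lambda>i. comp v y i - Lam v y * u v i else comp v y)"
  and None_refl: "refl S y None = y None"
  and comp_diag: "comp v (diag x y) = (if v \<in> V then \<rho> v (x v) (comp v y) else comp v y)"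
  and None_diag: "diag x y None = y None"
  by (auto simp: comp_def refl_def diag_def)

text \<open>A clique contains no vertex far from \<open>v\<close>, so only the summand
  \<open>lam v\<close> of \<open>Lam v\<close> changes, and \<open>lam v (u v) = 2\<close> reverses
  the sign.\<close>

lemma Lam_refl:
  assumes "S \<in> K" "v \<in> S" shows "Lam v (refl S y) = - Lam v y"
proof -
  have v: "v \<in> V" using assms clique_subset by blast
  have "(\<Sum>w\<in>far v. phi w (comp w (refl S y))) = (\<Sum>w\<in>far v. phi w (comp w y))"
    using clique_far[OF assms] by (simp add: comp_refl)
  then show ?thesis using assms(2) v
    by (simp add: Lam_def[of v "refl S y"] comp_refl None_refl linear_functional_diff[OF lin_lam] lam_u)
       (simp add: Lam_def)
qed

lemma refl_refl: "S \<in> K \<Longrightarrow> refl S (refl S y) = y"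
  by (rule comp_eqI) (auto simp: comp_refl None_refl Lam_refl)

lemma diag_mult:
  "x \<in> carrier (GC S) \<Longrightarrow> x' \<in> carrier (GC S) \<Longrightarrow> diag (x \<otimes>\<^bsub>GC S\<^esub> x') y = diag x (diag x' y)"
  by (rule comp_eqI) (auto simp: comp_diag None_diag clique_mult \<rho>_mult clique_carrier_G)

lemma rop_mult: "S \<in> K \<Longrightarrow> x \<in> carrier (GC S) \<Longrightarrow> x' \<in> carrier (GC S)
  \<Longrightarrow> rop S (x \<otimes>\<^bsub>GC S\<^esub> x') = rop S x \<circ> rop S x'"
  by (auto simp: rop_def diag_mult refl_refl)

lemma rop_one: "S \<in> K \<Longrightarrow> rop S \<one>\<^bsub>GC S\<^esub> = id"
proof -
  assume S: "S \<in> K"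
  have "diag \<one>\<^bsub>GC S\<^esub> y = y" for y
    by (rule comp_eqI) (auto simp: comp_diag None_diag clique_one \<rho>_one)
  then show ?thesis using S by (auto simp: rop_def refl_refl)
qed

lemma None_rop: "rop S x y None = y None"
  by (simp add: rop_def None_refl None_diag)

text \<open>The outer reflection evaluates \<open>Lam v\<close> at the intermediate vector. Its
  \<open>phi\<close> terms can still be read off from \<open>y\<close>: far vertices lie outside the
  clique, so they are not reflected there, and \<open>phi\<close> is invariant.\<close>

lemma comp_rop:
  assumes S: "S \<in> K" and x: "x \<in> carrier (GC S)" and v: "v \<in> V"
  shows "comp v (rop S x y) = (let z = \<rho> v (x v) (\<lambda>i. comp v y i - Lam v y * u v i) in
    if v \<in> S then (\<lambda>i. z i - (lam v z - 2 * (\<Sum>w\<in>far v. phi w (comp w y)) - 2 * y None) * u v i)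
    else \<rho> v (x v) (comp v y))"
proof -
  have "phi w (comp w (diag x (refl S y))) = phi w (comp w y)" if "v \<in> S" "w \<in> far v" for w
    using clique_far[OF S that] that x
    by (auto simp: comp_diag comp_refl far_def phi_inv clique_carrier_G)
  then show ?thesis using v
    by (auto simp: rop_def comp_refl comp_diag Lam_def[of v "diag x (refl S y)"] None_diag None_refl Let_def)
qed

lemma clique_mono: "S \<subseteq> T \<Longrightarrow> x \<in> carrier (GC S) \<Longrightarrow> x \<in> carrier (GC T)"
  by (auto simp: clique_carrier A_carrier split: if_splits)

text \<open>For v \<in> T - S the entry \<open>x v\<close> lies in \<open>A v\<close>; it fixes
  \<open>u v\<close> and \<open>lam v\<close>, hence commutes with the reflection at
  \<open>v\<close>, whose two occurrences cancel. This is the compatibility that lets the operators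
  pass to the colimit.\<close>

lemma rop_mono:
  assumes S: "S \<in> K" and T: "T \<in> K" and sub: "S \<subseteq> T" and x: "x \<in> carrier (GC S)"
  shows "rop T x = rop S x"
proof
  fix y
  have xT: "x \<in> carrier (GC T)" by (rule clique_mono[OF sub x])
  show "rop T x y = rop S x y"
  proof (rule comp_eqI)
    fix v
    show "comp v (rop T x y) = comp v (rop S x y)"
    proof (cases "v \<in> V")
      case v: True
      show ?thesis
      proof (cases "v \<in> T - S")
        case True
        then have a: "x v \<in> A v" using x v by (auto simp: clique_carrier)
        have lin: "linear_op (I v) (\<rho> v (x v))" using a v A_carrier lin_\<rho> by blast
        show ?thesis using True v
          unfolding comp_rop[OF S x v] comp_rop[OF T xT v]
          by (simp add: Let_def linear_op_diff[OF lin] A_u[OF v a] linear_functional_diff[OF lin_lam]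
              A_lam[OF v a] lam_u Lam_def) (simp add: algebra_simps)
      next
        case False
        then have "v \<in> T \<longleftrightarrow> v \<in> S" using sub by blast
        then show ?thesis unfolding comp_rop[OF S x v] comp_rop[OF T xT v] by simp
      qed
    next
      case False
      then show ?thesis using clique_subset[OF S] clique_subset[OF T]
        by (auto simp: rop_def comp_refl comp_diag)
    qed
  qed (simp add: None_rop)
qed

lemma comp_add: "comp v (\<lambda>i. x i + y i) = (\<lambda>i. comp v x i + comp v y i)"
  and comp_scale: "comp v (\<lambda>i. c * x i) = (\<lambda>i. c * comp v x i)"
  by (auto simp: comp_def)

lemma Lam_add: "v \<in> V \<Longrightarrow> Lam v (\<lambda>i. x i + y i) = Lam v x + Lam v y"
  and Lam_scale: "v \<in> V \<Longrightarrow> Lam v (\<lambda>i. c * x i) = c * Lam v x"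
proof -
  assume v: "v \<in> V"
  have [simp]: "w \<in> V" if "w \<in> far v" for w using that by (simp add: far_def)
  show "Lam v (\<lambda>i. x i + y i) = Lam v x + Lam v y" "Lam v (\<lambda>i. c * x i) = c * Lam v x"
    using v by (simp_all add: Lam_def comp_add comp_scale linear_functional_add[OF lin_lam]
        linear_functional_add[OF lin_phi] linear_functional_scale[OF lin_lam]
        linear_functional_scale[OF lin_phi] sum.distrib algebra_simps sum_distrib_left)
qed

lemma notin_J: "j \<notin> J \<Longrightarrow> \<exists>v i. j = Some (v, i) \<and> (v \<notin> V \<or> i \<notin> I v)"
  by (cases j) (force simp: J_def)+

lemma lin_refl:
  assumes S: "S \<subseteq> V" shows "linear_op J (refl S)"
  unfolding linear_op_def
proof (intro conjI allI impI)
  fix x y :: "('v \<times> 'i) option \<Rightarrow> real" and c :: real and j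
  show "refl S (\<lambda>i. x i + y i) = (\<lambda>i. refl S x i + refl S y i)"
    using S by (intro comp_eqI)
      (auto simp: comp_refl None_refl comp_add Lam_add algebra_simps dest: subsetD)
  show "refl S (\<lambda>i. c * x i) = (\<lambda>i. c * refl S x i)"
    using S by (intro comp_eqI)
      (auto simp: comp_refl None_refl comp_scale Lam_scale algebra_simps dest: subsetD)
  assume x: "\<forall>i. i \<notin> J \<longrightarrow> x i = 0" and j: "j \<notin> J"
  then obtain v i where "j = Some (v, i)" "v \<notin> V \<or> i \<notin> I v"
    using notin_J by blast
  then show "refl S x j = 0" using x j S u_supp by (auto simp: refl_def comp_def)
qed

lemma lin_diag:
  assumes x: "\<And>v. v \<in> V \<Longrightarrow> x v \<in> carrier (G v)" shows "linear_op J (diag x)"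
  unfolding linear_op_def
proof (intro conjI allI impI)
  fix y z :: "('v \<times> 'i) option \<Rightarrow> real" and c :: real and j
  note l = lin_\<rho>[OF _ x]
  show "diag x (\<lambda>i. y i + z i) = (\<lambda>i. diag x y i + diag x z i)"
    by (intro comp_eqI) (auto simp: comp_diag None_diag comp_add linear_op_add[OF l])
  show "diag x (\<lambda>i. c * y i) = (\<lambda>i. c * diag x y i)"
    by (intro comp_eqI) (auto simp: comp_diag None_diag comp_scale linear_op_scale[OF l])
  assume y: "\<forall>i. i \<notin> J \<longrightarrow> y i = 0" and j: "j \<notin> J"
  then obtain v i where vi: "j = Some (v, i)" "v \<notin> V \<or> i \<notin> I v"
    using notin_J by blast
  have "\<rho> v (x v) (comp v y) i = 0" if "v \<in> V"
    by (rule linear_op_supp[OF l[OF that that]]) (use vi that y in \<open>auto simp: comp_def J_def\<close>)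
  then show "diag x y j = 0" using vi y j by (auto simp: diag_def comp_def)
qed

lemma rop_op_group: "S \<in> K \<Longrightarrow> rop S \<in> hom (GC S) (op_group J)"
proof (rule homI)
  fix x x' assume S: "S \<in> K" and x: "x \<in> carrier (GC S)"
  have lin: "linear_op J (rop S y)" if "y \<in> carrier (GC S)" for y
    using that S clique_subset[OF S] clique_carrier_G
    by (auto simp: rop_def intro!: linear_op_comp lin_refl lin_diag)
  let ?x' = "inv\<^bsub>GC S\<^esub> x"
  have x': "?x' \<in> carrier (GC S)" using x group_GC by (simp add: group.inv_closed)
  have "rop S x \<circ> rop S ?x' = id" "rop S ?x' \<circ> rop S x = id"
    using x x' S by (simp_all add: rop_mult[symmetric] group.r_inv[OF group_GC] group.l_inv[OF group_GC] rop_one)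
  then show "rop S x \<in> carrier (op_group J)" using lin[OF x] lin[OF x'] by (auto simp: op_group_def)
  assume "x' \<in> carrier (GC S)"
  then show "rop S (x \<otimes>\<^bsub>GC S\<^esub> x') = rop S x \<otimes>\<^bsub>op_group J\<^esub> rop S x'"
    using x S by (simp add: rop_mult op_group_def)
qed

lemma ex_rep: "\<exists>R. R \<in> hom P (op_group J) \<and> (\<forall>S\<in>K. \<forall>x\<in>carrier (GC S). R (\<iota> S x) = rop S x)"
proof -
  have "\<exists>!h. h \<in> hom (group_colimit K (\<subseteq>) GC (\<lambda>S T x. x)) (op_group J) \<inter>
      extensional (carrier (group_colimit K (\<subseteq>) GC (\<lambda>S T x. x)))
    \<and> (\<forall>S\<in>K. \<forall>x\<in>carrier (GC S). h (\<iota> S x) = rop S x)"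
    by (rule colimit_universal[OF group_GC group_op_group rop_op_group])
      (assumption, rule rop_mono)
  from ex1_implies_ex[OF this] show ?thesis
    unfolding graph_product_of_pairs_def by (elim exE conjE IntE) (intro exI conjI)
qed

definition R :: "('v set \<times> ('v \<Rightarrow> 'a)) list set \<Rightarrow> (('v \<times> 'i) option \<Rightarrow> real) \<Rightarrow> ('v \<times> 'i) option \<Rightarrow> real"
  where "R = (SOME R. R \<in> hom P (op_group J) \<and> (\<forall>S\<in>K. \<forall>x\<in>carrier (GC S). R (\<iota> S x) = rop S x))"

lemma R_hom: "R \<in> hom P (op_group J)"
  and R_inj: "S \<in> K \<Longrightarrow> x \<in> carrier (GC S) \<Longrightarrow> R (\<iota> S x) = rop S x"
  using someI_ex[OF ex_rep] unfolding R_def[symmetric] by simp_all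

lemma R_mult: "X \<in> carrier P \<Longrightarrow> Y \<in> carrier P \<Longrightarrow> R (X \<otimes>\<^bsub>P\<^esub> Y) y = R X (R Y y)"
  using hom_mult[OF R_hom] by (simp add: op_group_def)


section \<open>Words in the vertex groups and their reduction\<close>

definition single :: "'v \<Rightarrow> 'a \<Rightarrow> 'v \<Rightarrow> 'a"
  where "single v g = (\<lambda>w\<in>V. if w = v then g else \<one>\<^bsub>G w\<^esub>)"

abbreviation letter :: "'v \<Rightarrow> 'a \<Rightarrow> ('v set \<times> ('v \<Rightarrow> 'a)) list set"
  where "letter v g \<equiv> \<iota> {v} (single v g)"

definition word :: "('v \<times> 'a) list \<Rightarrow> ('v set \<times> ('v \<Rightarrow> 'a)) list set"
  where "word L = foldr (\<lambda>(v, g) X. letter v g \<otimes>\<^bsub>P\<^esub> X) L \<one>\<^bsub>P\<^esub>"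

abbreviation syllables :: "('v \<times> 'a) set"
  where "syllables \<equiv> (SIGMA v:V. carrier (G v))"

lemma word_Nil: "word [] = \<one>\<^bsub>P\<^esub>"
  and word_Cons: "word ((v, g) # L) = letter v g \<otimes>\<^bsub>P\<^esub> word L"
  by (auto simp: word_def)

lemma K_empty: "{} \<in> K" and K_single: "v \<in> V \<Longrightarrow> {v} \<in> K"
  by (auto simp: complete_subgraphs_def)

lemma one_carrier: "v \<in> V \<Longrightarrow> \<one>\<^bsub>G v\<^esub> \<in> carrier (G v)"
  using grp[of v] by (simp add: group.is_monoid monoid.one_closed)

lemma single_carrier: "(v, g) \<in> syllables \<Longrightarrow> v \<in> S \<Longrightarrow> single v g \<in> carrier (GC S)"
  and single_carrier_A: "v \<in> V \<Longrightarrow> g \<in> A v \<Longrightarrow> single v g \<in> carrier (GC S)"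
  by (auto simp: clique_carrier single_def one_A one_carrier A_carrier)

lemma \<iota>_carrier: "S \<in> K \<Longrightarrow> x \<in> carrier (GC S) \<Longrightarrow> \<iota> S x \<in> carrier P"
  and \<iota>_mult: "S \<in> K \<Longrightarrow> x \<in> carrier (GC S) \<Longrightarrow> y \<in> carrier (GC S)
    \<Longrightarrow> \<iota> S (x \<otimes>\<^bsub>GC S\<^esub> y) = \<iota> S x \<otimes>\<^bsub>P\<^esub> \<iota> S y"
  using colimit_inj_hom[of K GC S "(\<subseteq>)" "\<lambda>S T x. x"] group_GC
  by (auto simp: hom_def graph_product_of_pairs_def)

lemma \<iota>_one: "S \<in> K \<Longrightarrow> \<iota> S \<one>\<^bsub>GC S\<^esub> = \<one>\<^bsub>P\<^esub>"
  using colimit_inj_hom[of K GC S "(\<subseteq>)" "\<lambda>S T x. x"] hom_one group_GC group_P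
  unfolding graph_product_of_pairs_def by blast

lemma \<iota>_mono: "S \<in> K \<Longrightarrow> T \<in> K \<Longrightarrow> S \<subseteq> T \<Longrightarrow> x \<in> carrier (GC S) \<Longrightarrow> \<iota> T x = \<iota> S x"
  using colimit_inj_transition[of K GC S T "(\<subseteq>)" x "\<lambda>S T x. x"] group_GC clique_mono by simp

lemma letter_mono: "(v, g) \<in> syllables \<Longrightarrow> T \<in> K \<Longrightarrow> v \<in> T \<Longrightarrow> \<iota> T (single v g) = letter v g"
  by (rule \<iota>_mono[OF K_single _ _ single_carrier]) auto

lemma letter_carrier: "(v, g) \<in> syllables \<Longrightarrow> letter v g \<in> carrier P"
  by (auto intro!: \<iota>_carrier K_single single_carrier)

lemma word_carrier: "set L \<subseteq> syllables \<Longrightarrow> word L \<in> carrier P"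
proof (induction L)
  case Nil
  then show ?case using group_P by (simp add: word_Nil group.is_monoid monoid.one_closed)
next
  case (Cons s L)
  then show ?case using letter_carrier group_P
    by (cases s) (auto simp: word_Cons group.is_monoid intro!: monoid.m_closed)
qed

lemma word_append: "set L \<subseteq> syllables \<Longrightarrow> set L' \<subseteq> syllables \<Longrightarrow> word (L @ L') = word L \<otimes>\<^bsub>P\<^esub> word L'"
proof (induction L)
  case Nil
  then show ?case using group_P word_carrier[of L'] by (simp add: word_Nil group.is_monoid monoid.l_one)
next
  case (Cons s L)
  obtain v g where s: "s = (v, g)" by force
  have "letter v g \<in> carrier P" "word L \<in> carrier P" "word L' \<in> carrier P"
    using Cons.prems s by (auto intro: letter_carrier word_carrier)
  then show ?case using Cons group_P by (simp add: s word_Cons group.is_monoid monoid.m_assoc)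
qed

lemma clique_eqI:
  "x \<in> extensional V \<Longrightarrow> y \<in> extensional V \<Longrightarrow> (\<And>v. v \<in> V \<Longrightarrow> x v = y v) \<Longrightarrow> x = y"
  by (rule extensionalityI)

lemma clique_ext: "x \<otimes>\<^bsub>GC S\<^esub> y \<in> extensional V" "\<one>\<^bsub>GC S\<^esub> \<in> extensional V" "single v g \<in> extensional V"
  by (auto simp: clique_group_def single_def)

lemma letter_mult: "(v, g) \<in> syllables \<Longrightarrow> (v, h) \<in> syllables \<Longrightarrow>
  letter v (g \<otimes>\<^bsub>G v\<^esub> h) = letter v g \<otimes>\<^bsub>P\<^esub> letter v h"
proof -
  assume *: "(v, g) \<in> syllables" "(v, h) \<in> syllables"
  have "single v (g \<otimes>\<^bsub>G v\<^esub> h) = single v g \<otimes>\<^bsub>GC {v}\<^esub> single v h"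
  proof (rule clique_eqI[OF clique_ext(3,1)])
    fix w assume w: "w \<in> V"
    then show "single v (g \<otimes>\<^bsub>G v\<^esub> h) w = (single v g \<otimes>\<^bsub>GC {v}\<^esub> single v h) w"
      using grp[OF w] by (simp add: clique_mult single_def group.is_monoid monoid.l_one monoid.one_closed)
  qed
  then show ?thesis using * by (simp add: \<iota>_mult K_single single_carrier)
qed

lemma letter_comm:
  assumes "(v, g) \<in> syllables" "(w, h) \<in> syllables" "(v, w) \<in> E"
  shows "letter v g \<otimes>\<^bsub>P\<^esub> letter w h = letter w h \<otimes>\<^bsub>P\<^esub> letter v g"
proof -
  have ne: "v \<noteq> w" using assms irrE by auto
  have K: "{v, w} \<in> K" using assms symE by (auto simp: complete_subgraphs_def dest: symD)
  have "single v g \<otimes>\<^bsub>GC {v, w}\<^esub> single w h = single w h \<otimes>\<^bsub>GC {v, w}\<^esub> single v g"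
  proof (rule clique_eqI[OF clique_ext(1,1)])
    fix x assume x: "x \<in> V"
    show "(single v g \<otimes>\<^bsub>GC {v, w}\<^esub> single w h) x = (single w h \<otimes>\<^bsub>GC {v, w}\<^esub> single v g) x"
      using grp[OF x] ne x assms
      by (auto simp: clique_mult single_def group.is_monoid monoid.l_one monoid.r_one monoid.one_closed)
  qed
  moreover have "\<iota> {v, w} (single v g) = letter v g" "\<iota> {v, w} (single w h) = letter w h"
    using assms by (simp_all add: letter_mono K)
  ultimately show ?thesis using K assms
    by (metis \<iota>_mult insertI1 insertI2 single_carrier)
qed

lemma letter_word_comm:
  assumes "(v, g) \<in> syllables" "set L \<subseteq> syllables" "\<forall>w\<in>set (map fst L). (v, w) \<in> E"
  shows "letter v g \<otimes>\<^bsub>P\<^esub> word L = word L \<otimes>\<^bsub>P\<^esub> letter v g"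
  using assms(2,3)
proof (induction L)
  case Nil
  then show ?case using group_P letter_carrier[OF assms(1)]
    by (simp add: word_Nil group.is_monoid monoid.l_one monoid.r_one)
next
  case (Cons s L)
  obtain w h where s: "s = (w, h)" by force
  interpret P: group P by (rule group_P)
  have c: "letter v g \<in> carrier P" "letter w h \<in> carrier P" "word L \<in> carrier P"
    using Cons.prems s assms by (auto intro!: letter_carrier word_carrier)
  have "letter v g \<otimes>\<^bsub>P\<^esub> word (s # L) = letter w h \<otimes>\<^bsub>P\<^esub> (letter v g \<otimes>\<^bsub>P\<^esub> word L)"
    using c letter_comm[of v g w h] assms(1) Cons.prems s by (simp add: word_Cons P.m_assoc[symmetric])
  then show ?case using c Cons s by (simp add: word_Cons P.m_assoc)
qed

text \<open>The base group, the product of all \<open>A v\<close>, normalises every vertex group: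
  moving \<open>a\<close> across a syllable at \<open>v\<close> conjugates the syllable by
  \<open>a v\<close>. The sequence of vertices is therefore preserved.\<close>

lemma push:
  assumes a: "a \<in> carrier (GC {})" and "set L \<subseteq> syllables"
  shows "\<exists>L'. set L' \<subseteq> syllables \<and> map fst L' = map fst L \<and> \<iota> {} a \<otimes>\<^bsub>P\<^esub> word L = word L' \<otimes>\<^bsub>P\<^esub> \<iota> {} a"
  using assms(2)
proof (induction L)
  case Nil
  then show ?case using group_P \<iota>_carrier[OF K_empty a]
    by (intro exI[of _ "[]"]) (simp add: word_Nil group.is_monoid monoid.l_one monoid.r_one)
next
  case (Cons s L)
  obtain v g where s: "s = (v, g)" by force
  interpret P: group P by (rule group_P)
  from Cons obtain L' where L': "set L' \<subseteq> syllables" "map fst L' = map fst L"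
    "\<iota> {} a \<otimes>\<^bsub>P\<^esub> word L = word L' \<otimes>\<^bsub>P\<^esub> \<iota> {} a" by auto
  have v: "v \<in> V" and g: "g \<in> carrier (G v)" using Cons.prems s by auto
  interpret Gv: group "G v" by (rule grp[OF v])
  have av: "a v \<in> carrier (G v)" by (rule clique_carrier_G[OF a v])
  define g' where "g' = a v \<otimes>\<^bsub>G v\<^esub> g \<otimes>\<^bsub>G v\<^esub> inv\<^bsub>G v\<^esub> a v"
  have g': "g' \<in> carrier (G v)" using av g by (simp add: g'_def)
  have a1: "a \<in> carrier (GC {v})" by (rule clique_mono[OF _ a]) simp
  have "a \<otimes>\<^bsub>GC {v}\<^esub> single v g = single v g' \<otimes>\<^bsub>GC {v}\<^esub> a"
  proof (rule clique_eqI[OF clique_ext(1,1)])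
    fix w assume w: "w \<in> V"
    interpret Gw: group "G w" by (rule grp[OF w])
    show "(a \<otimes>\<^bsub>GC {v}\<^esub> single v g) w = (single v g' \<otimes>\<^bsub>GC {v}\<^esub> a) w"
      using w av g clique_carrier_G[OF a w]
      by (auto simp: clique_mult single_def g'_def Gv.m_assoc)
  qed
  then have "\<iota> {v} a \<otimes>\<^bsub>P\<^esub> letter v g = letter v g' \<otimes>\<^bsub>P\<^esub> \<iota> {v} a"
    using v g g' a1 by (simp add: \<iota>_mult[symmetric] single_carrier K_single)
  moreover have "\<iota> {v} a = \<iota> {} a" by (rule \<iota>_mono[OF K_empty K_single[OF v] _ a]) simp
  ultimately have comm: "\<iota> {} a \<otimes>\<^bsub>P\<^esub> letter v g = letter v g' \<otimes>\<^bsub>P\<^esub> \<iota> {} a" by simp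
  have c: "\<iota> {} a \<in> carrier P" "letter v g \<in> carrier P" "letter v g' \<in> carrier P"
    "word L \<in> carrier P" "word L' \<in> carrier P"
    using v g g' Cons.prems L' a by (auto intro!: letter_carrier word_carrier \<iota>_carrier K_empty)
  have "\<iota> {} a \<otimes>\<^bsub>P\<^esub> word (s # L) = letter v g' \<otimes>\<^bsub>P\<^esub> (\<iota> {} a \<otimes>\<^bsub>P\<^esub> word L)"
    using c comm by (simp add: s word_Cons P.m_assoc[symmetric])
  also have "\<dots> = word ((v, g') # L') \<otimes>\<^bsub>P\<^esub> \<iota> {} a"
    using c by (simp add: L'(3) word_Cons P.m_assoc)
  finally show ?case using L' v g' s by (intro exI[of _ "(v, g') # L'"]) auto
qed

text \<open>The factor on the right collects what the syllables lose when they are absorbed into the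
  base group; by \<open>push\<close> it can always be kept at the end.\<close>

definition spelling :: "('v set \<times> ('v \<Rightarrow> 'a)) list set \<Rightarrow> ('v \<times> 'a) list \<Rightarrow> ('v \<Rightarrow> 'a) \<Rightarrow> bool"
  where "spelling X L a \<longleftrightarrow> set L \<subseteq> syllables \<and> a \<in> carrier (GC {}) \<and> X = word L \<otimes>\<^bsub>P\<^esub> \<iota> {} a"

lemma spelling_mult:
  assumes "spelling X L a" "spelling X' L' a'"
  shows "\<exists>L'' a''. length L'' = length L' \<and> spelling (X \<otimes>\<^bsub>P\<^esub> X') (L @ L'') a''"
proof -
  interpret P: group P by (rule group_P)
  have s: "set L \<subseteq> syllables" "set L' \<subseteq> syllables" "a \<in> carrier (GC {})" "a' \<in> carrier (GC {})"
    "X = word L \<otimes>\<^bsub>P\<^esub> \<iota> {} a" "X' = word L' \<otimes>\<^bsub>P\<^esub> \<iota> {} a'"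
    using assms by (auto simp: spelling_def)
  obtain L'' where L'': "set L'' \<subseteq> syllables" "map fst L'' = map fst L'"
    "\<iota> {} a \<otimes>\<^bsub>P\<^esub> word L' = word L'' \<otimes>\<^bsub>P\<^esub> \<iota> {} a" using push[OF s(3,2)] by blast
  have c: "word L \<in> carrier P" "word L' \<in> carrier P" "word L'' \<in> carrier P" "\<iota> {} a \<in> carrier P" "\<iota> {} a' \<in> carrier P"
    using s L'' by (auto intro!: word_carrier \<iota>_carrier K_empty)
  have "X \<otimes>\<^bsub>P\<^esub> X' = word L \<otimes>\<^bsub>P\<^esub> (\<iota> {} a \<otimes>\<^bsub>P\<^esub> word L') \<otimes>\<^bsub>P\<^esub> \<iota> {} a'"
    using c by (simp add: s(5,6) P.m_assoc)
  also have "\<dots> = word (L @ L'') \<otimes>\<^bsub>P\<^esub> \<iota> {} (a \<otimes>\<^bsub>GC {}\<^esub> a')"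
    using c s L'' by (simp add: word_append \<iota>_mult K_empty P.m_assoc)
  finally have "spelling (X \<otimes>\<^bsub>P\<^esub> X') (L @ L'') (a \<otimes>\<^bsub>GC {}\<^esub> a')"
    using s L'' group_GC[of "{}"] by (simp add: spelling_def group.is_monoid monoid.m_closed)
  moreover have "length L'' = length L'" using L''(2) by (metis length_map)
  ultimately show ?thesis by blast
qed

text \<open>One coordinate of the clique is split off at a time: \<open>x\<close> is the syllable
  \<open>x v\<close> times the element obtained by resetting coordinate \<open>v\<close> to the
  unit.\<close>

lemma ex_spelling_\<iota>:
  assumes "finite S" "S \<in> K" "x \<in> carrier (GC S)"
  shows "\<exists>L a. spelling (\<iota> S x) L a"
  using assms
proof (induction S arbitrary: x)
  case empty
  then show ?case using group_P \<iota>_carrier[OF empty]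
    by (intro exI[of _ "[]"] exI[of _ x])
      (simp add: spelling_def word_Nil group.is_monoid monoid.l_one)
next
  case (insert v S)
  interpret P: group P by (rule group_P)
  have K: "S \<in> K" and v: "v \<in> V" using insert.prems by (auto simp: complete_subgraphs_def)
  have g: "x v \<in> carrier (G v)" by (rule clique_carrier_G[OF insert.prems(2) v])
  interpret Gv: group "G v" by (rule grp[OF v])
  define y where "y = x(v := \<one>\<^bsub>G v\<^esub>)"
  have y: "y \<in> carrier (GC S)"
    using insert.prems(2) insert.hyps v by (auto simp: clique_carrier y_def one_A extensional_def split: if_splits)
  have "x = single v (x v) \<otimes>\<^bsub>GC (insert v S)\<^esub> y"
  proof (rule clique_eqI[OF _ clique_ext(1)])
    show "x \<in> extensional V" using insert.prems by (simp add: clique_carrier)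
    fix w assume w: "w \<in> V"
    interpret Gw: group "G w" by (rule grp[OF w])
    show "x w = (single v (x v) \<otimes>\<^bsub>GC (insert v S)\<^esub> y) w"
      using clique_carrier_G[OF insert.prems(2) w] w by (auto simp: clique_mult single_def y_def)
  qed
  moreover have "single v (x v) \<in> carrier (GC (insert v S))" using v g by (simp add: single_carrier)
  moreover have "y \<in> carrier (GC (insert v S))" by (rule clique_mono[OF _ y]) blast
  ultimately have "\<iota> (insert v S) x = \<iota> (insert v S) (single v (x v)) \<otimes>\<^bsub>P\<^esub> \<iota> (insert v S) y"
    using \<iota>_mult[OF insert.prems(1), of "single v (x v)" y] by simp
  moreover have "\<iota> (insert v S) (single v (x v)) = letter v (x v)"
    using v g by (intro \<iota>_mono insert.prems K_single single_carrier) auto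
  moreover have "\<iota> (insert v S) y = \<iota> S y" by (intro \<iota>_mono insert.prems K y) auto
  ultimately have eq: "\<iota> (insert v S) x = letter v (x v) \<otimes>\<^bsub>P\<^esub> \<iota> S y" by simp
  have "spelling (letter v (x v)) [(v, x v)] \<one>\<^bsub>GC {}\<^esub>"
    using v g letter_carrier[of v "x v"] group_GC[of "{}"] \<iota>_one[OF K_empty]
    by (simp add: spelling_def word_Cons word_Nil group.is_monoid monoid.one_closed)
  moreover obtain L a where "spelling (\<iota> S y) L a" using insert.IH[OF K y] by blast
  ultimately show ?case using spelling_mult[of "letter v (x v)" _ _ "\<iota> S y" L a] unfolding eq by blast
qed

lemma ex_spelling: "X \<in> carrier P \<Longrightarrow> \<exists>L a. spelling X L a"
proof -
  assume X: "X \<in> carrier P"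
  let ?rel = "colimit_rel K (\<subseteq>) GC (\<lambda>S T x. x)"
  obtain w where w: "w \<in> lists (colimit_letters K GC)" "X = ?rel `` {w}"
    using X unfolding graph_product_of_pairs_def by (rule colimit_carrier_cases)
  have "\<exists>L a. spelling (?rel `` {w}) L a" using w(1)
  proof (induction w)
    case Nil
    have "?rel `` {[]} = \<one>\<^bsub>P\<^esub>" by (simp add: graph_product_of_pairs_def group_colimit_def)
    moreover have "\<one>\<^bsub>GC {}\<^esub> \<in> carrier (GC {})" using group_GC[of "{}"] by (simp add: group.is_monoid monoid.one_closed)
    then have "spelling \<one>\<^bsub>P\<^esub> [] \<one>\<^bsub>GC {}\<^esub>" using \<iota>_one[OF K_empty] group_P
      by (simp add: spelling_def word_Nil group.is_monoid monoid.one_closed monoid.l_one)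
    ultimately show ?case by auto
  next
    case (Cons s w)
    obtain S x where s: "s = (S, x)" by force
    have Sx: "S \<in> K" "x \<in> carrier (GC S)" using Cons.hyps s by auto
    have eq: "?rel `` {s # w} = \<iota> S x \<otimes>\<^bsub>P\<^esub> ?rel `` {w}"
      using colimit_mult[of K GC "[s]" w "(\<subseteq>)" "\<lambda>S T x. x"] group_GC Cons.hyps
      by (simp add: graph_product_of_pairs_def colimit_inj_def s)
    have "finite S" using Sx(1) clique_subset finV finite_subset by blast
    then obtain L a where "spelling (\<iota> S x) L a"
      using ex_spelling_\<iota> Sx by blast
    moreover obtain L' a' where "spelling (?rel `` {w}) L' a'" using Cons.IH by blast
    ultimately show ?case using spelling_mult unfolding eq by blast
  qed
  then show ?thesis using w by simp
qed

text \<open>The normal form of graph products: no syllable can be absorbed into the base group, and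
  none can be moved up to a later syllable at the same vertex.\<close>

fun reduced :: "('v \<times> 'a) list \<Rightarrow> bool"
  where "reduced [] \<longleftrightarrow> True"
  | "reduced ((v, g) # L) \<longleftrightarrow> g \<notin> A v \<and> \<not> descent E v (map fst L) \<and> reduced L"

text \<open>Either a syllable lies in \<open>A v\<close> and moves into the base factor, or it
  commutes up to a later syllable at the same vertex and the two are multiplied. Both lower the
  length by one; the remaining case is a reducible tail.\<close>

lemma shorten:
  assumes "set L \<subseteq> syllables" "\<not> reduced L"
  shows "\<exists>L' a. length L' < length L \<and> spelling (word L) L' a"
  using assms
proof (induction L)
  case (Cons s L)
  obtain v g where s: "s = (v, g)" by force
  interpret P: group P by (rule group_P)
  have v: "v \<in> V" and g: "g \<in> carrier (G v)" and L: "set L \<subseteq> syllables" using Cons.prems s by auto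
  have one: "\<one>\<^bsub>GC {}\<^esub> \<in> carrier (GC {})"
    using group_GC[of "{}"] by (simp add: group.is_monoid monoid.one_closed)
  have spell: "spelling (word M) M \<one>\<^bsub>GC {}\<^esub>" if "set M \<subseteq> syllables" for M
    using that one \<iota>_one[OF K_empty] word_carrier[OF that] by (simp add: spelling_def)
  show ?case
  proof (cases "reduced L")
    case False
    then obtain L' a where L': "length L' < length L" "spelling (word L) L' a"
      using Cons.IH L by blast
    have "spelling (word [s]) [s] \<one>\<^bsub>GC {}\<^esub>" by (rule spell) (use s v g in auto)
    from spelling_mult[OF this L'(2)]
    obtain L'' a'' where *: "length L'' = length L'" "spelling (word [s] \<otimes>\<^bsub>P\<^esub> word L) ([s] @ L'') a''"
      by blast
    moreover have "word (s # L) = word [s] \<otimes>\<^bsub>P\<^esub> word L" using word_append[of "[s]" L] Cons.prems by simp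
    ultimately have "spelling (word (s # L)) ([s] @ L'') a''" by simp
    moreover note *(1)
    ultimately
    show ?thesis using L' by (intro exI[of _ "[s] @ L''"] exI[of _ a'']) simp
  next
    case red: True
    show ?thesis
    proof (cases "g \<in> A v")
      case True
      have a: "single v g \<in> carrier (GC {})" using v True by (rule single_carrier_A)
      have "letter v g = \<iota> {} (single v g)" by (rule \<iota>_mono[OF K_empty K_single[OF v] _ a]) simp
      moreover have "spelling (\<iota> {} (single v g)) [] (single v g)"
        using a \<iota>_carrier[OF K_empty a] by (simp add: spelling_def word_Nil)
      ultimately have "spelling (letter v g) [] (single v g)" by simp
      from spelling_mult[OF this spell[OF L]]
      obtain L'' a'' where "length L'' = length L" "spelling (letter v g \<otimes>\<^bsub>P\<^esub> word L) ([] @ L'') a''"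
        by blast
      then show ?thesis by (intro exI[of _ L''] exI[of _ a'']) (simp add: s word_Cons)
    next
      case False
      then have "descent E v (map fst L)" using Cons.prems(2) red s by simp
      then obtain us ws where uw: "map fst L = us @ v # ws" "\<forall>w\<in>set us. (v, w) \<in> E"
        by (auto simp: descent_def)
      obtain L1 h L2 where L12: "L = L1 @ (v, h) # L2" "map fst L1 = us"
        using uw(1) by (auto simp: map_eq_append_conv map_eq_Cons_conv)
      have h: "h \<in> carrier (G v)" and L1: "set L1 \<subseteq> syllables" and L2: "set L2 \<subseteq> syllables"
        using L L12 by auto
      have c: "word L1 \<in> carrier P" "word L2 \<in> carrier P" "letter v g \<in> carrier P" "letter v h \<in> carrier P"
        using L1 L2 v g h by (auto intro!: word_carrier letter_carrier)
      have comm: "letter v g \<otimes>\<^bsub>P\<^esub> word L1 = word L1 \<otimes>\<^bsub>P\<^esub> letter v g"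
        by (rule letter_word_comm) (use L1 v g uw(2) L12(2) in auto)
      have "word (s # L) = letter v g \<otimes>\<^bsub>P\<^esub> word L1 \<otimes>\<^bsub>P\<^esub> (letter v h \<otimes>\<^bsub>P\<^esub> word L2)"
        using c L1 L2 v h by (simp add: s word_Cons L12(1) word_append P.m_assoc)
      also have "\<dots> = word L1 \<otimes>\<^bsub>P\<^esub> (letter v g \<otimes>\<^bsub>P\<^esub> letter v h \<otimes>\<^bsub>P\<^esub> word L2)"
        using c by (simp add: comm P.m_assoc)
      also have "\<dots> = word (L1 @ (v, g \<otimes>\<^bsub>G v\<^esub> h) # L2)"
        using L1 L2 v g h by (simp add: word_append word_Cons letter_mult mult_carrier)
      finally have "spelling (word (s # L)) (L1 @ (v, g \<otimes>\<^bsub>G v\<^esub> h) # L2) \<one>\<^bsub>GC {}\<^esub>"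
        using spell[of "L1 @ (v, g \<otimes>\<^bsub>G v\<^esub> h) # L2"] L1 L2 v mult_carrier[OF v g h] by simp
      then show ?thesis using L12
        by (intro exI[of _ "L1 @ (v, g \<otimes>\<^bsub>G v\<^esub> h) # L2"] exI[of _ "\<one>\<^bsub>GC {}\<^esub>"]) simp
    qed
  qed
qed simp

text \<open>A spelling of least length is reduced: otherwise \<open>shorten\<close> applies to its
  word, and the old base factor merges with the new one without adding syllables.\<close>

lemma ex_reduced_spelling:
  assumes "X \<in> carrier P" shows "\<exists>L a. spelling X L a \<and> reduced L"
proof -
  define n where "n = (LEAST n. \<exists>L a. spelling X L a \<and> length L = n)"
  have "\<exists>L a. spelling X L a \<and> length L = n"
    unfolding n_def by (rule LeastI_ex) (use ex_spelling[OF assms] in blast)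
  then obtain L a where L: "spelling X L a" "length L = n" by blast
  have "reduced L"
  proof (rule ccontr)
    assume "\<not> reduced L"
    then obtain L' a' where L': "length L' < length L" "spelling (word L) L' a'"
      using shorten[of L] L by (auto simp: spelling_def)
    have a: "a \<in> carrier (GC {})" using L by (simp add: spelling_def)
    have "spelling (\<iota> {} a) [] a"
      using a \<iota>_carrier[OF K_empty a] group_P by (simp add: spelling_def word_Nil group.is_monoid monoid.l_one)
    then obtain L'' a'' where *: "length L'' = length ([] :: ('v \<times> 'a) list)"
      "spelling (word L \<otimes>\<^bsub>P\<^esub> \<iota> {} a) (L' @ L'') a''"
      using spelling_mult[OF L'(2)] by blast
    then have "spelling X L' a''" using L by (simp add: spelling_def)
    then have "n \<le> length L'" unfolding n_def by (intro Least_le) blast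
    then show False using L' L by simp
  qed
  then show ?thesis using L by blast
qed


section \<open>Ping-pong on invariant cones\<close>

definition cone :: "'v \<Rightarrow> ('i \<Rightarrow> real) set"
  where "cone v = {z. phi v z \<ge> 0 \<and> (\<forall>h\<in>carrier (G v). lam v (\<rho> v h z) \<le> 2 * phi v z) \<and>
    (\<forall>h\<in>carrier (G v). \<forall>k\<in>carrier (G v) - A v.
      lam v (\<rho> v h z) + lam v (\<rho> v (k \<otimes>\<^bsub>G v\<^esub> h) z) \<le> 0)}"

lemma cone_zero: "v \<in> V \<Longrightarrow> (\<lambda>i. 0) \<in> cone v"
  by (simp add: cone_def linear_functional_zero[OF lin_phi] linear_functional_zero[OF lin_lam]
      linear_op_zero[OF lin_\<rho>] mult_carrier)

lemma cone_add:
  assumes v: "v \<in> V" and "x \<in> cone v" "y \<in> cone v" shows "(\<lambda>i. x i + y i) \<in> cone v"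
proof -
  have l: "lam v (\<rho> v h (\<lambda>i. x i + y i)) = lam v (\<rho> v h x) + lam v (\<rho> v h y)"
    if "h \<in> carrier (G v)" for h
    by (simp add: linear_op_add[OF lin_\<rho>[OF v that]] linear_functional_add[OF lin_lam[OF v]])
  have p: "phi v (\<lambda>i. x i + y i) = phi v x + phi v y"
    by (rule linear_functional_add[OF lin_phi[OF v]])
  show ?thesis using assms unfolding cone_def
    by (auto simp: l p mult_carrier v) (smt (verit) Diff_iff)+
qed

lemma cone_scale:
  assumes v: "v \<in> V" and x: "x \<in> cone v" and c: "c \<ge> 0" shows "(\<lambda>i. c * x i) \<in> cone v"
proof -
  have l: "lam v (\<rho> v h (\<lambda>i. c * x i)) = c * lam v (\<rho> v h x)" if "h \<in> carrier (G v)" for h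
    by (simp add: linear_op_scale[OF lin_\<rho>[OF v that]] linear_functional_scale[OF lin_lam[OF v]])
  have p: "phi v (\<lambda>i. c * x i) = c * phi v x"
    by (rule linear_functional_scale[OF lin_phi[OF v]])
  show ?thesis unfolding cone_def
  proof (intro CollectI conjI ballI)
    show "0 \<le> phi v (\<lambda>i. c * x i)" using x c by (simp add: p cone_def)
    fix h assume h: "h \<in> carrier (G v)"
    have "lam v (\<rho> v h x) \<le> 2 * phi v x" using x h by (simp add: cone_def)
    from mult_left_mono[OF this c] show "lam v (\<rho> v h (\<lambda>i. c * x i)) \<le> 2 * phi v (\<lambda>i. c * x i)"
      by (simp add: l[OF h] p)
    fix k assume k: "k \<in> carrier (G v) - A v"
    then have "lam v (\<rho> v h x) + lam v (\<rho> v (k \<otimes>\<^bsub>G v\<^esub> h) x) \<le> 0" using x h by (simp add: cone_def)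
    from mult_left_mono[OF this c]
    show "lam v (\<rho> v h (\<lambda>i. c * x i)) + lam v (\<rho> v (k \<otimes>\<^bsub>G v\<^esub> h) (\<lambda>i. c * x i)) \<le> 0"
      using k h mult_carrier[OF v, of k h] by (simp add: l algebra_simps)
  qed
qed

text \<open>The conditions range over all group elements h, so translating the vector by
  \<open>g\<close> only replaces h by the product of h and \<open>g\<close>.\<close>

lemma cone_\<rho>:
  assumes v: "v \<in> V" and x: "x \<in> cone v" and g: "g \<in> carrier (G v)" shows "\<rho> v g x \<in> cone v"
proof -
  interpret Gv: group "G v" by (rule grp[OF v])
  show ?thesis using x g unfolding cone_def
    by (auto simp: phi_inv v \<rho>_mult[OF v, symmetric] Gv.m_assoc)
qed

lemma lam_orbit: "v \<in> V \<Longrightarrow> g \<in> carrier (G v) \<Longrightarrow> lam v (\<rho> v g (u v)) = 2 \<or> g \<notin> A v \<and> lam v (\<rho> v g (u v)) \<le> - 2"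
  using sep A_u lam_u by metis

text \<open>The last condition of \<open>cone\<close> is modelled on this case: h and kh cannot both
  lie in \<open>A v\<close> when k does not, so one of the two values is at most -2, while the other
  is at most 2.\<close>

lemma u_cone: assumes v: "v \<in> V" shows "u v \<in> cone v"
  unfolding cone_def
proof (intro CollectI conjI ballI)
  interpret Gv: group "G v" by (rule grp[OF v])
  interpret Av: subgroup "A v" "G v" by (rule sub[OF v])
  show "0 \<le> phi v (u v)" by (simp add: phi_u v)
  fix h assume h: "h \<in> carrier (G v)"
  show "lam v (\<rho> v h (u v)) \<le> 2 * phi v (u v)" using lam_orbit[OF v h] by (auto simp: phi_u v)
  fix k assume k: "k \<in> carrier (G v) - A v"
  have "\<not> (h \<in> A v \<and> k \<otimes>\<^bsub>G v\<^esub> h \<in> A v)"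
  proof
    assume *: "h \<in> A v \<and> k \<otimes>\<^bsub>G v\<^esub> h \<in> A v"
    then have "(k \<otimes>\<^bsub>G v\<^esub> h) \<otimes>\<^bsub>G v\<^esub> inv\<^bsub>G v\<^esub> h \<in> A v" by simp
    then show False using k h by (simp add: Gv.m_assoc)
  qed
  then have "lam v (\<rho> v h (u v)) \<le> -2 \<or> lam v (\<rho> v (k \<otimes>\<^bsub>G v\<^esub> h) (u v)) \<le> -2"
    using sep[OF v] h k by auto
  moreover have "lam v (\<rho> v h (u v)) \<le> 2" "lam v (\<rho> v (k \<otimes>\<^bsub>G v\<^esub> h) (u v)) \<le> 2"
    using lam_orbit[OF v h] lam_orbit[OF v, of "k \<otimes>\<^bsub>G v\<^esub> h"] h k by auto
  ultimately show "lam v (\<rho> v h (u v)) + lam v (\<rho> v (k \<otimes>\<^bsub>G v\<^esub> h) (u v)) \<le> 0" by linarith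
qed

definition mass :: "'v \<Rightarrow> (('v \<times> 'i) option \<Rightarrow> real) \<Rightarrow> real"
  where "mass v y = (\<Sum>w\<in>far v. phi w (comp w y))"

text \<open>The invariant of the ping-pong argument: every \<open>v\<close> that is not a descent of the spelling
  \<open>vs\<close> sees \<open>y\<close> on the negative side of its reflection, so that the next syllable at \<open>v\<close> can
  only enlarge the \<open>v\<close>-component.\<close>

definition good :: "(('v \<times> 'i) option \<Rightarrow> real) \<Rightarrow> 'v list \<Rightarrow> bool"
  where "good y vs \<longleftrightarrow> y None = 1 \<and> (\<forall>v\<in>V. comp v y \<in> cone v) \<and>
    (\<forall>v\<in>V. \<not> descent E v vs \<longrightarrow>
      (\<forall>h\<in>carrier (G v). lam v (\<rho> v h (comp v y)) - 2 * mass v y - 2 \<le> 0))"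

definition f\<^sub>0 :: "('v \<times> 'i) option \<Rightarrow> real"
  where "f\<^sub>0 = (\<lambda>j. if j = None then 1 else 0)"

lemma comp_f\<^sub>0: "comp v f\<^sub>0 = (\<lambda>i. 0)"
  by (simp add: comp_def f\<^sub>0_def)

lemma good_f\<^sub>0: "good f\<^sub>0 []"
proof -
  have "mass v f\<^sub>0 = 0" for v unfolding mass_def comp_f\<^sub>0
    by (rule sum.neutral) (auto simp: far_def linear_functional_zero[OF lin_phi])
  then show ?thesis unfolding good_def comp_f\<^sub>0
    by (auto simp: f\<^sub>0_def cone_zero linear_op_zero[OF lin_\<rho>] linear_functional_zero[OF lin_lam])
qed

text \<open>As \<open>v\<close> is no descent, all \<open>D h\<close> are nonnegative. Conjugating
  by the reflection turns the component at \<open>v\<close> into its translate by \<open>g\<close>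
  plus nonnegative multiples of \<open>\<rho> v g (u v)\<close> and \<open>u v\<close>: it stays in
  the cone and becomes large. Vertices far from \<open>v\<close> then see a large mass, and
  neighbours of \<open>v\<close> see no change.\<close>

lemma good_step:
  assumes y: "good y vs" and v: "v \<in> V" and nd: "\<not> descent E v vs"
    and g: "g \<in> carrier (G v)" "g \<notin> A v"
  defines "y' \<equiv> rop {v} (single v g) y"
  shows "good y' (v # vs)" "phi v (comp v y') \<ge> 4"
proof -
  have vg: "(v, g) \<in> syllables" using v g by simp
  interpret Gv: group "G v" by (rule grp[OF v])
  note rop = comp_rop[OF K_single[OF v] single_carrier[OF vg singletonI]]
  have None': "y' None = 1" using y by (simp add: y'_def None_rop good_def)
  have other: "comp w y' = comp w y" if "w \<in> V" "w \<noteq> v" for w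
    using that unfolding y'_def rop[OF that(1)] by (simp add: single_def \<rho>_one)
  define D where "D h = - (lam v (\<rho> v h (comp v y)) - 2 * mass v y - 2)" for h
  have D_nonneg: "D h \<ge> 0" if "h \<in> carrier (G v)" for h
    using y v nd that by (auto simp: D_def good_def)
  \<comment> \<open>This is minus \<open>Lam v y\<close>, the multiple of \<open>u v\<close> that
    the inner reflection adds.\<close>
  define D1 where "D1 = D \<one>\<^bsub>G v\<^esub>"
  \<comment> \<open>The multiple of \<open>u v\<close> that the outer reflection adds. It is at
    least \<open>D g\<close>, since \<open>D1\<close> is nonnegative and \<open>lam v\<close> is at
    most -2 on \<open>\<rho> v g (u v)\<close>.\<close>
  define D2 where "D2 = D g - D1 * lam v (\<rho> v g (u v))"
  have Lam: "Lam v y = - D1"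
    using y by (simp add: Lam_def D1_def D_def mass_def \<rho>_one v good_def)
  have D1: "D1 \<ge> 0" using D_nonneg by (simp add: D1_def)
  have lg: "lam v (\<rho> v g (u v)) \<le> -2" by (rule sep[OF v g])
  have "D1 * lam v (\<rho> v g (u v)) \<le> D1 * (-2)" by (rule mult_left_mono[OF lg D1])
  then have D2: "D2 \<ge> D g" using D1 by (simp add: D2_def)
  define z where "z = (\<lambda>i. \<rho> v g (comp v y) i + D1 * \<rho> v g (u v) i)"
  have z: "\<rho> v g (\<lambda>i. comp v y i - Lam v y * u v i) = z"
    by (simp add: z_def Lam linear_op_diff[OF lin_\<rho>[OF v g(1)], of "comp v y" "- D1" "u v", simplified])
  have lamz: "lam v z = lam v (\<rho> v g (comp v y)) + D1 * lam v (\<rho> v g (u v))"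
    using linear_functional_diff[OF lin_lam[OF v], of "\<rho> v g (comp v y)" "- D1" "\<rho> v g (u v)"]
    by (simp add: z_def)
  have compv: "comp v y' = (\<lambda>i. z i + D2 * u v i)"
  proof -
    have "comp v y' = (\<lambda>i. z i - (lam v z - 2 * mass v y - 2 * y None) * u v i)"
      unfolding y'_def rop[OF v] mass_def using v by (simp add: single_def z Let_def)
    also have "lam v z - 2 * mass v y - 2 * y None = - D2"
      using y by (simp add: D2_def D_def lamz good_def)
    finally show ?thesis by simp
  qed
  have yc: "comp w y \<in> cone w" if "w \<in> V" for w using y that by (simp add: good_def)
  have D2_nonneg: "D2 \<ge> 0" using D2 D_nonneg[OF g(1)] by simp
  have cone_v: "comp v y' \<in> cone v"
    unfolding compv z_def
    by (intro cone_add cone_scale cone_\<rho> u_cone yc v g D1 D2_nonneg)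
  have phi_v: "phi v (comp v y') = phi v (comp v y) + D1 + D2"
    unfolding compv z_def
    by (simp add: linear_functional_add[OF lin_phi[OF v]] linear_functional_scale[OF lin_phi[OF v]]
        phi_inv v g phi_u)
  \<comment> \<open>The last condition of \<open>cone\<close> at h = 1 and k = g. Adding the two
    values cancels everything but the mass and the constant, which gives the factor 4 below.\<close>
  have "lam v (\<rho> v \<one>\<^bsub>G v\<^esub> (comp v y)) + lam v (\<rho> v (g \<otimes>\<^bsub>G v\<^esub> \<one>\<^bsub>G v\<^esub>) (comp v y)) \<le> 0"
    using yc[OF v] g Gv.one_closed unfolding cone_def by blast
  then have "D1 + D g \<ge> 4 * mass v y + 4"
    using g by (simp add: D1_def D_def)
  moreover have "phi v (comp v y) \<ge> 0" using yc[OF v] by (simp add: cone_def)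
  ultimately have big: "phi v (comp v y') \<ge> 4 * mass v y + 4" using phi_v D2 by linarith
  have phi_nonneg: "phi w (comp w y) \<ge> 0" "phi w (comp w y') \<ge> 0" if "w \<in> V" for w
    using yc[OF that] cone_v other[OF that] by (cases "w = v"; auto simp: cone_def)+
  have mass_nonneg: "mass w y \<ge> 0" for w
    unfolding mass_def by (rule sum_nonneg) (auto simp: far_def phi_nonneg)
  then show "phi v (comp v y') \<ge> 4" using big by (smt (verit))
  show "good y' (v # vs)"
    unfolding good_def
  proof (intro conjI ballI impI None')
    fix w assume w: "w \<in> V"
    show "comp w y' \<in> cone w" using cone_v other yc w by (cases "w = v") auto
    fix h assume ndw: "\<not> descent E w (v # vs)" and h: "h \<in> carrier (G w)"
    have wv: "w \<noteq> v" using ndw descent_Cons_self by metis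
    show "lam w (\<rho> w h (comp w y')) - 2 * mass w y' - 2 \<le> 0"
    proof (cases "(w, v) \<in> E")
      case True
      \<comment> \<open>Prepending a neighbour preserves descents, so a descent of \<open>vs\<close>
        would be one of \<open>v # vs\<close>. As \<open>v\<close> is not far from \<open>w\<close>,
        nothing that \<open>w\<close> sees has moved.\<close>
      then have "\<not> descent E w vs" using ndw descent_Cons by metis
      moreover have "mass w y' = mass w y"
        unfolding mass_def
      proof (rule sum.cong)
        fix x assume "x \<in> far w"
        then have "x \<in> V" "x \<noteq> v" using True by (auto simp: far_def)
        then show "phi x (comp x y') = phi x (comp x y)" by (simp add: other)
      qed simp
      ultimately show ?thesis using y w h by (auto simp: good_def other[OF w wv])
    next
      case False
      then have "(v, w) \<notin> E" using symE by (auto dest: symD)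
      \<comment> \<open>The component at \<open>w\<close> is unchanged, and \<open>lam w\<close> on
        its translates is at most twice the old mass at \<open>v\<close>. The new mass at
        \<open>w\<close> contains the component at \<open>v\<close>, which is at least four times
        that mass plus 4.\<close>
      then have far: "w \<in> far v" "v \<in> far w" using False wv v w by (auto simp: far_def)
      have "phi w (comp w y) \<le> mass v y"
        unfolding mass_def by (rule member_le_sum[OF far(1) _ fin_far]) (auto simp: far_def phi_nonneg)
      moreover have "phi v (comp v y') \<le> mass w y'"
        unfolding mass_def by (rule member_le_sum[OF far(2) _ fin_far]) (auto simp: far_def phi_nonneg)
      moreover have "lam w (\<rho> w h (comp w y)) \<le> 2 * phi w (comp w y)"
        using yc[OF w] h by (simp add: cone_def)
      ultimately show ?thesis using big mass_nonneg[of v] by (simp add: other[OF w wv])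
    qed
  qed
qed

lemma R_letter: "(v, g) \<in> syllables \<Longrightarrow> R (letter v g) = rop {v} (single v g)"
  by (rule R_inj) (auto intro: K_single single_carrier)

lemma R_one: "R \<one>\<^bsub>P\<^esub> y = y"
  using hom_one[OF R_hom group_P group_op_group] by (simp add: op_group_def)

lemma R_word_Cons: "(v, g) \<in> syllables \<Longrightarrow> set L \<subseteq> syllables
  \<Longrightarrow> R (word ((v, g) # L)) y = rop {v} (single v g) (R (word L) y)"
  by (simp add: word_Cons R_mult letter_carrier word_carrier R_letter)

lemma good_word:
  assumes "set L \<subseteq> syllables" "reduced L"
  shows "good (R (word L) f\<^sub>0) (map fst L) \<and>
    (L \<noteq> [] \<longrightarrow> (\<exists>v\<in>V. phi v (comp v (R (word L) f\<^sub>0)) \<ge> 4))"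
  using assms
proof (induction L)
  case Nil
  then show ?case by (simp add: word_Nil R_one good_f\<^sub>0)
next
  case (Cons s L)
  obtain v g where s: "s = (v, g)" by force
  have *: "(v, g) \<in> syllables" "set L \<subseteq> syllables" using Cons.prems s by auto
  have "good (R (word L) f\<^sub>0) (map fst L)" using Cons s by simp
  from good_step[OF this, of v g] show ?case
    using * Cons.prems by (auto simp: s R_word_Cons)
qed

lemma refl_empty: "refl {} y = y"
  by (rule comp_eqI) (auto simp: comp_refl None_refl)

lemma R_base: "a \<in> carrier (GC {}) \<Longrightarrow> R (\<iota> {} a) y = diag a y"
  by (simp add: R_inj K_empty rop_def refl_empty)

lemma diag_f\<^sub>0: "a \<in> carrier (GC {}) \<Longrightarrow> diag a f\<^sub>0 = f\<^sub>0"
  by (rule comp_eqI)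
    (auto simp: comp_diag None_diag comp_f\<^sub>0 linear_op_zero[OF lin_\<rho>] clique_carrier_G)

lemma None_R: assumes "X \<in> carrier P" shows "R X y None = y None"
proof -
  obtain L a where L: "spelling X L a" using ex_spelling[OF assms] by blast
  then have s: "set L \<subseteq> syllables" "a \<in> carrier (GC {})" "X = word L \<otimes>\<^bsub>P\<^esub> \<iota> {} a"
    by (auto simp: spelling_def)
  have "R (word L) z None = z None" for z using s(1)
    by (induction L) (auto simp: word_Nil R_one R_word_Cons None_rop)
  then show ?thesis
    by (simp add: s R_mult word_carrier \<iota>_carrier K_empty R_base None_diag)
qed

definition total :: "(('v \<times> 'i) option \<Rightarrow> real) \<Rightarrow> real"
  where "total y = 2 * y None - (\<Sum>v\<in>V. phi v (comp v y))"

text \<open>\<open>total\<close> becomes the functional \<open>lam\<close> of the new pair. It is 2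
  at \<open>f\<^sub>0\<close>; a nonempty reduced word produces one component of size at least 4 and
  no negative one, so the value drops to at most 2 - 4.\<close>

lemma R_separates:
  assumes X: "X \<in> carrier P" "X \<notin> \<iota> {} ` carrier (GC {})"
  shows "total (R X f\<^sub>0) \<le> - 2"
proof -
  obtain L a where L: "spelling X L a" "reduced L" using ex_reduced_spelling[OF X(1)] by blast
  then have s: "set L \<subseteq> syllables" "a \<in> carrier (GC {})" "X = word L \<otimes>\<^bsub>P\<^esub> \<iota> {} a"
    by (auto simp: spelling_def)
  have eq: "R X f\<^sub>0 = R (word L) f\<^sub>0"
    by (simp add: s R_mult word_carrier \<iota>_carrier K_empty R_base diag_f\<^sub>0)
  have "L \<noteq> []"
  proof
    assume "L = []"
    then have "X = \<iota> {} a" using s group_P \<iota>_carrier[OF K_empty s(2)]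
      by (simp add: word_Nil group.is_monoid monoid.l_one)
    then show False using X s by blast
  qed
  then obtain v where g: "good (R X f\<^sub>0) (map fst L)" and v: "v \<in> V" "phi v (comp v (R X f\<^sub>0)) \<ge> 4"
    using good_word[OF s(1) L(2)] eq by auto
  have "phi v (comp v (R X f\<^sub>0)) \<le> (\<Sum>v\<in>V. phi v (comp v (R X f\<^sub>0)))"
    by (rule member_le_sum[OF v(1) _ finV]) (use g in \<open>auto simp: good_def cone_def\<close>)
  then show ?thesis using v g by (simp add: total_def good_def)
qed

lemma total_diag: "a \<in> carrier (GC {}) \<Longrightarrow> total (diag a y) = total y"
  unfolding total_def None_diag by (simp add: comp_diag phi_inv clique_carrier_G)

lemma total_f\<^sub>0: "total f\<^sub>0 = 2"
proof -
  have "(\<Sum>v\<in>V. phi v (comp v f\<^sub>0)) = 0"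
    by (rule sum.neutral) (simp add: comp_f\<^sub>0 linear_functional_zero[OF lin_phi])
  then show ?thesis by (simp add: total_def f\<^sub>0_def)
qed

lemma finJ: "finite J"
  using faithful finV by (auto simp: J_def faithful_rep_def)

lemma linear_total: "linear_functional total"
  unfolding linear_functional_def total_def comp_add comp_scale
  by (simp add: linear_functional_add[OF lin_phi] linear_functional_scale[OF lin_phi]
      sum.distrib sum_distrib_left algebra_simps)

text \<open>An element that fixes \<open>f\<^sub>0\<close> lies in the base group by separation. The
  base group acts diagonally, and each factor acts faithfully on its own summand.\<close>

lemma faithful_R: "faithful_rep P J R"
  unfolding faithful_rep_def
proof (intro conjI ballI impI finJ R_hom)
  fix X assume X: "X \<in> carrier P" and triv: "\<forall>y. (\<forall>i. i \<notin> J \<longrightarrow> y i = 0) \<longrightarrow> R X y = y"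
  have "R X f\<^sub>0 = f\<^sub>0" using triv by (auto simp: f\<^sub>0_def J_def)
  then have "X \<in> \<iota> {} ` carrier (GC {})" using R_separates[OF X] total_f\<^sub>0 by (cases "X \<in> \<iota> {} ` carrier (GC {})") auto
  then obtain a where a: "a \<in> carrier (GC {})" "X = \<iota> {} a" by blast
  have "a v = \<one>\<^bsub>G v\<^esub>" if v: "v \<in> V" for v
  proof -
    have "\<rho> v (a v) z = z" if z: "\<forall>i. i \<notin> I v \<longrightarrow> z i = 0" for z
    proof -
      define y where "y = (\<lambda>j. case j of None \<Rightarrow> 0 | Some (w, i) \<Rightarrow> if w = v then z i else 0)"
      have "\<forall>i. i \<notin> J \<longrightarrow> y i = 0"
      proof (intro allI impI)
        fix j assume "j \<notin> J"
        then show "y j = 0" using notin_J[of j] z v by (auto simp: y_def)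
      qed
      then have "R X y = y" using triv by blast
      then have "comp v (diag a y) = comp v y" using a by (simp add: R_base)
      moreover have "comp v y = z" by (simp add: comp_def y_def)
      ultimately show ?thesis using v by (simp add: comp_diag)
    qed
    then show ?thesis using faithful[OF v] clique_carrier_G[OF a(1) v] by (simp add: faithful_rep_def)
  qed
  then have "a = \<one>\<^bsub>GC {}\<^esub>"
    using a by (intro clique_eqI[OF _ clique_ext(2)]) (auto simp: clique_carrier clique_one)
  then show "X = \<one>\<^bsub>P\<^esub>" using a \<iota>_one[OF K_empty] by simp
qed

text \<open>The new vector is \<open>f\<^sub>0\<close> and the new invariant functional is the
  coordinate \<open>None\<close>. Input and output have the same form, so the result can again serve
  as a vertex group.\<close>

theorem pair_rep_graph_product:
  "pair_rep P (\<iota> {} ` carrier (GC {})) J R f\<^sub>0 total (\<lambda>y. y None)"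
  unfolding pair_rep_def
  using faithful_R linear_total R_separates total_diag None_R
  by (auto simp: f\<^sub>0_def[symmetric] total_f\<^sub>0 R_base diag_f\<^sub>0 linear_functional_def)
     (auto simp: f\<^sub>0_def J_def)

end

section \<open>Finite pairs, subgroups, and linearity of graph products\<close>

lemma hom_op_groupI:
  assumes G: "group G" and lin: "\<And>g. g \<in> carrier G \<Longrightarrow> linear_op I (\<rho> g)"
    and mult: "\<And>g h x. g \<in> carrier G \<Longrightarrow> h \<in> carrier G \<Longrightarrow> \<rho> (g \<otimes>\<^bsub>G\<^esub> h) x = \<rho> g (\<rho> h x)"
    and one: "\<And>x. \<rho> \<one>\<^bsub>G\<^esub> x = x"
  shows "\<rho> \<in> hom G (op_group I)"
proof (rule homI)
  interpret group G by (rule G)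
  fix g assume g: "g \<in> carrier G"
  have "\<rho> g \<circ> \<rho> (inv\<^bsub>G\<^esub> g) = id" "\<rho> (inv\<^bsub>G\<^esub> g) \<circ> \<rho> g = id"
    using g by (auto simp: fun_eq_iff mult[symmetric] one)
  then show "\<rho> g \<in> carrier (op_group I)" using lin[OF g] lin[OF inv_closed[OF g]] by (auto simp: op_group_def)
  fix h assume "h \<in> carrier G"
  then show "\<rho> (g \<otimes>\<^bsub>G\<^esub> h) = \<rho> g \<otimes>\<^bsub>op_group I\<^esub> \<rho> h" using g by (auto simp: op_group_def mult)
qed

text \<open>In the regular representation the translates of the indicator \<open>u\<close> of
  \<open>A\<close> are the indicators of cosets. \<open>phi\<close> is normalised to 1 on each of
  them, and the first term of \<open>lam\<close> is 4 on \<open>A\<close> and 0 on the other cosets,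
  so subtracting 2 \<open>phi\<close> gives 2 and -2.\<close>

lemma pair_rep_finite:
  fixes G (structure)
  assumes G: "group G" and fin: "finite (carrier G)" and A: "subgroup A G"
  shows "\<exists>\<rho> u lam phi. pair_rep G A (carrier G) \<rho> u lam phi"
proof -
  interpret group G by (rule G)
  interpret A: subgroup A G by (rule A)
  define \<rho> :: "'a \<Rightarrow> ('a \<Rightarrow> real) \<Rightarrow> 'a \<Rightarrow> real"
    where "\<rho> g x = (\<lambda>k. if k \<in> carrier G then x (inv g \<otimes> k) else x k)" for g x
  define u :: "'a \<Rightarrow> real" where "u k = (if k \<in> A then 1 else 0)" for k
  define phi :: "('a \<Rightarrow> real) \<Rightarrow> real" where "phi x = (\<Sum>k\<in>carrier G. x k) / card A" for x
  define lam :: "('a \<Rightarrow> real) \<Rightarrow> real" where "lam x = 4 / card A * (\<Sum>a\<in>A. x a) - 2 * phi x" for x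
  have finA: "finite A" using fin A.subset finite_subset by blast
  have cA: "card A > 0" using finA A.one_closed card_gt_0_iff by blast
  have bij: "bij_betw (\<lambda>k. inv g \<otimes> k) (carrier G) (carrier G)" if "g \<in> carrier G" for g
    by (rule bij_betwI[where g = "\<lambda>k. g \<otimes> k"]) (use that in \<open>auto simp: m_assoc[symmetric]\<close>)
  have bijA: "bij_betw (\<lambda>k. inv g \<otimes> k) A A" if "g \<in> A" for g
    by (rule bij_betwI[where g = "\<lambda>k. g \<otimes> k"])
      (use that A.mem_carrier in \<open>auto simp: m_assoc[symmetric]\<close>)
  have sumA: "(\<Sum>a\<in>A. \<rho> g x a) = (\<Sum>a\<in>A. x (inv g \<otimes> a))" for g x
    by (rule sum.cong) (use A.mem_carrier in \<open>auto simp: \<rho>_def\<close>)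
  have lin: "linear_op (carrier G) (\<rho> g)" for g
    by (auto simp: linear_op_def \<rho>_def)
  have rep: "\<rho> \<in> hom G (op_group (carrier G))"
    by (rule hom_op_groupI[OF G lin]) (auto simp: \<rho>_def inv_mult_group m_assoc)
  have phi_inv: "phi (\<rho> g x) = phi x" if "g \<in> carrier G" for g x
    using sum.reindex_bij_betw[OF bij[OF that], of x] by (simp add: phi_def \<rho>_def)
  have phi_u: "phi u = 1"
  proof -
    have "(\<Sum>k\<in>carrier G. u k) = (\<Sum>k\<in>A. u k)"
      by (rule sum.mono_neutral_right[OF fin A.subset]) (simp add: u_def)
    then show ?thesis using cA by (simp add: phi_def u_def)
  qed
  have "faithful_rep G (carrier G) \<rho>"
    unfolding faithful_rep_def
  proof (intro conjI ballI impI fin rep)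
    fix g assume g: "g \<in> carrier G"
      and triv: "\<forall>x. (\<forall>i. i \<notin> carrier G \<longrightarrow> x i = 0) \<longrightarrow> \<rho> g x = x"
    let ?x = "\<lambda>k. if k = \<one> then 1 else 0 :: real"
    have "\<rho> g ?x = ?x" using triv by auto
    from fun_cong[OF this, of g] show "g = \<one>" using g by (auto simp: \<rho>_def split: if_splits)
  qed
  moreover have "linear_functional phi"
    by (auto simp: linear_functional_def phi_def sum.distrib sum_distrib_left add_divide_distrib)
  moreover from this have "linear_functional lam"
    by (auto simp: linear_functional_def lam_def sum.distrib sum_distrib_left[symmetric] add_divide_distrib algebra_simps)
  moreover have "lam u = 2" using cA by (simp add: lam_def phi_u) (simp add: u_def)
  moreover have "\<rho> a u = u" "lam (\<rho> a x) = lam x" if "a \<in> A" for a x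
  proof -
    have a: "a \<in> carrier G" using that by simp
    have "inv a \<otimes> k \<in> A \<longleftrightarrow> k \<in> A" if "k \<in> carrier G" for k
    proof
      assume "inv a \<otimes> k \<in> A"
      then have "a \<otimes> (inv a \<otimes> k) \<in> A" using \<open>a \<in> A\<close> by blast
      then show "k \<in> A" using a that by (simp add: m_assoc[symmetric])
    qed (use \<open>a \<in> A\<close> in auto)
    then show "\<rho> a u = u" by (auto simp: \<rho>_def u_def fun_eq_iff)
    show "lam (\<rho> a x) = lam x"
      using sum.reindex_bij_betw[OF bijA[OF that], of x] by (simp add: lam_def phi_inv a sumA)
  qed
  moreover have "lam (\<rho> g u) \<le> - 2" if g: "g \<in> carrier G - A" for g
  proof -
    have "inv g \<otimes> a \<notin> A" if a: "a \<in> A" for a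
    proof
      assume "inv g \<otimes> a \<in> A"
      then have "a \<otimes> inv (inv g \<otimes> a) \<in> A" using a by blast
      then show False using a g A.mem_carrier[OF a] by (simp add: inv_mult_group m_assoc[symmetric])
    qed
    then have "(\<Sum>a\<in>A. u (inv g \<otimes> a)) = 0" by (intro sum.neutral) (simp add: u_def)
    then show ?thesis using g by (simp add: lam_def sumA phi_inv phi_u)
  qed
  moreover have "\<forall>i. i \<notin> carrier G \<longrightarrow> u i = 0" by (auto simp: u_def)
  ultimately have "pair_rep G A (carrier G) \<rho> u lam phi"
    using phi_inv phi_u by (simp add: pair_rep_def)
  then show ?thesis by blast
qed

text \<open>The index sets may vary with the vertex, but they share one type; the new index type
  adds a vertex label and the point \<open>None\<close>.\<close>

lemma graph_product_pair_rep:
  fixes I :: "'v \<Rightarrow> 'i set"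
  assumes graph: "finite_graph V E"
    and grp: "\<And>v. v \<in> V \<Longrightarrow> group (G v) \<and> subgroup (A v) (G v)"
    and rep: "\<And>v. v \<in> V \<Longrightarrow> \<exists>\<rho> u lam phi. pair_rep (G v) (A v) (I v) \<rho> u lam phi"
  shows "\<exists>J \<rho> u lam phi. pair_rep (graph_product_of_pairs V E G A)
    (colimit_inj (complete_subgraphs V E) (\<subseteq>) (clique_group V G A) (\<lambda>S T x. x) {} ` carrier (clique_group V G A {}))
    (J :: ('v \<times> 'i) option set) \<rho> u lam phi"
proof -
  have "\<forall>v\<in>V. \<exists>q. pair_rep (G v) (A v) (I v) (fst q) (fst (snd q)) (fst (snd (snd q))) (snd (snd (snd q)))"
    using rep by (metis fst_conv snd_conv)
  then obtain q where q: "\<And>v. v \<in> V \<Longrightarrow>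
      pair_rep (G v) (A v) (I v) (fst (q v)) (fst (snd (q v))) (fst (snd (snd (q v)))) (snd (snd (snd (q v))))"
    by (metis (no_types))
  interpret graph_pair_rep V E G A I "\<lambda>v. fst (q v)" "\<lambda>v. fst (snd (q v))"
      "\<lambda>v. fst (snd (snd (q v)))" "\<lambda>v. snd (snd (snd (q v)))"
    by (rule graph_pair_rep.intro) (use graph grp q in \<open>blast+\<close>)
  show ?thesis using pair_rep_graph_product by blast
qed

lemma linear_graph_product:
  fixes G :: "'v \<Rightarrow> 'a monoid" and I :: "'v \<Rightarrow> 'i set"
  assumes graph: "finite_graph V E"
    and grp: "\<And>v. v \<in> V \<Longrightarrow> group (G v) \<and> subgroup (A v) (G v)"
    and rep: "\<And>v. v \<in> V \<Longrightarrow> \<exists>\<rho> u lam phi. pair_rep (G v) (A v) (I v) \<rho> u lam phi"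
  shows "linear_group (graph_product_of_pairs V E G A)"
proof -
  obtain J :: "('v \<times> 'i) option set" and \<rho> where
    "faithful_rep (graph_product_of_pairs V E G A) J \<rho>"
    using graph_product_pair_rep[of V E G A I, OF graph grp rep] unfolding pair_rep_def by blast
  moreover obtain \<kappa> :: "real \<Rightarrow> ('v set \<times> ('v \<Rightarrow> 'a)) list set list" where "inj \<kappa>"
    using inj_real_list_set by blast
  ultimately show ?thesis
    by (intro linear_group_faithful_rep group_graph_product_of_pairs) (use grp in auto)
qed

lemma linear_graph_product_finite:
  assumes "finite_graph V E" "\<forall>v\<in>V. group (F v) \<and> finite (carrier (F v)) \<and> subgroup (A v) (F v)"
  shows "linear_group (graph_product_of_pairs V E F A)"
  by (rule linear_graph_product[OF assms(1), where I = "\<lambda>v. carrier (F v)"])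
    (use assms(2) in \<open>auto intro: pair_rep_finite\<close>)

text \<open>Injectivity sends every nontrivial element of \<open>G\<close> to a nontrivial element
  of \<open>H\<close>, so both faithfulness and the bound -2 restrict.\<close>

lemma pair_rep_pullback:
  assumes G: "group G" and H: "group H" and rep: "pair_rep H {\<one>\<^bsub>H\<^esub>} I \<rho> u lam phi"
    and f: "f \<in> hom G H" "inj_on f (carrier G)"
  shows "pair_rep G {\<one>\<^bsub>G\<^esub>} I (\<rho> \<circ> f) u lam phi"
proof -
  have f1: "f \<one>\<^bsub>G\<^esub> = \<one>\<^bsub>H\<^esub>" by (rule hom_one[OF f(1) G H])
  have inj: "g = \<one>\<^bsub>G\<^esub>" if "g \<in> carrier G" "f g = \<one>\<^bsub>H\<^esub>" for g
    using inj_onD[OF f(2), of g "\<one>\<^bsub>G\<^esub>"] that f1 G by (simp add: group.is_monoid monoid.one_closed)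
  have fc: "f g \<in> carrier H" if "g \<in> carrier G" for g using f(1) that by (auto simp: hom_def)
  have "faithful_rep G I (\<rho> \<circ> f)"
    using rep f(1) inj fc unfolding pair_rep_def faithful_rep_def
    by (auto intro: hom_compose[of f G H \<rho>])
  then show ?thesis using rep fc inj unfolding pair_rep_def by (auto simp: f1)
qed

section \<open>Right-angled Coxeter groups of cycles\<close>

definition commutator :: "('a, 'm) monoid_scheme \<Rightarrow> 'a \<Rightarrow> 'a \<Rightarrow> 'a"
  where "commutator G x y = x \<otimes>\<^bsub>G\<^esub> y \<otimes>\<^bsub>G\<^esub> inv\<^bsub>G\<^esub> x \<otimes>\<^bsub>G\<^esub> inv\<^bsub>G\<^esub> y"

primrec commutator_prod :: "('a, 'm) monoid_scheme \<Rightarrow> (nat \<Rightarrow> 'a) \<Rightarrow> (nat \<Rightarrow> 'a) \<Rightarrow> nat \<Rightarrow> 'a"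
  where "commutator_prod G a b 0 = \<one>\<^bsub>G\<^esub>"
  | "commutator_prod G a b (Suc n) = commutator_prod G a b n \<otimes>\<^bsub>G\<^esub> commutator G (a n) (b n)"

definition cycle_edges :: "nat \<Rightarrow> nat rel"
  where "cycle_edges m = {(i, j). i < m \<and> j < m \<and> (j = Suc i mod m \<or> i = Suc j mod m)}"

text \<open>The group of order two as booleans under exclusive or, so that an element of a clique
  group is the characteristic function of a set of generators.\<close>

definition two_group :: "bool monoid"
  where "two_group = \<lparr>carrier = UNIV, monoid.mult = (\<noteq>), one = False\<rparr>"

lemma group_two_group: "group two_group"
  by (rule groupI) (auto simp: two_group_def)

definition racg :: "nat \<Rightarrow> (nat set \<times> (nat \<Rightarrow> bool)) list set monoid"
  where "racg m = graph_product_of_pairs {..<m} (cycle_edges m) (\<lambda>_. two_group) (\<lambda>_. {False})"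

lemma finite_graph_cycle: "m \<ge> 2 \<Longrightarrow> finite_graph {..<m} (cycle_edges m)"
  by (auto simp: finite_graph_def cycle_edges_def sym_def irrefl_def mod_Suc split: if_splits)

lemma subgroup_two_group: "subgroup {False} two_group"
  using group.triv_subgroup[OF group_two_group] by (simp add: two_group_def)

lemma pair_rep_two_group: "\<exists>\<rho> u lam phi. pair_rep two_group {False} (UNIV :: bool set) \<rho> u lam phi"
proof -
  have c: "carrier two_group = UNIV" by (simp add: two_group_def)
  show ?thesis using pair_rep_finite[OF group_two_group _ subgroup_two_group] unfolding c by simp
qed

text \<open>The subgroup supplied by the graph product theorem is the image of the base group, which
  is trivial here because every \<open>A v\<close> is.\<close>

lemma pair_rep_racg:
  assumes "m \<ge> 2"
  shows "\<exists>(I :: (nat \<times> bool) option set) \<rho> u lam phi. pair_rep (racg m) {\<one>\<^bsub>racg m\<^esub>} I \<rho> u lam phi"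
proof -
  let ?G = "\<lambda>_ :: nat. two_group" and ?A = "\<lambda>_ :: nat. {False}"
  let ?K = "complete_subgraphs {..<m} (cycle_edges m)"
  let ?\<iota> = "colimit_inj ?K (\<subseteq>) (clique_group {..<m} ?G ?A) (\<lambda>S T x. x)"
  note fin = pair_rep_two_group
  have grp: "group (clique_group {..<m} ?G ?A S)" for S
    by (rule group_clique_group) (auto simp: group_two_group subgroup_two_group)
  have "carrier (clique_group {..<m} ?G ?A {}) = {\<one>\<^bsub>clique_group {..<m} ?G ?A {}\<^esub>}"
    by (auto simp: clique_group_def two_group_def PiE_def extensional_def fun_eq_iff restrict_def Pi_def)
  moreover have "?\<iota> {} \<one>\<^bsub>clique_group {..<m} ?G ?A {}\<^esub> = \<one>\<^bsub>racg m\<^esub>"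
    unfolding racg_def graph_product_of_pairs_def
    by (rule hom_one[OF _ grp group_group_colimit[of ?K, OF grp]])
      (rule colimit_inj_hom, auto simp: complete_subgraphs_def grp)
  ultimately have "?\<iota> {} ` carrier (clique_group {..<m} ?G ?A {}) = {\<one>\<^bsub>racg m\<^esub>}" by simp
  then show ?thesis
    using graph_product_pair_rep[of "{..<m}" "cycle_edges m" ?G ?A "\<lambda>_. UNIV"]
      finite_graph_cycle[OF assms] group_two_group subgroup_two_group fin by (simp add: racg_def)
qed

definition gen :: "nat \<Rightarrow> nat \<Rightarrow> (nat set \<times> (nat \<Rightarrow> bool)) list set"
  where "gen m i = colimit_inj (complete_subgraphs {..<m} (cycle_edges m)) (\<subseteq>)
    (clique_group {..<m} (\<lambda>_. two_group) (\<lambda>_. {False})) (\<lambda>S T x. x) {i} (\<lambda>j\<in>{..<m}. j = i)"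

lemma group_racg: "group (racg m)"
  unfolding racg_def by (rule group_graph_product_of_pairs) (auto simp: group_two_group subgroup_two_group)

lemma racg_gen:
  assumes m: "m \<ge> 2"
  shows "i < m \<Longrightarrow> gen m i \<in> carrier (racg m)"
    and "i < m \<Longrightarrow> gen m i \<otimes>\<^bsub>racg m\<^esub> gen m i = \<one>\<^bsub>racg m\<^esub>"
    and "(i, j) \<in> cycle_edges m \<Longrightarrow> gen m i \<otimes>\<^bsub>racg m\<^esub> gen m j = gen m j \<otimes>\<^bsub>racg m\<^esub> gen m i"
proof -
  obtain \<rho> u lam phi where "pair_rep two_group {False} (UNIV :: bool set) \<rho> u lam phi"
    using pair_rep_two_group by blast
  then interpret graph_pair_rep "{..<m}" "cycle_edges m" "\<lambda>_. two_group" "\<lambda>_. {False}" "\<lambda>_. UNIV"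
      "\<lambda>_. \<rho>" "\<lambda>_. u" "\<lambda>_. lam" "\<lambda>_. phi"
    by (intro graph_pair_rep.intro) (auto simp: finite_graph_cycle m group_two_group subgroup_two_group)
  have gen: "gen m i = letter i True" for i
    unfolding gen_def single_def
    by (rule arg_cong[where f = "colimit_inj _ _ _ _ _"]) (auto simp: restrict_def two_group_def)
  have syl: "(i, True) \<in> syllables" if "i < m" for i using that by (simp add: two_group_def)
  show "gen m i \<in> carrier (racg m)" if "i < m"
    using letter_carrier[OF syl[OF that]] by (simp add: gen racg_def)
  show "gen m i \<otimes>\<^bsub>racg m\<^esub> gen m i = \<one>\<^bsub>racg m\<^esub>" if "i < m"
  proof -
    have "gen m i \<otimes>\<^bsub>racg m\<^esub> gen m i = letter i False"
      using letter_mult[OF syl syl, OF that that] by (simp add: gen racg_def two_group_def)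
    also have "single i False = \<one>\<^bsub>GC {i}\<^esub>"
      by (rule clique_eqI[OF clique_ext(3,2)]) (simp add: single_def clique_one, simp add: two_group_def)
    finally show ?thesis using \<iota>_one[OF K_single] that by (simp add: racg_def)
  qed
  show "gen m i \<otimes>\<^bsub>racg m\<^esub> gen m j = gen m j \<otimes>\<^bsub>racg m\<^esub> gen m i" if "(i, j) \<in> cycle_edges m"
    using letter_comm[OF syl syl that] that by (simp add: gen racg_def cycle_edges_def)
qed

text \<open>A clique element is a set of pairwise adjacent indices, sent to the product of the
  \<open>t i\<close> in increasing order; this is multiplicative because these factors commute. The
  formula does not mention the clique, so the maps agree on smaller cliques.\<close>

lemma racg_universal:
  fixes H :: "'h monoid"
  assumes m: "m \<ge> 2" and H: "group H"
    and t: "\<And>i. i < m \<Longrightarrow> t i \<in> carrier H" "\<And>i. i < m \<Longrightarrow> t i \<otimes>\<^bsub>H\<^esub> t i = \<one>\<^bsub>H\<^esub>"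
    and comm: "\<And>i j. (i, j) \<in> cycle_edges m \<Longrightarrow> t i \<otimes>\<^bsub>H\<^esub> t j = t j \<otimes>\<^bsub>H\<^esub> t i"
  shows "\<exists>h \<in> hom (racg m) H. \<forall>i<m. h (gen m i) = t i"
proof -
  interpret H: group H by (rule H)
  let ?GC = "clique_group {..<m} (\<lambda>_. two_group) (\<lambda>_. {False})"
  let ?K = "complete_subgraphs {..<m} (cycle_edges m)"
  have grp: "group (?GC S)" for S
    by (rule group_clique_group) (auto simp: group_two_group subgroup_two_group)
  define l where "l x = map (\<lambda>i. if x i then t i else \<one>\<^bsub>H\<^esub>) [0..<m]" for x
  define f where "f (S :: nat set) x = foldr (\<otimes>\<^bsub>H\<^esub>) (l x) \<one>\<^bsub>H\<^esub>" for S x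
  have GC: "x \<in> carrier (?GC S) \<longleftrightarrow> x \<in> extensional {..<m} \<and> (\<forall>i<m. x i \<longrightarrow> i \<in> S)" for x S
    by (auto simp: clique_group_def two_group_def PiE_def Pi_def split: if_splits)
  have fold_closed: "set xs \<subseteq> carrier H \<Longrightarrow> foldr (\<otimes>\<^bsub>H\<^esub>) xs \<one>\<^bsub>H\<^esub> \<in> carrier H" for xs
    by (induction xs) auto
  have fold_mult: "foldr (\<otimes>\<^bsub>H\<^esub>) (map (\<lambda>i. a i \<otimes>\<^bsub>H\<^esub> b i) is) \<one>\<^bsub>H\<^esub>
      = foldr (\<otimes>\<^bsub>H\<^esub>) (map a is) \<one>\<^bsub>H\<^esub> \<otimes>\<^bsub>H\<^esub> foldr (\<otimes>\<^bsub>H\<^esub>) (map b is) \<one>\<^bsub>H\<^esub>"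
    if "a ` set is \<subseteq> carrier H" "b ` set is \<subseteq> carrier H"
      "\<And>i j. i \<in> set is \<Longrightarrow> j \<in> set is \<Longrightarrow> a i \<otimes>\<^bsub>H\<^esub> b j = b j \<otimes>\<^bsub>H\<^esub> a i" for a b :: "nat \<Rightarrow> _" and "is"
    using that
  proof (induction "is")
    case (Cons i "is")
    note outer = Cons.prems(3)
    let ?a = "foldr (\<otimes>\<^bsub>H\<^esub>) (map a is) \<one>\<^bsub>H\<^esub>" and ?b = "foldr (\<otimes>\<^bsub>H\<^esub>) (map b is) \<one>\<^bsub>H\<^esub>"
    have c: "a i \<in> carrier H" "b i \<in> carrier H" "?a \<in> carrier H" "?b \<in> carrier H"
      using Cons.prems by (auto intro!: fold_closed)
    have "foldr (\<otimes>\<^bsub>H\<^esub>) (map a js) \<one>\<^bsub>H\<^esub> \<otimes>\<^bsub>H\<^esub> b i = b i \<otimes>\<^bsub>H\<^esub> foldr (\<otimes>\<^bsub>H\<^esub>) (map a js) \<one>\<^bsub>H\<^esub>"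
      if "set js \<subseteq> set is" for js
      using that
    proof (induction js)
      case (Cons j js)
      let ?c = "foldr (\<otimes>\<^bsub>H\<^esub>) (map a js) \<one>\<^bsub>H\<^esub>"
      have "set js \<subseteq> set is" using Cons.prems by simp
      then have "a ` set js \<subseteq> carrier H" "a j \<in> carrier H"
        using Cons.prems \<open>a ` set (i # is) \<subseteq> carrier H\<close> by auto
      then have *: "a j \<in> carrier H" "?c \<in> carrier H"
        by (auto intro!: fold_closed[of "map a js"])
      have "(a j \<otimes>\<^bsub>H\<^esub> ?c) \<otimes>\<^bsub>H\<^esub> b i = (a j \<otimes>\<^bsub>H\<^esub> b i) \<otimes>\<^bsub>H\<^esub> ?c"
        using * c Cons by (simp add: H.m_assoc)
      also have "a j \<otimes>\<^bsub>H\<^esub> b i = b i \<otimes>\<^bsub>H\<^esub> a j"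
        by (rule outer) (use Cons.prems in auto)
      finally show ?case using * c by (simp add: H.m_assoc)
    qed (use c in simp)
    then have "?a \<otimes>\<^bsub>H\<^esub> b i = b i \<otimes>\<^bsub>H\<^esub> ?a" by blast
    then have "a i \<otimes>\<^bsub>H\<^esub> b i \<otimes>\<^bsub>H\<^esub> (?a \<otimes>\<^bsub>H\<^esub> ?b) = a i \<otimes>\<^bsub>H\<^esub> ?a \<otimes>\<^bsub>H\<^esub> (b i \<otimes>\<^bsub>H\<^esub> ?b)"
      using c by (metis H.m_assoc H.m_closed)
    then show ?case using Cons by simp
  qed simp
  have f_hom: "f S \<in> hom (?GC S) H" if S: "S \<in> ?K" for S
  proof (rule homI)
    fix x y assume x: "x \<in> carrier (?GC S)" and y: "y \<in> carrier (?GC S)"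
    show "f S x \<in> carrier H" unfolding f_def l_def by (rule fold_closed) (use t in auto)
    have 1: "(x \<otimes>\<^bsub>?GC S\<^esub> y) i \<longleftrightarrow> x i \<noteq> y i" if "i < m" for i
      using that by (simp add: clique_group_def two_group_def)
    have "l (x \<otimes>\<^bsub>?GC S\<^esub> y) = map (\<lambda>i. (if x i then t i else \<one>\<^bsub>H\<^esub>) \<otimes>\<^bsub>H\<^esub> (if y i then t i else \<one>\<^bsub>H\<^esub>)) [0..<m]"
      unfolding l_def by (rule map_cong) (use t in \<open>auto simp: 1\<close>)
    then show "f S (x \<otimes>\<^bsub>?GC S\<^esub> y) = f S x \<otimes>\<^bsub>H\<^esub> f S y"
      unfolding f_def l_def
    proof (simp only:, intro fold_mult)
      fix i j assume ij: "i \<in> set [0..<m]" "j \<in> set [0..<m]"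
      have "t i \<otimes>\<^bsub>H\<^esub> t j = t j \<otimes>\<^bsub>H\<^esub> t i" if "x i" "y j"
      proof (cases "i = j")
        case False
        have "i \<in> S" "j \<in> S" using that x y ij by (auto simp: GC)
        then have "(i, j) \<in> cycle_edges m" using S False by (auto simp: complete_subgraphs_def)
        then show ?thesis by (rule comm)
      qed simp
      then show "(if x i then t i else \<one>\<^bsub>H\<^esub>) \<otimes>\<^bsub>H\<^esub> (if y j then t j else \<one>\<^bsub>H\<^esub>)
        = (if y j then t j else \<one>\<^bsub>H\<^esub>) \<otimes>\<^bsub>H\<^esub> (if x i then t i else \<one>\<^bsub>H\<^esub>)"
        using t ij by auto
    qed (use t in auto)
  qed
  have "\<exists>!h. h \<in> hom (group_colimit ?K (\<subseteq>) ?GC (\<lambda>S T x. x)) H \<inter>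
      extensional (carrier (group_colimit ?K (\<subseteq>) ?GC (\<lambda>S T x. x)))
    \<and> (\<forall>S\<in>?K. \<forall>x\<in>carrier (?GC S). h (colimit_inj ?K (\<subseteq>) ?GC (\<lambda>S T x. x) S x) = f S x)"
    by (rule colimit_universal[OF grp H f_hom]) (simp_all add: f_def)
  from ex1_implies_ex[OF this] obtain h where h: "h \<in> hom (racg m) H"
    and hf: "\<And>S x. S \<in> ?K \<Longrightarrow> x \<in> carrier (?GC S) \<Longrightarrow> h (colimit_inj ?K (\<subseteq>) ?GC (\<lambda>S T x. x) S x) = f S x"
    unfolding racg_def graph_product_of_pairs_def by (elim exE conjE IntE) simp
  have "h (gen m i) = t i" if i: "i < m" for i
  proof -
    have "h (gen m i) = f {i} (\<lambda>j\<in>{..<m}. j = i)"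
      unfolding gen_def by (rule hf) (use i in \<open>auto simp: complete_subgraphs_def GC\<close>)
    moreover have "l (\<lambda>j\<in>{..<m}. j = i) = map (\<lambda>j. if j = i then t i else \<one>\<^bsub>H\<^esub>) [0..<m]"
      by (auto simp: l_def)
    ultimately have "h (gen m i) = foldr (\<otimes>\<^bsub>H\<^esub>) (map (\<lambda>j. if j = i then t i else \<one>\<^bsub>H\<^esub>) [0..<m]) \<one>\<^bsub>H\<^esub>"
      by (simp add: f_def)
    moreover have "foldr (\<otimes>\<^bsub>H\<^esub>) (map (\<lambda>j. if j = i then t i else \<one>\<^bsub>H\<^esub>) js) \<one>\<^bsub>H\<^esub>
        = (if i \<in> set js then t i else \<one>\<^bsub>H\<^esub>)" if "distinct js" for js
      using that t(1)[OF i] by (induction js) auto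
    ultimately show ?thesis using i by simp
  qed
  then show ?thesis using h by blast
qed

lemma (in group) inv_cancel_left:
  "x \<in> carrier G \<Longrightarrow> y \<in> carrier G \<Longrightarrow> inv x \<otimes> (x \<otimes> y) = y"
  "x \<in> carrier G \<Longrightarrow> y \<in> carrier G \<Longrightarrow> x \<otimes> (inv x \<otimes> y) = y"
  by (simp_all add: m_assoc[symmetric])

text \<open>The right-hand side is a factor in \<open>p\<close> times a factor in \<open>p'\<close>
  of mirrored form. A product of such commutators along a chain of involutions therefore
  telescopes.\<close>

lemma (in group) commutator_involutions:
  assumes c: "e \<in> carrier G" "p \<in> carrier G" "p' \<in> carrier G" "z \<in> carrier G"
    and i: "e \<otimes> e = \<one>" "p \<otimes> p = \<one>" "p' \<otimes> p' = \<one>" "z \<otimes> z = \<one>"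
    and z: "z \<otimes> p = p \<otimes> z" "z \<otimes> p' = p' \<otimes> z"
  defines "q \<equiv> e \<otimes> p \<otimes> e"
  shows "commutator G (q \<otimes> p \<otimes> p' \<otimes> q) (q \<otimes> e \<otimes> z \<otimes> q) = (q \<otimes> p) \<otimes> (p' \<otimes> (e \<otimes> p' \<otimes> e))"
proof -
  have ii: "e \<otimes> (e \<otimes> x) = x" "p \<otimes> (p \<otimes> x) = x" "p' \<otimes> (p' \<otimes> x) = x" "z \<otimes> (z \<otimes> x) = x"
    "z \<otimes> (p \<otimes> x) = p \<otimes> (z \<otimes> x)" "z \<otimes> (p' \<otimes> x) = p' \<otimes> (z \<otimes> x)"
    if "x \<in> carrier G" for x
    using that c i z by (simp_all add: m_assoc[symmetric])
  have inv: "inv (q \<otimes> p \<otimes> p' \<otimes> q) = q \<otimes> p' \<otimes> p \<otimes> q" "inv (q \<otimes> e \<otimes> z \<otimes> q) = q \<otimes> z \<otimes> e \<otimes> q"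
    by (rule inv_equality; use c in \<open>simp add: q_def m_assoc i ii z\<close>)+
  show ?thesis unfolding commutator_def inv using c by (simp add: q_def m_assoc i ii z)
qed

section \<open>Involutions on four copies of a group\<close>

context
  fixes \<Pi>' :: "('p, 'm) monoid_scheme" (structure)
  assumes group_\<Pi>: "group \<Pi>'"
begin

interpretation group \<Pi>' by (rule group_\<Pi>)

text \<open>The flags name four tiles. A flip crosses to the tile with the other \<eta>, multiplying
  by \<open>c\<close> or \<open>d\<close> on the way in and by the inverse on the way back;
  \<epsilon> selects which of the two. \<open>flip_z\<close> exchanges the roles of the
  flags.\<close>

definition flip_p :: "'p \<Rightarrow> 'p \<Rightarrow> 'p \<times> bool \<times> bool \<Rightarrow> 'p \<times> bool \<times> bool"
  where "flip_p c d = (\<lambda>(y, \<epsilon>, \<eta>)\<in>carrier \<Pi>' \<times> UNIV.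
    ((if \<epsilon> then (if \<eta> then inv d else d) else (if \<eta> then inv c else c)) \<otimes> y, \<epsilon>, \<not> \<eta>))"

definition flip_z :: "'p \<Rightarrow> 'p \<Rightarrow> 'p \<times> bool \<times> bool \<Rightarrow> 'p \<times> bool \<times> bool"
  where "flip_z c d = (\<lambda>(y, \<epsilon>, \<eta>)\<in>carrier \<Pi>' \<times> UNIV.
    ((if \<eta> then (if \<epsilon> then inv d else d) else (if \<epsilon> then inv c else c)) \<otimes> y, \<not> \<epsilon>, \<eta>))"

lemma flip_bij:
  assumes "c \<in> carrier \<Pi>'" "d \<in> carrier \<Pi>'"
  shows "flip_p c d \<in> Bij (carrier \<Pi>' \<times> UNIV)" "flip_z c d \<in> Bij (carrier \<Pi>' \<times> UNIV)"
proof -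
  have "bij_betw (flip_p c d) (carrier \<Pi>' \<times> UNIV) (carrier \<Pi>' \<times> UNIV)"
    "bij_betw (flip_z c d) (carrier \<Pi>' \<times> UNIV) (carrier \<Pi>' \<times> UNIV)"
    by (rule bij_betwI[where g = "flip_p c d"] bij_betwI[where g = "flip_z c d"];
      use assms in \<open>auto simp: flip_p_def flip_z_def inv_cancel_left\<close>)+
  then show "flip_p c d \<in> Bij (carrier \<Pi>' \<times> UNIV)" "flip_z c d \<in> Bij (carrier \<Pi>' \<times> UNIV)"
    by (auto simp: Bij_def flip_p_def flip_z_def)
qed

lemma flip_involution:
  assumes "c \<in> carrier \<Pi>'" "d \<in> carrier \<Pi>'" and x: "x \<in> carrier \<Pi>' \<times> UNIV"
  shows "flip_p c d (flip_p c d x) = x" "flip_z c d (flip_z c d x) = x"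
  using assms by (auto simp: flip_p_def flip_z_def inv_cancel_left)

text \<open>The four tiles form a square. The equation says that both ways from (False, False) to
  the opposite tile agree; the other three starting points follow by inverting sides of the
  square.\<close>

lemma flip_comm:
  assumes c: "P \<in> carrier \<Pi>'" "Q \<in> carrier \<Pi>'" "E \<in> carrier \<Pi>'" "E' \<in> carrier \<Pi>'"
    and eq: "Q \<otimes> E = E' \<otimes> P" and x: "x \<in> carrier \<Pi>' \<times> UNIV"
  shows "flip_p P Q (flip_z E E' x) = flip_z E E' (flip_p P Q x)"
proof -
  obtain y \<epsilon> \<eta> where x: "x = (y, \<epsilon>, \<eta>)" "y \<in> carrier \<Pi>'" using x by (cases x) auto
  have 1: "P \<otimes> inv E = inv E' \<otimes> Q"
    by (metis c eq inv_closed inv_solve_left inv_solve_right' m_assoc m_closed)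
  have 2: "inv Q \<otimes> E' = E \<otimes> inv P"
    by (metis c eq inv_closed inv_solve_left' inv_solve_right m_assoc m_closed)
  have 3: "inv P \<otimes> inv E' = inv E \<otimes> inv Q"
    by (metis c eq inv_mult_group)
  have *: "Q \<otimes> (E \<otimes> y) = E' \<otimes> (P \<otimes> y)" "P \<otimes> (inv E \<otimes> y) = inv E' \<otimes> (Q \<otimes> y)"
    "inv Q \<otimes> (E' \<otimes> y) = E \<otimes> (inv P \<otimes> y)" "inv P \<otimes> (inv E' \<otimes> y) = inv E \<otimes> (inv Q \<otimes> y)"
    using c x eq 1 2 3 by (simp_all add: m_assoc[symmetric])
  show ?thesis using c x * by (cases \<epsilon>; cases \<eta>) (auto simp: flip_p_def flip_z_def)
qed

end

text \<open>The subgroup \<open>Z\<close> is the relation between \<open>W\<close> and \<open>\<Pi>'\<close> obtained from an action of \<open>W\<close>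
  on four copies of \<open>\<Pi>'\<close>. It serves as a left inverse of the map \<open>\<alpha>\<^sub>k \<mapsto> a\<^sub>k\<close>,
  \<open>\<beta>\<^sub>k \<mapsto> b\<^sub>k\<close>.\<close>

lemma surface_word_group:
  assumes g: "g \<ge> 1"
  defines "W \<equiv> racg (2 * g + 2)"
  shows "\<exists>a b. (\<forall>k<g. a k \<in> carrier W \<and> b k \<in> carrier W) \<and> commutator_prod W a b g = \<one>\<^bsub>W\<^esub> \<and>
    (\<forall>(\<Pi>' :: ('p, 'm) monoid_scheme) \<alpha> \<beta>. group \<Pi>' \<longrightarrow> (\<forall>k<g. \<alpha> k \<in> carrier \<Pi>' \<and> \<beta> k \<in> carrier \<Pi>') \<longrightarrow>
      commutator_prod \<Pi>' \<alpha> \<beta> g = \<one>\<^bsub>\<Pi>'\<^esub> \<longrightarrow>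
      (\<exists>Z. subgroup Z (W \<times>\<times> \<Pi>') \<and> (\<forall>k<g. (a k, \<alpha> k) \<in> Z \<and> (b k, \<beta> k) \<in> Z) \<and>
        (\<forall>\<pi>. (\<one>\<^bsub>W\<^esub>, \<pi>) \<in> Z \<longrightarrow> \<pi> = \<one>\<^bsub>\<Pi>'\<^esub>)))"
proof -
  let ?m = "2 * g + 2"
  have m: "?m \<ge> 2" by simp
  interpret W: group W unfolding W_def by (rule group_racg)
  note gen = racg_gen[OF m, folded W_def]
  \<comment> \<open>Around the cycle the generators alternate \<open>z 0\<close>,
    \<open>p 0\<close>, \<open>z 1\<close>, \<open>p 1\<close>, ..., \<open>z g\<close>,
    \<open>p g\<close>, and \<open>e\<close> is \<open>z 0\<close>.\<close>
  define p where "p k = gen ?m (2 * k + 1)" for k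
  define z where "z k = gen ?m (2 * k)" for k
  define e where "e = gen ?m 0"
  define q where "q k = e \<otimes>\<^bsub>W\<^esub> p k \<otimes>\<^bsub>W\<^esub> e" for k
  \<comment> \<open>Both \<open>a k\<close> and \<open>b k\<close> use evenly many odd-numbered and
    evenly many even-numbered generators, so they return every tile to itself.\<close>
  define a where "a k = q k \<otimes>\<^bsub>W\<^esub> p k \<otimes>\<^bsub>W\<^esub> p (Suc k) \<otimes>\<^bsub>W\<^esub> q k" for k
  define b where "b k = q k \<otimes>\<^bsub>W\<^esub> e \<otimes>\<^bsub>W\<^esub> z (Suc k) \<otimes>\<^bsub>W\<^esub> q k" for k
  have e: "e \<in> carrier W" "e \<otimes>\<^bsub>W\<^esub> e = \<one>\<^bsub>W\<^esub>" using gen(1,2)[of 0] by (auto simp: e_def)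
  have p: "p k \<in> carrier W" "p k \<otimes>\<^bsub>W\<^esub> p k = \<one>\<^bsub>W\<^esub>" if "k \<le> g" for k
    using gen(1,2)[of "2 * k + 1"] that by (auto simp: p_def)
  have z: "z k \<in> carrier W" "z k \<otimes>\<^bsub>W\<^esub> z k = \<one>\<^bsub>W\<^esub>" if "k \<le> g" for k
    using gen(1,2)[of "2 * k"] that by (auto simp: z_def)
  have q: "q k \<in> carrier W" if "k \<le> g" for k using e p[OF that] by (simp add: q_def)
  have zp: "z (Suc k) \<otimes>\<^bsub>W\<^esub> p k = p k \<otimes>\<^bsub>W\<^esub> z (Suc k)"
    "z (Suc k) \<otimes>\<^bsub>W\<^esub> p (Suc k) = p (Suc k) \<otimes>\<^bsub>W\<^esub> z (Suc k)" if "k < g" for k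
    unfolding z_def p_def by (rule gen(3), use that in \<open>simp add: cycle_edges_def\<close>)+
  \<comment> \<open>The generator 0 has the neighbours 1 and 2g + 1; these two relations make the
    ends of the telescoping product trivial.\<close>
  have ep: "e \<otimes>\<^bsub>W\<^esub> p 0 = p 0 \<otimes>\<^bsub>W\<^esub> e" "e \<otimes>\<^bsub>W\<^esub> p g = p g \<otimes>\<^bsub>W\<^esub> e"
    unfolding e_def p_def by (rule gen(3), use g in \<open>simp add: cycle_edges_def\<close>)+
  have qp: "q k \<otimes>\<^bsub>W\<^esub> p k = \<one>\<^bsub>W\<^esub>" "p k \<otimes>\<^bsub>W\<^esub> q k = \<one>\<^bsub>W\<^esub>"
    if "e \<otimes>\<^bsub>W\<^esub> p k = p k \<otimes>\<^bsub>W\<^esub> e" "k \<le> g" for k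
  proof -
    have "q k = p k" unfolding q_def that(1) using e p[OF that(2)] by (simp add: W.m_assoc)
    then show "q k \<otimes>\<^bsub>W\<^esub> p k = \<one>\<^bsub>W\<^esub>" "p k \<otimes>\<^bsub>W\<^esub> q k = \<one>\<^bsub>W\<^esub>" using p[OF that(2)] by auto
  qed
  have comm: "commutator W (a k) (b k) = (q k \<otimes>\<^bsub>W\<^esub> p k) \<otimes>\<^bsub>W\<^esub> (p (Suc k) \<otimes>\<^bsub>W\<^esub> q (Suc k))" if "k < g" for k
    unfolding a_def b_def q_def
    by (rule W.commutator_involutions) (use that e p z zp in auto)
  \<comment> \<open>Consecutive factors cancel, since \<open>p k\<close>, \<open>q k\<close>,
    \<open>q k\<close>, \<open>p k\<close> multiply to the unit. By \<open>ep\<close> the remaining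
    product is trivial at k = 0 and at k = g.\<close>
  have tele: "commutator_prod W a b k = p k \<otimes>\<^bsub>W\<^esub> q k" if "k \<le> g" for k
    using that
  proof (induction k)
    case 0
    show ?case using qp(2)[OF ep(1)] by simp
  next
    case (Suc k)
    have k: "p k \<in> carrier W" "q k \<in> carrier W" "p (Suc k) \<in> carrier W" "q (Suc k) \<in> carrier W"
      using Suc.prems p q by auto
    have ii: "e \<otimes>\<^bsub>W\<^esub> (e \<otimes>\<^bsub>W\<^esub> x) = x" "p k \<otimes>\<^bsub>W\<^esub> (p k \<otimes>\<^bsub>W\<^esub> x) = x" if "x \<in> carrier W" for x
      using that e k p(2)[of k] Suc.prems by (simp_all add: W.m_assoc[symmetric])
    have "p k \<otimes>\<^bsub>W\<^esub> q k \<otimes>\<^bsub>W\<^esub> (q k \<otimes>\<^bsub>W\<^esub> p k) = \<one>\<^bsub>W\<^esub>"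
      using k e p(2)[of k] Suc.prems by (simp add: q_def W.m_assoc ii)
    moreover have "commutator_prod W a b (Suc k)
      = (p k \<otimes>\<^bsub>W\<^esub> q k) \<otimes>\<^bsub>W\<^esub> ((q k \<otimes>\<^bsub>W\<^esub> p k) \<otimes>\<^bsub>W\<^esub> (p (Suc k) \<otimes>\<^bsub>W\<^esub> q (Suc k)))"
      using Suc by (simp add: comm)
    then have "commutator_prod W a b (Suc k)
      = (p k \<otimes>\<^bsub>W\<^esub> q k \<otimes>\<^bsub>W\<^esub> (q k \<otimes>\<^bsub>W\<^esub> p k)) \<otimes>\<^bsub>W\<^esub> (p (Suc k) \<otimes>\<^bsub>W\<^esub> q (Suc k))"
      using k by (simp only: W.m_assoc W.m_closed)
    ultimately show ?case using k by simp
  qed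
  have prod: "commutator_prod W a b g = \<one>\<^bsub>W\<^esub>" using tele[of g] qp(2)[OF ep(2)] by simp
  have ab: "\<forall>k<g. a k \<in> carrier W \<and> b k \<in> carrier W"
    using e p q z by (simp add: a_def b_def Suc_leI)
  have "\<exists>Z. subgroup Z (W \<times>\<times> \<Pi>') \<and> (\<forall>k<g. (a k, \<alpha> k) \<in> Z \<and> (b k, \<beta> k) \<in> Z) \<and>
        (\<forall>\<pi>. (\<one>\<^bsub>W\<^esub>, \<pi>) \<in> Z \<longrightarrow> \<pi> = \<one>\<^bsub>\<Pi>'\<^esub>)"
    if group: "group \<Pi>'" and \<alpha>\<beta>: "\<forall>k<g. \<alpha> k \<in> carrier \<Pi>' \<and> \<beta> k \<in> carrier \<Pi>'"
      and rel: "commutator_prod \<Pi>' \<alpha> \<beta> g = \<one>\<^bsub>\<Pi>'\<^esub>" for \<Pi>' :: "('p, 'm) monoid_scheme" (structure) and \<alpha> \<beta>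
  proof -
    interpret \<Pi>': group \<Pi>' by (rule group)
    \<comment> \<open>The flip of \<open>p k\<close> multiplies by \<open>P k\<close> or
      \<open>Q k\<close>. The recursion is forced: the first line makes \<open>a k\<close> act as
      \<open>\<alpha> k\<close> on the tile (False, False), the second makes the flip of
      \<open>z (Suc k)\<close> commute with that of \<open>p (Suc k)\<close>.\<close>
    define PQ where "PQ = rec_nat (\<one>, \<one>) (\<lambda>k (P, Q).
      (Q \<otimes> inv \<alpha> k \<otimes> (inv Q \<otimes> P), Q \<otimes> \<beta> k \<otimes> inv \<alpha> k \<otimes> inv \<beta> k))"
    define P where "P k = fst (PQ k)" for k
    define Q where "Q k = snd (PQ k)" for k
    have P0: "P 0 = \<one>" "Q 0 = \<one>" by (auto simp: P_def Q_def PQ_def)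
    have PS: "P (Suc k) = Q k \<otimes> inv \<alpha> k \<otimes> (inv Q k \<otimes> P k)"
      "Q (Suc k) = Q k \<otimes> \<beta> k \<otimes> inv \<alpha> k \<otimes> inv \<beta> k" for k
      by (auto simp: P_def Q_def PQ_def split: prod.split)
    have PQc: "P k \<in> carrier \<Pi>' \<and> Q k \<in> carrier \<Pi>'" if "k \<le> g" for k
      using that by (induction k) (use \<alpha>\<beta> in \<open>auto simp: P0 PS\<close>)
    \<comment> \<open>The quotient of the two sequences records the product of commutators, so the
      surface relation says exactly that they meet again at g.\<close>
    have "inv (Q k) \<otimes> P k = inv (commutator_prod \<Pi>' \<alpha> \<beta> k) \<and> commutator_prod \<Pi>' \<alpha> \<beta> k \<in> carrier \<Pi>'" if "k \<le> g" for k
      using that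
    proof (induction k)
      case (Suc k)
      then have c: "P k \<in> carrier \<Pi>'" "Q k \<in> carrier \<Pi>'" "\<alpha> k \<in> carrier \<Pi>'" "\<beta> k \<in> carrier \<Pi>'"
        using PQc[of k] \<alpha>\<beta> by auto
      then show ?case using Suc unfolding PS
        by (simp add: commutator_def \<Pi>'.inv_mult_group \<Pi>'.m_assoc \<Pi>'.inv_cancel_left)
    qed (simp add: P0)
    from this[of g] have "inv (Q g) \<otimes> P g = \<one>" using rel by simp
    then have PQg: "P g = Q g" using PQc[of g] by (metis \<Pi>'.inv_cancel_left(2) \<Pi>'.r_one order_refl)
    \<comment> \<open>\<open>E' (Suc j)\<close> is forced by \<open>b j\<close> acting as
      \<open>\<beta> j\<close>, and \<open>E (Suc j)\<close> by commutation with \<open>p j\<close>.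
      The values 1 at 0 make \<open>e\<close> a mere change of tile.\<close>
    define E where "E k = (case k of 0 \<Rightarrow> \<one> | Suc j \<Rightarrow> \<beta> j \<otimes> (inv Q j \<otimes> P j))" for k
    define E' where "E' k = (case k of 0 \<Rightarrow> \<one> | Suc j \<Rightarrow> Q j \<otimes> \<beta> j \<otimes> inv Q j)" for k
    have Ec: "E k \<in> carrier \<Pi>'" "E' k \<in> carrier \<Pi>'" if "k \<le> g" for k
      using that PQc \<alpha>\<beta> by (auto simp: E_def E'_def split: nat.split)
    have sq: "Q k \<otimes> E (Suc k) = E' (Suc k) \<otimes> P k" "Q (Suc k) \<otimes> E (Suc k) = E' (Suc k) \<otimes> P (Suc k)"
      if "k < g" for k
    proof -
      have c: "P k \<in> carrier \<Pi>'" "Q k \<in> carrier \<Pi>'" "\<alpha> k \<in> carrier \<Pi>'" "\<beta> k \<in> carrier \<Pi>'"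
        using PQc[of k] \<alpha>\<beta> that by auto
      then show "Q k \<otimes> E (Suc k) = E' (Suc k) \<otimes> P k" "Q (Suc k) \<otimes> E (Suc k) = E' (Suc k) \<otimes> P (Suc k)"
        by (simp_all add: E_def E'_def PS \<Pi>'.m_assoc \<Pi>'.inv_cancel_left)
    qed
    let ?X = "carrier \<Pi>' \<times> (UNIV :: (bool \<times> bool) set)"
    let ?B = "BijGroup ?X"
    define t where "t i = (if odd i then flip_p \<Pi>' (P (i div 2)) (Q (i div 2))
      else flip_z \<Pi>' (E (i div 2)) (E' (i div 2)))" for i
    have tc: "t i \<in> carrier ?B" if "i < ?m" for i
      using that flip_bij[OF group] PQc Ec by (auto simp: t_def BijGroup_def)
    have tB: "t i \<in> Bij ?X" if "i < ?m" for i using tc[OF that] by (simp add: BijGroup_def)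
    have tX: "t i x \<in> ?X" if "i < ?m" "x \<in> ?X" for i x
      using tB[OF that(1)] that(2) by (auto simp: Bij_def dest: bij_betwE)
    have tt: "t i \<otimes>\<^bsub>?B\<^esub> t i = \<one>\<^bsub>?B\<^esub>" if i: "i < ?m" for i
    proof -
      have "compose ?X (t i) (t i) = (\<lambda>x\<in>?X. x)"
        using i PQc[of "i div 2"] Ec[of "i div 2"]
        by (auto simp: compose_def t_def flip_involution[OF group] fun_eq_iff simp del: mem_Sigma_iff)
      then show ?thesis using tB[OF i] by (simp add: BijGroup_def)
    qed
    have tcomm1: "t i (t j x) = t j (t i x)"
      if "i < ?m" "j < ?m" "odd i" "even j" "(i, j) \<in> cycle_edges ?m" and x: "x \<in> ?X" for i j x
    proof -
      obtain k where k: "i = 2 * k + 1" using \<open>odd i\<close> by (elim oddE)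
      obtain l where l: "j = 2 * l" using \<open>even j\<close> by (elim evenE)
      have "Q k \<otimes> E l = E' l \<otimes> P k"
      proof (cases l)
        case 0
        \<comment> \<open>The generator 0 meets only \<open>p 0\<close> and \<open>p g\<close>. With
          \<open>E 0 = E' 0 = \<one>\<close> the square reduces to \<open>P k = Q k\<close>, which
          at k = g is the surface relation.\<close>
        then have "k = 0 \<or> k = g" using that k l by (auto simp: cycle_edges_def mod_Suc split: if_splits)
        then show ?thesis using 0 PQg PQc by (auto simp: E_def E'_def P0)
      next
        case (Suc l')
        then have "k = l' \<or> k = Suc l'" "l' < g"
          using that k l by (auto simp: cycle_edges_def mod_Suc split: if_splits)
        then show ?thesis using sq[of l'] Suc by auto
      qed
      then show ?thesis
        using flip_comm[OF group, of "P k" "Q k" "E l" "E' l" x] PQc[of k] Ec[of l] that k l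
        by (simp add: t_def)
    qed
    have par: "odd i \<noteq> odd j" if "(i, j) \<in> cycle_edges ?m" for i j
      using that by (auto simp: cycle_edges_def mod_Suc split: if_splits)
    have sym: "(j, i) \<in> cycle_edges ?m" if "(i, j) \<in> cycle_edges ?m" for i j
      using that by (auto simp: cycle_edges_def)
    have tcomm: "t i \<otimes>\<^bsub>?B\<^esub> t j = t j \<otimes>\<^bsub>?B\<^esub> t i" if ij: "(i, j) \<in> cycle_edges ?m" for i j
    proof -
      have lt: "i < ?m" "j < ?m" using ij by (auto simp: cycle_edges_def)
      have "t i (t j x) = t j (t i x)" if "x \<in> ?X" for x
        using tcomm1[of i j x] tcomm1[of j i x] par[OF ij] sym[OF ij] ij lt that by auto
      then have "compose ?X (t i) (t j) = compose ?X (t j) (t i)"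
        by (simp add: compose_def fun_eq_iff)
      then show ?thesis using tB lt by (simp add: BijGroup_def)
    qed
    obtain h where h: "h \<in> hom W ?B" and ht: "\<And>i. i < ?m \<Longrightarrow> h (gen ?m i) = t i"
      using racg_universal[where t = t, OF m group_BijGroup tc tt tcomm] unfolding W_def by blast
    have hB: "h w \<in> Bij ?X" if "w \<in> carrier W" for w
      using h that by (auto simp: hom_def BijGroup_def)
    have hmul: "h (w \<otimes>\<^bsub>W\<^esub> w') x = h w (h w' x)" if "w \<in> carrier W" "w' \<in> carrier W" "x \<in> ?X" for w w' x
      using hom_mult[OF h that(1,2)] hB that by (simp add: BijGroup_def compose_def)
    have h1: "h \<one>\<^bsub>W\<^esub> x = x" if "x \<in> ?X" for x
      using hom_one[OF h W.is_group group_BijGroup] that by (simp add: BijGroup_def)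
    \<comment> \<open>The pairs (w, \<pi>) for which w maps the tile (False, False) to itself as
      left translation by \<pi>; the unit of W can only act as translation by the unit.\<close>
    define Z where "Z = {(w, \<pi>). w \<in> carrier W \<and> \<pi> \<in> carrier \<Pi>' \<and>
      (\<forall>y\<in>carrier \<Pi>'. h w (y, False, False) = (\<pi> \<otimes> y, False, False))}"
    interpret D: group "W \<times>\<times> \<Pi>'" by (rule DirProd_group[OF W.is_group group])
    have "subgroup Z (W \<times>\<times> \<Pi>')"
    proof (rule D.subgroupI)
      show "Z \<subseteq> carrier (W \<times>\<times> \<Pi>')" by (auto simp: Z_def)
      have "(\<one>\<^bsub>W\<^esub>, \<one>) \<in> Z" by (auto simp: Z_def h1)
      then show "Z \<noteq> {}" by blast
      fix x assume x: "x \<in> Z"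
      obtain w \<pi> where w: "x = (w, \<pi>)" "w \<in> carrier W" "\<pi> \<in> carrier \<Pi>'"
        "\<And>y. y \<in> carrier \<Pi>' \<Longrightarrow> h w (y, False, False) = (\<pi> \<otimes> y, False, False)"
        using x by (auto simp: Z_def)
      have "h (inv\<^bsub>W\<^esub> w) (y, False, False) = (inv \<pi> \<otimes> y, False, False)" if y: "y \<in> carrier \<Pi>'" for y
      proof -
        have eq: "h w (inv \<pi> \<otimes> y, False, False) = (y, False, False)"
          using w y by (simp add: \<Pi>'.inv_cancel_left)
        have "h (inv\<^bsub>W\<^esub> w) (h w (inv \<pi> \<otimes> y, False, False))
          = h (inv\<^bsub>W\<^esub> w \<otimes>\<^bsub>W\<^esub> w) (inv \<pi> \<otimes> y, False, False)"
          by (rule hmul[symmetric]) (use w y in simp_all)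
        then show ?thesis using w y unfolding eq by (simp add: h1)
      qed
      then show "inv\<^bsub>W \<times>\<times> \<Pi>'\<^esub> x \<in> Z" using w by (simp add: Z_def inv_DirProd W.is_group group)
      fix x' assume "x' \<in> Z"
      then show "x \<otimes>\<^bsub>W \<times>\<times> \<Pi>'\<^esub> x' \<in> Z"
        using x by (auto simp: Z_def hmul \<Pi>'.m_assoc)
    qed
    moreover have "(a k, \<alpha> k) \<in> Z \<and> (b k, \<beta> k) \<in> Z" if k: "k < g" for k
    proof -
      have c: "P k \<in> carrier \<Pi>'" "Q k \<in> carrier \<Pi>'" "\<alpha> k \<in> carrier \<Pi>'" "\<beta> k \<in> carrier \<Pi>'"
        "P (Suc k) \<in> carrier \<Pi>'" "E' (Suc k) \<in> carrier \<Pi>'"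
        using PQc[of k] PQc[of "Suc k"] Ec[of "Suc k"] \<alpha>\<beta> k by auto
      have hg: "h e = flip_z \<Pi>' \<one> \<one>" "h (p k) = flip_p \<Pi>' (P k) (Q k)"
        "h (p (Suc k)) = flip_p \<Pi>' (P (Suc k)) (Q (Suc k))"
        "h (z (Suc k)) = flip_z \<Pi>' (E (Suc k)) (E' (Suc k))"
      proof -
        have *: "h e = t 0" "h (p k) = t (2 * k + 1)" "h (p (Suc k)) = t (2 * Suc k + 1)"
          "h (z (Suc k)) = t (2 * Suc k)"
          unfolding e_def p_def z_def by (rule ht, use k in simp)+
        show "h e = flip_z \<Pi>' \<one> \<one>" "h (p k) = flip_p \<Pi>' (P k) (Q k)"
          "h (p (Suc k)) = flip_p \<Pi>' (P (Suc k)) (Q (Suc k))"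
          "h (z (Suc k)) = flip_z \<Pi>' (E (Suc k)) (E' (Suc k))"
          unfolding * by (simp_all add: t_def E_def E'_def)
      qed
      have cW: "e \<in> carrier W" "p k \<in> carrier W" "p (Suc k) \<in> carrier W" "z (Suc k) \<in> carrier W" "q k \<in> carrier W"
        using e p q z k by auto
      \<comment> \<open>\<open>q k\<close> passes through the tile with flag \<epsilon> set, so
        \<open>Q k\<close> acts instead of \<open>P k\<close>.\<close>
      have hq1: "h (q k) (y, False, False) = (Q k \<otimes> y, False, True)"
        "h (q k) (y, False, True) = (inv (Q k) \<otimes> y, False, False)" if "y \<in> carrier \<Pi>'" for y
        using that c cW
        by (simp_all add: q_def hmul hg flip_p_def[OF group] flip_z_def[OF group])
      have "h (a k) (y, False, False) = (\<alpha> k \<otimes> y, False, False)" if "y \<in> carrier \<Pi>'" for y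
        using that c cW
        by (simp add: a_def hmul hq1 hg flip_p_def[OF group] PS \<Pi>'.inv_mult_group \<Pi>'.m_assoc \<Pi>'.inv_cancel_left)
      moreover have "h (b k) (y, False, False) = (\<beta> k \<otimes> y, False, False)" if "y \<in> carrier \<Pi>'" for y
        using that c cW
        by (simp add: b_def hmul hq1 hg flip_z_def[OF group])
          (simp add: E'_def \<Pi>'.m_assoc \<Pi>'.inv_cancel_left)
      ultimately show ?thesis using ab c k by (simp add: Z_def)
    qed
    moreover have "\<pi> = \<one>" if "(\<one>\<^bsub>W\<^esub>, \<pi>) \<in> Z" for \<pi>
    proof -
      have *: "\<pi> \<in> carrier \<Pi>'" "h \<one>\<^bsub>W\<^esub> (\<one>, False, False) = (\<pi> \<otimes> \<one>, False, False)"
        using that unfolding Z_def by blast+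
      then show ?thesis by (simp add: h1)
    qed
    ultimately show ?thesis by blast
  qed
  note main = this
  show ?thesis
    by (intro exI[of _ a] exI[of _ b] conjI) (rule ab, rule prod, intro allI impI, rule main)
qed

section \<open>Local systems and transport along paths\<close>

text \<open>A flat section along the path, written in charts: locally constant in each chart, with
  transitions multiplying on the right, so that left multiplication preserves lifts. Where the path
  is outside \<open>U i\<close>, the value \<open>L s i\<close> is unconstrained.\<close>

definition lift_on :: "'i set \<Rightarrow> ('i \<Rightarrow> 's set) \<Rightarrow> ('h, 'm) monoid_scheme \<Rightarrow> ('i \<Rightarrow> 'i \<Rightarrow> 's \<Rightarrow> 'h)
    \<Rightarrow> (real \<Rightarrow> 's) \<Rightarrow> real \<Rightarrow> real \<Rightarrow> (real \<Rightarrow> 'i \<Rightarrow> 'h) \<Rightarrow> bool"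
  where "lift_on I U H t p a b L \<longleftrightarrow> (\<forall>s\<in>{a..b}. \<forall>i\<in>I. p s \<in> U i \<longrightarrow> L s i \<in> carrier H \<and>
    (\<forall>j\<in>I. p s \<in> U j \<longrightarrow> L s j = L s i \<otimes>\<^bsub>H\<^esub> t i j (p s)) \<and>
    (\<exists>e>0. \<forall>s'\<in>{a..b}. \<bar>s' - s\<bar> < e \<longrightarrow> p s' \<in> U i \<and> L s' i = L s i))"

lemma lift_onD:
  assumes "lift_on I U H t p a b L" "s \<in> {a..b}" "i \<in> I" "p s \<in> U i"
  shows "L s i \<in> carrier H"
    and "j \<in> I \<Longrightarrow> p s \<in> U j \<Longrightarrow> L s j = L s i \<otimes>\<^bsub>H\<^esub> t i j (p s)"
    and "\<exists>e>0. \<forall>s'\<in>{a..b}. \<bar>s' - s\<bar> < e \<longrightarrow> p s' \<in> U i \<and> L s' i = L s i"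
  using assms(1)[unfolded lift_on_def, rule_format, OF assms(2-4)] by simp_all

lemma openin_path_nbhd:
  fixes p :: "real \<Rightarrow> 's::topological_space"
  assumes "continuous_on {a..b} p" "p ` {a..b} \<subseteq> S" "openin (top_of_set S) O'" "s \<in> {a..b}" "p s \<in> O'"
  shows "\<exists>e>0. \<forall>s'\<in>{a..b}. \<bar>s' - s\<bar> < e \<longrightarrow> p s' \<in> O'"
proof -
  have "openin (top_of_set {a..b}) ({a..b} \<inter> p -` O')"
    using assms(1-3) by (intro continuous_openin_preimage[of _ _ S]) auto
  then show ?thesis using assms(4,5)
    by (auto simp: openin_euclidean_subtopology_iff dist_real_def)
qed

text \<open>Whether the pair of values lies in \<open>Z\<close> is independent of the chart, since
  the transitions do, and it is locally constant along the path; connectedness of the interval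
  carries it from the start to any later time. The diagonal as \<open>Z\<close> yields uniqueness of
  lifts.\<close>

lemma lift_on_compare:
  assumes L: "lift_on I U H t p a b L" and L': "lift_on I U H' t' p a b L'"
    and Z: "subgroup Z (H \<times>\<times> H')"
    and tZ: "\<And>i j y. i \<in> I \<Longrightarrow> j \<in> I \<Longrightarrow> y \<in> U i \<Longrightarrow> y \<in> U j \<Longrightarrow> (t i j y, t' i j y) \<in> Z"
    and cover: "\<And>s. s \<in> {a..b} \<Longrightarrow> \<exists>i\<in>I. p s \<in> U i"
    and i: "i \<in> I" "p a \<in> U i" "(L a i, L' a i) \<in> Z" and s: "s \<in> {a..b}" and j: "j \<in> I" "p s \<in> U j"
  shows "(L s j, L' s j) \<in> Z"
proof -
  define P where "P s \<longleftrightarrow> (\<forall>i\<in>I. p s \<in> U i \<longrightarrow> (L s i, L' s i) \<in> Z)" for s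
  have P_one: "P s" if "s \<in> {a..b}" "i \<in> I" "p s \<in> U i" "(L s i, L' s i) \<in> Z" for s i
    unfolding P_def
  proof (intro ballI impI)
    fix j assume j: "j \<in> I" "p s \<in> U j"
    have "(L s i, L' s i) \<otimes>\<^bsub>H \<times>\<times> H'\<^esub> (t i j (p s), t' i j (p s)) \<in> Z"
      by (rule subgroup.m_closed[OF Z that(4) tZ]) (use that j in auto)
    moreover have "L s j = L s i \<otimes>\<^bsub>H\<^esub> t i j (p s)" "L' s j = L' s i \<otimes>\<^bsub>H'\<^esub> t' i j (p s)"
      using lift_onD(2)[OF L that(1-3) j] lift_onD(2)[OF L' that(1-3) j] by blast+
    ultimately show "(L s j, L' s j) \<in> Z" by simp
  qed
  have "P s"
  proof (rule connected_induction_simple[of "{a..b}" a s P])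
    show "P a" by (rule P_one[of a i]) (use i s in auto)
    fix x assume x: "x \<in> {a..b}"
    then obtain k where k: "k \<in> I" "p x \<in> U k" using cover by blast
    obtain e e' where e: "e > 0" "\<forall>s'\<in>{a..b}. \<bar>s' - x\<bar> < e \<longrightarrow> p s' \<in> U k \<and> L s' k = L x k"
      "e' > 0" "\<forall>s'\<in>{a..b}. \<bar>s' - x\<bar> < e' \<longrightarrow> p s' \<in> U k \<and> L' s' k = L' x k"
      using lift_onD(3)[OF L x k] lift_onD(3)[OF L' x k] by blast
    let ?T = "{a..b} \<inter> ball x (min e e')"
    have *: "P y \<longleftrightarrow> (L x k, L' x k) \<in> Z" if "y \<in> ?T" for y
    proof -
      have "p y \<in> U k" "L y k = L x k" "L' y k = L' x k" "y \<in> {a..b}"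
        using that e by (auto simp: dist_real_def abs_minus_commute)
      then show ?thesis using P_one[of y k] k by (auto simp: P_def)
    qed
    have "openin (top_of_set {a..b}) ?T" "x \<in> ?T"
      using x e(1,3) by (auto intro: openin_open_Int)
    moreover have "\<forall>y\<in>?T. \<forall>z\<in>?T. P y \<longrightarrow> P z" using * by blast
    ultimately show "\<exists>T. openin (top_of_set {a..b}) T \<and> x \<in> T \<and> (\<forall>x\<in>T. \<forall>y\<in>T. P x \<longrightarrow> P y)"
      by blast
  qed (use s in auto)
  then show ?thesis using j by (auto simp: P_def)
qed

text \<open>The transition is a function of the point, only locally constant, because two charts may
  overlap in several components: in the surface, the open cell meets the star of the vertex in 4g
  sectors.\<close>

locale local_system =
  fixes S :: "'s::metric_space set" and I :: "'i set" and U :: "'i \<Rightarrow> 's set"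
    and H :: "('h, 'm) monoid_scheme" and t :: "'i \<Rightarrow> 'i \<Rightarrow> 's \<Rightarrow> 'h"
  assumes group_H: "group H"
    and open_U: "\<And>i. i \<in> I \<Longrightarrow> openin (top_of_set S) (U i)"
    and cover: "S \<subseteq> (\<Union>i\<in>I. U i)"
    and t_carrier: "\<And>i j y. i \<in> I \<Longrightarrow> j \<in> I \<Longrightarrow> y \<in> U i \<Longrightarrow> y \<in> U j \<Longrightarrow> t i j y \<in> carrier H"
    and t_refl: "\<And>i y. i \<in> I \<Longrightarrow> y \<in> U i \<Longrightarrow> t i i y = \<one>\<^bsub>H\<^esub>"
    and t_cocycle: "\<And>i j k y. i \<in> I \<Longrightarrow> j \<in> I \<Longrightarrow> k \<in> I \<Longrightarrow> y \<in> U i \<Longrightarrow> y \<in> U j \<Longrightarrow> y \<in> U k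
      \<Longrightarrow> t i k y = t i j y \<otimes>\<^bsub>H\<^esub> t j k y"
    and t_local: "\<And>i j y. i \<in> I \<Longrightarrow> j \<in> I \<Longrightarrow> y \<in> U i \<Longrightarrow> y \<in> U j
      \<Longrightarrow> \<exists>O'. openin (top_of_set S) O' \<and> y \<in> O' \<and> O' \<subseteq> U i \<inter> U j \<and> (\<forall>y'\<in>O'. t i j y' = t i j y)"
begin

sublocale H: group H by (rule group_H)

abbreviation "lift \<equiv> lift_on I U H t"

lemma diag_subgroup: "subgroup {(x, x) |x. x \<in> carrier H} (H \<times>\<times> H)"
  by (rule group.subgroupI) (auto simp: DirProd_group group_H inv_DirProd intro: exI[of _ "\<one>\<^bsub>H\<^esub>"])

lemma lift_unique:
  assumes p: "p ` {a..b} \<subseteq> S" and L: "lift p a b L" and L': "lift p a b L'"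
    and i: "i \<in> I" "p a \<in> U i" "L a i = L' a i" and s: "s \<in> {a..b}" and j: "j \<in> I" "p s \<in> U j"
  shows "L s j = L' s j"
proof -
  have "a \<in> {a..b}" using s by auto
  then have "L a i \<in> carrier H" using lift_onD(1)[OF L _ i(1,2)] by blast
  then have "(L s j, L' s j) \<in> {(x, x) |x. x \<in> carrier H}"
    by (intro lift_on_compare[OF L L' diag_subgroup _ _ i(1,2) _ s j])
      (use p cover t_carrier i in \<open>auto simp: subset_iff image_subset_iff\<close>)
  then show ?thesis by auto
qed

lemmas lift_carrier = lift_onD(1)[of I U H t]
  and lift_change = lift_onD(2)[of I U H t]
  and lift_nbhd = lift_onD(3)[of I U H t]

lemma lift_subset:
  assumes L: "lift p a b L" and cd: "a \<le> c" "d \<le> b"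
  shows "lift p c d L"
  unfolding lift_on_def
proof (intro ballI impI, goal_cases)
  case (1 s i)
  have s: "s \<in> {a..b}" using 1 cd by simp
  obtain e where "e > 0" "\<forall>s'\<in>{a..b}. \<bar>s' - s\<bar> < e \<longrightarrow> p s' \<in> U i \<and> L s' i = L s i"
    using lift_nbhd[OF L s 1(2,3)] by blast
  then have "\<exists>e>0. \<forall>s'\<in>{c..d}. \<bar>s' - s\<bar> < e \<longrightarrow> p s' \<in> U i \<and> L s' i = L s i"
    using cd by (intro exI[of _ e]) auto
  then show ?case using lift_carrier[OF L s 1(2,3)] lift_change[OF L s 1(2,3)] by auto
qed

lemma lift_glue:
  assumes L: "lift p a b L" and L': "lift p b c L'" and k: "k \<in> I" "p b \<in> U k" "L b k = L' b k"
    and ab: "a \<le> b" "b \<le> c"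
  shows "lift p a c (\<lambda>s. if s \<le> b then L s else L' s)"
proof -
  have eq: "L b i = L' b i" if "i \<in> I" "p b \<in> U i" for i
    using lift_change[OF L _ k(1,2) that] lift_change[OF L' _ k(1,2) that] k(3) ab by auto
  show ?thesis unfolding lift_on_def
  proof (intro ballI impI, goal_cases)
    case (1 s i)
    note s = 1(1) and i = 1(2) and ps = 1(3)
    let ?M = "\<lambda>s. if s \<le> b then L s else L' s"
    consider "s < b" | "s = b" | "s > b" by linarith
    then show ?case
    proof cases
      case 1
      then have sa: "s \<in> {a..b}" using s by auto
      obtain e where e: "e > 0" "\<forall>s'\<in>{a..b}. \<bar>s' - s\<bar> < e \<longrightarrow> p s' \<in> U i \<and> L s' i = L s i"
        using lift_nbhd[OF L sa i ps] by blast
      have "\<exists>e>0. \<forall>s'\<in>{a..c}. \<bar>s' - s\<bar> < e \<longrightarrow> p s' \<in> U i \<and> ?M s' i = ?M s i"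
      proof (intro exI[of _ "min e (b - s)"] conjI ballI impI)
        fix s' assume "s' \<in> {a..c}" "\<bar>s' - s\<bar> < min e (b - s)"
        then have s': "s' \<in> {a..b}" "\<bar>s' - s\<bar> < e" by auto
        show "p s' \<in> U i" "?M s' i = ?M s i"
          using e(2)[rule_format, OF s'] s' 1 by simp_all
      qed (use e 1 in simp)
      then show ?thesis using 1 lift_carrier[OF L sa i ps] lift_change[OF L sa i ps] by auto
    next
      case 2
      have sa: "b \<in> {a..b}" "b \<in> {b..c}" using ab by auto
      have ps': "p b \<in> U i" using ps 2 by simp
      obtain e where e: "e > 0" "\<forall>s'\<in>{a..b}. \<bar>s' - b\<bar> < e \<longrightarrow> p s' \<in> U i \<and> L s' i = L b i"
        using lift_nbhd[OF L sa(1) i ps'] by blast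
      obtain e' where e': "e' > 0" "\<forall>s'\<in>{b..c}. \<bar>s' - b\<bar> < e' \<longrightarrow> p s' \<in> U i \<and> L' s' i = L' b i"
        using lift_nbhd[OF L' sa(2) i ps'] by blast
      have "\<exists>e>0. \<forall>s'\<in>{a..c}. \<bar>s' - b\<bar> < e \<longrightarrow> p s' \<in> U i \<and> ?M s' i = ?M b i"
      proof (intro exI[of _ "min e e'"] conjI ballI impI)
        fix s' assume s': "s' \<in> {a..c}" "\<bar>s' - b\<bar> < min e e'"
        have "p s' \<in> U i \<and> ?M s' i = ?M b i"
        proof (cases "s' \<le> b")
          case True
          then show ?thesis using e(2)[rule_format, of s'] s' by simp
        next
          case False
          then show ?thesis using e'(2)[rule_format, of s'] s' eq[OF i ps'] by simp
        qed
        then show "p s' \<in> U i" "?M s' i = ?M b i" by blast+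
      qed (use e e' in simp)
      then show ?thesis using 2 lift_carrier[OF L sa(1) i ps'] lift_change[OF L sa(1) i ps'] by auto
    next
      case 3
      then have sa: "s \<in> {b..c}" using s by auto
      obtain e where e: "e > 0" "\<forall>s'\<in>{b..c}. \<bar>s' - s\<bar> < e \<longrightarrow> p s' \<in> U i \<and> L' s' i = L' s i"
        using lift_nbhd[OF L' sa i ps] by blast
      have "\<exists>e>0. \<forall>s'\<in>{a..c}. \<bar>s' - s\<bar> < e \<longrightarrow> p s' \<in> U i \<and> ?M s' i = ?M s i"
      proof (intro exI[of _ "min e (s - b)"] conjI ballI impI)
        fix s' assume "s' \<in> {a..c}" "\<bar>s' - s\<bar> < min e (s - b)"
        then have s': "s' \<in> {b..c}" "\<bar>s' - s\<bar> < e" "\<not> s' \<le> b" by auto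
        show "p s' \<in> U i" "?M s' i = ?M s i"
          using e(2)[rule_format, OF s'(1,2)] s' 3 by simp_all
      qed (use e 3 in simp)
      then show ?thesis using 3 lift_carrier[OF L' sa i ps] lift_change[OF L' sa i ps] by auto
    qed
  qed
qed

text \<open>On a stretch inside one chart \<open>k\<close>, the section is the constant
  \<open>l\<close> in that chart, read off in all the others.\<close>

lemma lift_const:
  assumes p: "continuous_on {a..b} p" "p ` {a..b} \<subseteq> S" and k: "k \<in> I" "p ` {a..b} \<subseteq> U k"
    and l: "l \<in> carrier H"
  shows "lift p a b (\<lambda>s i. l \<otimes>\<^bsub>H\<^esub> t k i (p s))"
  unfolding lift_on_def
proof (intro ballI impI, goal_cases)
  case (1 s i)
  have pk: "p s \<in> U k" using 1 k by blast
  obtain O' where O': "openin (top_of_set S) O'" "p s \<in> O'" "O' \<subseteq> U k \<inter> U i" "\<forall>y'\<in>O'. t k i y' = t k i (p s)"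
    using t_local[OF k(1) 1(2) pk 1(3)] by blast
  obtain e where e: "e > 0" "\<forall>s'\<in>{a..b}. \<bar>s' - s\<bar> < e \<longrightarrow> p s' \<in> O'"
    using openin_path_nbhd[OF p O'(1) 1(1) O'(2)] by blast
  have "\<exists>e>0. \<forall>s'\<in>{a..b}. \<bar>s' - s\<bar> < e \<longrightarrow> p s' \<in> U i \<and> l \<otimes>\<^bsub>H\<^esub> t k i (p s') = l \<otimes>\<^bsub>H\<^esub> t k i (p s)"
  proof (intro exI[of _ e] conjI ballI impI e(1))
    fix s' assume "s' \<in> {a..b}" "\<bar>s' - s\<bar> < e"
    then have s': "p s' \<in> O'" using e by blast
    show "p s' \<in> U i" using s' O'(3) by blast
    show "l \<otimes>\<^bsub>H\<^esub> t k i (p s') = l \<otimes>\<^bsub>H\<^esub> t k i (p s)" using O'(4)[rule_format, OF s'] by simp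
  qed
  moreover have "l \<otimes>\<^bsub>H\<^esub> t k j (p s) = l \<otimes>\<^bsub>H\<^esub> t k i (p s) \<otimes>\<^bsub>H\<^esub> t i j (p s)" if "j \<in> I" "p s \<in> U j" for j
    using t_cocycle[OF k(1) 1(2) that(1) pk 1(3) that(2)] that 1 k(1) pk l by (simp add: H.m_assoc t_carrier)
  ultimately show ?case using t_carrier[OF k(1) 1(2) pk 1(3)] l by auto
qed

definition transport :: "(real \<Rightarrow> 's) \<Rightarrow> real \<Rightarrow> real \<Rightarrow> 'i \<Rightarrow> 'h \<Rightarrow> 'i \<Rightarrow> 'h \<Rightarrow> bool"
  where "transport p a b i l j m \<longleftrightarrow> (\<exists>L. lift p a b L \<and> L a i = l \<and> L b j = m)"

lemma transport_const:
  assumes p: "continuous_on {a..b} p" "p ` {a..b} \<subseteq> S" and k: "k \<in> I" "p ` {a..b} \<subseteq> U k" and ab: "a \<le> b"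
    and i: "i \<in> I" "p a \<in> U i" and j: "j \<in> I" "p b \<in> U j" and l: "l \<in> carrier H"
  shows "transport p a b i l j (l \<otimes>\<^bsub>H\<^esub> t i k (p a) \<otimes>\<^bsub>H\<^esub> t k j (p b))"
proof -
  have ak: "p a \<in> U k" using k ab by auto
  have c: "t i k (p a) \<in> carrier H" "t k i (p a) \<in> carrier H" using i k ak by (auto intro!: t_carrier)
  have "l \<otimes>\<^bsub>H\<^esub> t i k (p a) \<otimes>\<^bsub>H\<^esub> t k i (p a) = l"
    using t_cocycle[OF i(1) k(1) i(1) i(2) ak i(2)] t_refl[OF i] c l by (simp add: H.m_assoc)
  then show ?thesis unfolding transport_def
    using lift_const[OF p k, of "l \<otimes>\<^bsub>H\<^esub> t i k (p a)"] c l by (intro exI[of _ "\<lambda>s n. _ \<otimes>\<^bsub>H\<^esub> t k n (p s)"]) auto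
qed

lemma transport_unique:
  "p ` {a..b} \<subseteq> S \<Longrightarrow> a \<le> b \<Longrightarrow> i \<in> I \<Longrightarrow> p a \<in> U i \<Longrightarrow> j \<in> I \<Longrightarrow> p b \<in> U j \<Longrightarrow>
    transport p a b i l j m \<Longrightarrow> transport p a b i l j m' \<Longrightarrow> m = m'"
  unfolding transport_def using lift_unique[of p a b _ _ i b j] by auto

lemma transport_trans:
  assumes "transport p a b i l k m" "transport p b c k m j n" "a \<le> b" "b \<le> c" "k \<in> I" "p b \<in> U k"
    and j: "j \<in> I" "p c \<in> U j"
  shows "transport p a c i l j n"
proof -
  obtain L L' where L: "lift p a b L" "L a i = l" "L b k = m" "lift p b c L'" "L' b k = m" "L' c j = n"
    using assms(1,2) by (auto simp: transport_def)
  have "lift p a c (\<lambda>s. if s \<le> b then L s else L' s)"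
    by (rule lift_glue[of p a b L c L' k]) (use L assms in auto)
  moreover have "(if c \<le> b then L c else L' c) j = n"
  proof (cases "c \<le> b")
    case True
    then have "c = b" using assms by simp
    then show ?thesis using L assms(3,4) lift_change[OF L(1) _ assms(5,6) j(1)] lift_change[OF L(4) _ assms(5,6) j(1)] j
      by auto
  qed (use L in auto)
  ultimately show ?thesis using L assms(3) unfolding transport_def
    by (intro exI[of _ "\<lambda>s. if s \<le> b then L s else L' s"]) auto
qed

text \<open>Bisection: a sufficiently short stretch stays inside one chart, where the constant
  section works, and transports over adjacent stretches compose.\<close>

lemma ex_transport:
  assumes p: "continuous_on {a..b} p" "p ` {a..b} \<subseteq> S" and ab: "a \<le> b"
    and i: "i \<in> I" "p a \<in> U i" and j: "j \<in> I" "p b \<in> U j" and l: "l \<in> carrier H"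
  shows "\<exists>m\<in>carrier H. transport p a b i l j m"
proof -
  \<comment> \<open>Quantifying over both charts and the initial value lets the second stretch start
    from whatever the first one delivers.\<close>
  define Q where "Q a' b' \<longleftrightarrow> (a \<le> a' \<longrightarrow> a' \<le> b' \<longrightarrow> b' \<le> b \<longrightarrow> (\<forall>i\<in>I. \<forall>j\<in>I. \<forall>l\<in>carrier H. p a' \<in> U i \<longrightarrow> p b' \<in> U j
    \<longrightarrow> (\<exists>m\<in>carrier H. transport p a' b' i l j m)))" for a' b'
  have "Q a b"
  proof (rule Bolzano[OF ab])
    fix a' b' c' assume *: "Q a' b'" "Q b' c'" "a' \<le> b'" "b' \<le> c'"
    show "Q a' c'" unfolding Q_def
    proof (intro impI ballI)
      fix i j l assume h: "a \<le> a'" "a' \<le> c'" "c' \<le> b" "i \<in> I" "j \<in> I" "l \<in> carrier H" "p a' \<in> U i" "p c' \<in> U j"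
      have "p b' \<in> S" using p h * by (auto simp: image_subset_iff)
      then obtain k where k: "k \<in> I" "p b' \<in> U k" using cover by blast
      obtain m where m: "m \<in> carrier H" "transport p a' b' i l k m"
        using *(1,3,4) h k unfolding Q_def by (meson order_trans)
      obtain n where n: "n \<in> carrier H" "transport p b' c' k m j n"
        using *(2,3,4) h k m unfolding Q_def by (meson order_trans)
      then show "\<exists>m\<in>carrier H. transport p a' c' i l j m"
        using transport_trans[OF m(2) n(2) *(3,4) k] h by blast
    qed
  next
    fix x assume x: "a \<le> x" "x \<le> b"
    then have "p x \<in> S" using p by auto
    then obtain k where k: "k \<in> I" "p x \<in> U k" using cover by blast
    obtain d where d: "d > 0" "\<forall>s'\<in>{a..b}. \<bar>s' - x\<bar> < d \<longrightarrow> p s' \<in> U k"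
      using openin_path_nbhd[OF p open_U[OF k(1)] _ k(2)] x by auto
    show "\<exists>d>0. \<forall>a' b'. a' \<le> x \<and> x \<le> b' \<and> b' - a' < d \<longrightarrow> Q a' b'"
    proof (intro exI[of _ d] conjI allI impI d(1))
      fix a' b' assume ab': "a' \<le> x \<and> x \<le> b' \<and> b' - a' < d"
      show "Q a' b'" unfolding Q_def
      proof (intro impI ballI)
        fix i j l assume h: "a \<le> a'" "a' \<le> b'" "b' \<le> b" "i \<in> I" "j \<in> I" "l \<in> carrier H" "p a' \<in> U i" "p b' \<in> U j"
        have sub: "{a'..b'} \<subseteq> {a..b}" using h by auto
        have pk: "p ` {a'..b'} \<subseteq> U k" using d h ab' by auto
        have "transport p a' b' i l j (l \<otimes>\<^bsub>H\<^esub> t i k (p a') \<otimes>\<^bsub>H\<^esub> t k j (p b'))"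
          by (rule transport_const) (use p sub pk h k continuous_on_subset in blast)+
        moreover have "p a' \<in> U k" "p b' \<in> U k" using pk h by auto
        then have "l \<otimes>\<^bsub>H\<^esub> t i k (p a') \<otimes>\<^bsub>H\<^esub> t k j (p b') \<in> carrier H" using h k by (simp add: t_carrier)
        ultimately show "\<exists>m\<in>carrier H. transport p a' b' i l j m" by blast
      qed
    qed
  qed
  then show ?thesis using assms by (auto simp: Q_def)
qed

text \<open>Bisection in the path parameter with \<tau> fixed. Over a short stretch all nearby paths
  stay in one chart \<open>k\<close>, so transport is given by two transitions at the ends, and
  these are constant for \<sigma> close to \<tau>.\<close>

lemma transport_homotopy_local:
  assumes K: "continuous_on ({0..1} \<times> {0..1}) K" "K ` ({0..1} \<times> {0..1}) \<subseteq> S" and \<tau>: "\<tau> \<in> {0..1::real}"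
    and i: "i \<in> I" "K (\<tau>, 0::real) \<in> U i" and j: "j \<in> I" "K (\<tau>, 1) \<in> U j"
  shows "\<exists>e>0. \<forall>\<sigma>\<in>{0..1}. \<bar>\<sigma> - \<tau>\<bar> < e \<longrightarrow> K (\<sigma>, 0) \<in> U i \<and> K (\<sigma>, 1) \<in> U j \<and>
    (\<forall>l\<in>carrier H. \<forall>m. transport (\<lambda>s. K (\<tau>, s)) 0 1 i l j m \<longrightarrow> transport (\<lambda>s. K (\<sigma>, s)) 0 1 i l j m)"
proof -
  define Q where "Q a b \<longleftrightarrow> (0 \<le> a \<longrightarrow> a \<le> b \<longrightarrow> b \<le> 1 \<longrightarrow> (\<forall>i\<in>I. \<forall>j\<in>I. K (\<tau>, a) \<in> U i \<longrightarrow> K (\<tau>, b) \<in> U j \<longrightarrow>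
    (\<exists>e>0. \<forall>\<sigma>\<in>{0..1}. \<bar>\<sigma> - \<tau>\<bar> < e \<longrightarrow> K (\<sigma>, a) \<in> U i \<and> K (\<sigma>, b) \<in> U j \<and>
    (\<forall>l\<in>carrier H. \<forall>m. transport (\<lambda>s. K (\<tau>, s)) a b i l j m \<longrightarrow> transport (\<lambda>s. K (\<sigma>, s)) a b i l j m))))" for a b
  have cont: "continuous_on {a..b} (\<lambda>s. K (\<sigma>, s))" "(\<lambda>s. K (\<sigma>, s)) ` {a..b} \<subseteq> S"
    if "\<sigma> \<in> {0..1}" "0 \<le> a" "b \<le> 1" for \<sigma> a b
    using that K by (auto intro!: continuous_intros continuous_on_compose2[OF K(1)])
  have cont\<tau>: "continuous_on {0..1} (\<lambda>\<sigma>. K (\<sigma>, s))" "(\<lambda>\<sigma>. K (\<sigma>, s)) ` {0..1} \<subseteq> S" if "s \<in> {0..1}" for s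
    using that K by (auto intro!: continuous_intros continuous_on_compose2[OF K(1)])
  have "Q 0 1"
  proof (rule Bolzano)
    fix a b c assume *: "Q a b" "Q b c" "a \<le> b" "b \<le> c"
    show "Q a c" unfolding Q_def
    proof (intro impI ballI)
      fix i j assume h: "0 \<le> a" "a \<le> c" "c \<le> 1" "i \<in> I" "j \<in> I" "K (\<tau>, a) \<in> U i" "K (\<tau>, c) \<in> U j"
      have b: "0 \<le> b" "b \<le> 1" using h * by auto
      then have "K (\<tau>, b) \<in> S" using K \<tau> by auto
      then obtain k where k: "k \<in> I" "K (\<tau>, b) \<in> U k" using cover by blast
      obtain e where e: "e > 0" "\<forall>\<sigma>\<in>{0..1}. \<bar>\<sigma> - \<tau>\<bar> < e \<longrightarrow> K (\<sigma>, a) \<in> U i \<and> K (\<sigma>, b) \<in> U k \<and>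
        (\<forall>l\<in>carrier H. \<forall>m. transport (\<lambda>s. K (\<tau>, s)) a b i l k m \<longrightarrow> transport (\<lambda>s. K (\<sigma>, s)) a b i l k m)"
        using *(1)[unfolded Q_def, rule_format, OF h(1) *(3) b(2) h(4) k(1) h(6) k(2)] by blast
      obtain e' where e': "e' > 0" "\<forall>\<sigma>\<in>{0..1}. \<bar>\<sigma> - \<tau>\<bar> < e' \<longrightarrow> K (\<sigma>, b) \<in> U k \<and> K (\<sigma>, c) \<in> U j \<and>
        (\<forall>l\<in>carrier H. \<forall>m. transport (\<lambda>s. K (\<tau>, s)) b c k l j m \<longrightarrow> transport (\<lambda>s. K (\<sigma>, s)) b c k l j m)"
        using *(2)[unfolded Q_def, rule_format, OF b(1) *(4) h(3) k(1) h(5) k(2) h(7)] by blast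
      show "\<exists>e>0. \<forall>\<sigma>\<in>{0..1}. \<bar>\<sigma> - \<tau>\<bar> < e \<longrightarrow> K (\<sigma>, a) \<in> U i \<and> K (\<sigma>, c) \<in> U j \<and>
        (\<forall>l\<in>carrier H. \<forall>m. transport (\<lambda>s. K (\<tau>, s)) a c i l j m \<longrightarrow> transport (\<lambda>s. K (\<sigma>, s)) a c i l j m)"
      proof (intro exI[of _ "min e e'"] conjI ballI impI allI)
        fix \<sigma> assume \<sigma>: "\<sigma> \<in> {0..1}" "\<bar>\<sigma> - \<tau>\<bar> < min e e'"
        show "K (\<sigma>, a) \<in> U i" "K (\<sigma>, c) \<in> U j" using e e' \<sigma> by auto
        fix l m assume l: "l \<in> carrier H" and tr: "transport (\<lambda>s. K (\<tau>, s)) a c i l j m"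
        obtain L where L: "lift (\<lambda>s. K (\<tau>, s)) a c L" "L a i = l" "L c j = m"
          using tr by (auto simp: transport_def)
        have "L b k \<in> carrier H" by (rule lift_carrier[OF L(1)]) (use * k in auto)
        moreover have "transport (\<lambda>s. K (\<tau>, s)) a b i l k (L b k)" "transport (\<lambda>s. K (\<tau>, s)) b c k (L b k) j m"
          unfolding transport_def using L lift_subset[OF L(1)] *(3,4) by blast+
        ultimately have "transport (\<lambda>s. K (\<sigma>, s)) a b i l k (L b k)" "transport (\<lambda>s. K (\<sigma>, s)) b c k (L b k) j m"
          using e(2) e'(2) \<sigma> l by auto
        moreover have "K (\<sigma>, b) \<in> U k" "K (\<sigma>, c) \<in> U j" using e e' \<sigma> by auto
        ultimately show "transport (\<lambda>s. K (\<sigma>, s)) a c i l j m"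
          using transport_trans[of "\<lambda>s. K (\<sigma>, s)" a b i l k "L b k" c j m] *(3,4) k(1) h(5) by blast
      qed (use e e' in auto)
    qed
  next
    fix x :: real assume x: "0 \<le> x" "x \<le> 1"
    then have "K (\<tau>, x) \<in> S" using K \<tau> by auto
    then obtain k where k: "k \<in> I" "K (\<tau>, x) \<in> U k" using cover by blast
    have "openin (top_of_set ({0..1} \<times> {0..1})) (({0..1} \<times> {0..1}) \<inter> K -` U k)"
      using K open_U[OF k(1)] by (intro continuous_openin_preimage[of _ _ S]) auto
    then obtain d where d: "d > 0" "\<forall>z\<in>{0..1} \<times> {0..1}. dist z (\<tau>, x) < d \<longrightarrow> K z \<in> U k"
      using k(2) x \<tau> by (force simp: openin_euclidean_subtopology_iff)
    have dk: "K (\<sigma>, s) \<in> U k" if "\<sigma> \<in> {0..1}" "s \<in> {0..1}" "\<bar>\<sigma> - \<tau>\<bar> < d / 2" "\<bar>s - x\<bar> < d / 2" for \<sigma> s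
    proof -
      have "dist (\<sigma>, s) (\<tau>, x) \<le> \<bar>\<sigma> - \<tau>\<bar> + \<bar>s - x\<bar>"
        by (simp add: dist_prod_def dist_real_def sqrt_sum_squares_le_sum_abs)
      then show ?thesis using d that by auto
    qed
    show "\<exists>d>0. \<forall>a b. a \<le> x \<and> x \<le> b \<and> b - a < d \<longrightarrow> Q a b"
    proof (intro exI[of _ "d / 2"] conjI allI impI)
      fix a b assume ab: "a \<le> x \<and> x \<le> b \<and> b - a < d / 2"
      show "Q a b" unfolding Q_def
      proof (intro impI ballI)
        fix i j assume h: "0 \<le> a" "a \<le> b" "b \<le> 1" "i \<in> I" "j \<in> I" "K (\<tau>, a) \<in> U i" "K (\<tau>, b) \<in> U j"
        have ab01: "a \<in> {0..1}" "b \<in> {0..1}" using h by auto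
        have img: "(\<lambda>s. K (\<sigma>, s)) ` {a..b} \<subseteq> U k" if "\<sigma> \<in> {0..1}" "\<bar>\<sigma> - \<tau>\<bar> < d / 2" for \<sigma>
        proof (rule image_subsetI)
          fix s assume s: "s \<in> {a..b}"
          have "s - x < d / 2" "x - s < d / 2" using s ab unfolding atLeastAtMost_iff by linarith+
          then have "\<bar>s - x\<bar> < d / 2" by linarith
          moreover have "s \<in> {0..1}" using s h by auto
          ultimately
          show "K (\<sigma>, s) \<in> U k" using dk[OF that(1) _ that(2)] by blast
        qed
        have ka: "K (\<tau>, a) \<in> U k" "K (\<tau>, b) \<in> U k" using img[OF \<tau>] d h by auto
        obtain O1 where O1: "openin (top_of_set S) O1" "K (\<tau>, a) \<in> O1" "O1 \<subseteq> U i \<inter> U k"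
          "\<forall>y'\<in>O1. t i k y' = t i k (K (\<tau>, a))" using t_local[OF h(4) k(1) h(6) ka(1)] by blast
        obtain O2 where O2: "openin (top_of_set S) O2" "K (\<tau>, b) \<in> O2" "O2 \<subseteq> U k \<inter> U j"
          "\<forall>y'\<in>O2. t k j y' = t k j (K (\<tau>, b))" using t_local[OF k(1) h(5) ka(2) h(7)] by blast
        obtain e1 where e1: "e1 > 0" "\<forall>\<sigma>\<in>{0..1}. \<bar>\<sigma> - \<tau>\<bar> < e1 \<longrightarrow> K (\<sigma>, a) \<in> O1"
          using openin_path_nbhd[OF cont\<tau>[OF ab01(1)] O1(1) \<tau> O1(2)] by blast
        obtain e2 where e2: "e2 > 0" "\<forall>\<sigma>\<in>{0..1}. \<bar>\<sigma> - \<tau>\<bar> < e2 \<longrightarrow> K (\<sigma>, b) \<in> O2"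
          using openin_path_nbhd[OF cont\<tau>[OF ab01(2)] O2(1) \<tau> O2(2)] by blast
        show "\<exists>e>0. \<forall>\<sigma>\<in>{0..1}. \<bar>\<sigma> - \<tau>\<bar> < e \<longrightarrow> K (\<sigma>, a) \<in> U i \<and> K (\<sigma>, b) \<in> U j \<and>
          (\<forall>l\<in>carrier H. \<forall>m. transport (\<lambda>s. K (\<tau>, s)) a b i l j m \<longrightarrow> transport (\<lambda>s. K (\<sigma>, s)) a b i l j m)"
        proof (intro exI[of _ "min (d / 2) (min e1 e2)"] conjI ballI impI allI)
          fix \<sigma> assume \<sigma>: "\<sigma> \<in> {0..1}" "\<bar>\<sigma> - \<tau>\<bar> < min (d / 2) (min e1 e2)"
          have in_O: "K (\<sigma>, a) \<in> O1" "K (\<sigma>, b) \<in> O2" using e1 e2 \<sigma> by auto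
          then show ij: "K (\<sigma>, a) \<in> U i" "K (\<sigma>, b) \<in> U j" using O1 O2 by auto
          fix l m assume l: "l \<in> carrier H" and tr: "transport (\<lambda>s. K (\<tau>, s)) a b i l j m"
          have "transport (\<lambda>s. K (\<tau>, s)) a b i l j (l \<otimes>\<^bsub>H\<^esub> t i k (K (\<tau>, a)) \<otimes>\<^bsub>H\<^esub> t k j (K (\<tau>, b)))"
            using transport_const[OF cont[OF \<tau> h(1,3)] k(1) img[OF \<tau>] h(2)] h l d by simp
          then have "m = l \<otimes>\<^bsub>H\<^esub> t i k (K (\<tau>, a)) \<otimes>\<^bsub>H\<^esub> t k j (K (\<tau>, b))"
            using transport_unique[OF cont(2)[OF \<tau> h(1,3)] h(2,4) _ h(5) _ tr] h(6,7) by blast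
          also have "\<dots> = l \<otimes>\<^bsub>H\<^esub> t i k (K (\<sigma>, a)) \<otimes>\<^bsub>H\<^esub> t k j (K (\<sigma>, b))"             by (simp add: O1(4)[rule_format, OF in_O(1)] O2(4)[rule_format, OF in_O(2)])
          finally show "transport (\<lambda>s. K (\<sigma>, s)) a b i l j m"
            using transport_const[OF cont[OF \<sigma>(1) h(1,3)] k(1) img[OF \<sigma>(1)] h(2)] h ij l \<sigma>(2) by simp
        qed (use d e1 e2 in auto)
      qed
    qed (use d in auto)
  qed simp
  then show ?thesis using i j by (simp add: Q_def)
qed

text \<open>By the local statement the transported value is locally constant in the homotopy
  parameter, and the parameter interval is connected. The homotopy fixes end points, so one chart
  serves at each end throughout.\<close>

lemma transport_homotopic:
  assumes hom: "homotopic_paths S p q" and i: "i \<in> I" "pathstart p \<in> U i" and j: "j \<in> I" "pathfinish p \<in> U j"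
    and l: "l \<in> carrier H" and tr: "transport p 0 1 i l j m"
  shows "transport q 0 1 i l j m"
proof -
  obtain K :: "real \<times> real \<Rightarrow> 's" where K: "continuous_on ({0..1} \<times> {0..1}) K" "K ` ({0..1} \<times> {0..1}) \<subseteq> S"
    "\<And>s. s \<in> {0..1} \<Longrightarrow> K (0, s) = p s" "\<And>s. s \<in> {0..1} \<Longrightarrow> K (1, s) = q s"
    "\<And>\<tau>. \<tau> \<in> {0..1} \<Longrightarrow> K (\<tau>, 0) = pathstart p \<and> K (\<tau>, 1) = pathfinish p"
  proof -
    obtain K :: "real \<times> real \<Rightarrow> 's" where K: "continuous_on ({0..1} \<times> {0..1}) K" "K \<in> {0..1} \<times> {0..1} \<rightarrow> S"
      "\<forall>x\<in>{0..1}. K (0, x) = p x" "\<forall>x\<in>{0..1}. K (1, x) = q x"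
      "\<forall>t\<in>{0..1::real}. pathstart (K \<circ> Pair t) = pathstart p \<and> pathfinish (K \<circ> Pair t) = pathfinish p"
      using hom unfolding homotopic_paths by blast
    show thesis
      by (rule that[OF K(1)]) (use K(2-5) in \<open>auto simp: pathstart_def pathfinish_def\<close>)
  qed
  have cong: "transport p' 0 1 i l j m \<longleftrightarrow> transport q' 0 1 i l j m"
    if "\<And>s. s \<in> {0..1} \<Longrightarrow> p' s = q' s" for p' q' :: "real \<Rightarrow> 's"
    unfolding transport_def lift_on_def using that by simp
  define P where "P \<tau> \<longleftrightarrow> transport (\<lambda>s. K (\<tau>, s)) 0 1 i l j m" for \<tau>
  have "P 1"
  proof (rule connected_induction_simple[of "{0..1}" 0 1 P])
    have "transport (\<lambda>s. K (0, s)) 0 1 i l j m \<longleftrightarrow> transport p 0 1 i l j m" by (rule cong) (use K in auto)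
    then show "P 0" using tr by (simp add: P_def)
    fix \<tau> :: real assume \<tau>: "\<tau> \<in> {0..1}"
    have ends: "K (\<sigma>, 0) \<in> U i" "K (\<sigma>, 1) \<in> U j" if "\<sigma> \<in> {0..1}" for \<sigma> using K(5)[OF that] i j by auto
    obtain e where e: "e > 0" "\<forall>\<sigma>\<in>{0..1}. \<bar>\<sigma> - \<tau>\<bar> < e \<longrightarrow>
      (\<forall>l\<in>carrier H. \<forall>m. transport (\<lambda>s. K (\<tau>, s)) 0 1 i l j m \<longrightarrow> transport (\<lambda>s. K (\<sigma>, s)) 0 1 i l j m)"
      using transport_homotopy_local[OF K(1,2) \<tau> i(1) ends(1)[OF \<tau>] j(1) ends(2)[OF \<tau>]] by blast
    have cont: "continuous_on {0..1} (\<lambda>s. K (\<sigma>, s))" "(\<lambda>s. K (\<sigma>, s)) ` {0..1} \<subseteq> S" if "\<sigma> \<in> {0..1}" for \<sigma>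
      using that K by (auto intro!: continuous_intros continuous_on_compose2[OF K(1)])
    obtain n where n: "transport (\<lambda>s. K (\<tau>, s)) 0 1 i l j n"
      using ex_transport[OF cont[OF \<tau>], of i j l] ends[OF \<tau>] i j l by auto
    let ?T = "{0..1} \<inter> ball \<tau> e"
    have "P \<sigma> \<longleftrightarrow> m = n" if "\<sigma> \<in> ?T" for \<sigma>
    proof -
      have \<sigma>: "\<sigma> \<in> {0..1}" "\<bar>\<sigma> - \<tau>\<bar> < e" using that by (auto simp: dist_real_def)
      then have "transport (\<lambda>s. K (\<sigma>, s)) 0 1 i l j n" using e n l by blast
      then show ?thesis unfolding P_def
        using transport_unique[OF cont(2)[OF \<sigma>(1)], of i j l] i j ends[OF \<sigma>(1)] by auto
    qed
    then have "\<forall>y\<in>?T. \<forall>z\<in>?T. P y \<longrightarrow> P z" by blast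
    moreover have "openin (top_of_set {0..1}) ?T" "\<tau> \<in> ?T"
      using \<tau> e(1) by (auto intro: openin_open_Int)
    ultimately show "\<exists>T. openin (top_of_set {0..1}) T \<and> \<tau> \<in> T \<and> (\<forall>x\<in>T. \<forall>y\<in>T. P x \<longrightarrow> P y)"
      by blast
  qed auto
  moreover have "transport (\<lambda>s. K (1, s)) 0 1 i l j m \<longleftrightarrow> transport q 0 1 i l j m" by (rule cong) (use K in auto)
  ultimately show ?thesis by (simp add: P_def)
qed

text \<open>Reparametrises a lift and changes its initial value at the same time; this prepares the
  two halves of a concatenated path.\<close>

lemma lift_affine:
  assumes L: "lift p 0 1 L" and c: "c > 0" and h: "h \<in> carrier H"
    and r: "\<And>s. s \<in> {a..b} \<Longrightarrow> c * s + d \<in> {0..1}" "\<And>s. s \<in> {a..b} \<Longrightarrow> r s = p (c * s + d)"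
  shows "lift r a b (\<lambda>s i. h \<otimes>\<^bsub>H\<^esub> L (c * s + d) i)"
  unfolding lift_on_def
proof (intro ballI impI, goal_cases)
  case (1 s i)
  let ?s = "c * s + d"
  have s: "?s \<in> {0..1}" "p ?s \<in> U i" "r s = p ?s" using r 1 by auto
  obtain e where e: "e > 0" "\<forall>s'\<in>{0..1}. \<bar>s' - ?s\<bar> < e \<longrightarrow> p s' \<in> U i \<and> L s' i = L ?s i"
    using lift_nbhd[OF L s(1) 1(2) s(2)] by blast
  have "\<exists>e>0. \<forall>s'\<in>{a..b}. \<bar>s' - s\<bar> < e \<longrightarrow> r s' \<in> U i \<and> h \<otimes>\<^bsub>H\<^esub> L (c * s' + d) i = h \<otimes>\<^bsub>H\<^esub> L ?s i"
  proof (intro exI[of _ "e / c"] conjI ballI impI)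
    fix s' assume s': "s' \<in> {a..b}" "\<bar>s' - s\<bar> < e / c"
    have "(c * s' + d) - ?s = c * (s' - s)" by (simp add: algebra_simps)
    then have "\<bar>(c * s' + d) - ?s\<bar> = c * \<bar>s' - s\<bar>" using c by (simp add: abs_mult)
    then have "\<bar>(c * s' + d) - ?s\<bar> < e" using s'(2) c by (simp add: pos_less_divide_eq mult.commute)
    from e(2)[rule_format, OF r(1)[OF s'(1)] this]
    show "r s' \<in> U i" "h \<otimes>\<^bsub>H\<^esub> L (c * s' + d) i = h \<otimes>\<^bsub>H\<^esub> L ?s i"
      unfolding r(2)[OF s'(1)] by simp_all
  qed (use c e in auto)
  moreover have "h \<otimes>\<^bsub>H\<^esub> L ?s j = h \<otimes>\<^bsub>H\<^esub> L ?s i \<otimes>\<^bsub>H\<^esub> t i j (r s)" if "j \<in> I" "r s \<in> U j" for j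
  proof -
    have "L ?s j = L ?s i \<otimes>\<^bsub>H\<^esub> t i j (p ?s)" using lift_change[OF L s(1) 1(2) s(2)] that s by simp
    moreover have "t i j (p ?s) \<in> carrier H" using that s 1 by (auto intro: t_carrier)
    ultimately show ?thesis using h lift_carrier[OF L s(1) 1(2) s(2)] s by (simp add: H.m_assoc)
  qed
  ultimately show ?case using h lift_carrier[OF L s(1) 1(2) s(2)] by simp
qed

lemma transport_join:
  assumes p: "transport p 0 1 i \<one>\<^bsub>H\<^esub> i m" and q: "transport q 0 1 i \<one>\<^bsub>H\<^esub> i n"
    and i: "i \<in> I" "pathfinish p \<in> U i" "pathfinish q \<in> U i" and pq: "pathfinish p = pathstart q"
  shows "transport (p +++ q) 0 1 i \<one>\<^bsub>H\<^esub> i (m \<otimes>\<^bsub>H\<^esub> n)"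
proof -
  obtain L L' where L: "lift p 0 1 L" "L 0 i = \<one>\<^bsub>H\<^esub>" "L 1 i = m"
    and L': "lift q 0 1 L'" "L' 0 i = \<one>\<^bsub>H\<^esub>" "L' 1 i = n"
    using p q by (auto simp: transport_def)
  have m: "m \<in> carrier H" using lift_carrier[OF L(1), of 1 i] i L by (simp add: pathfinish_def)
  have 1: "lift (p +++ q) 0 (1/2) (\<lambda>s i. \<one>\<^bsub>H\<^esub> \<otimes>\<^bsub>H\<^esub> L (2 * s + 0) i)"
    by (rule lift_affine[OF L(1)]) (auto simp: joinpaths_def)
  have "(p +++ q) s = q (2 * s + -1)" if "s \<in> {1/2..1}" for s
  proof (cases "s = 1/2")
    case True
    show ?thesis unfolding True using pq by (simp add: joinpaths_def pathstart_def pathfinish_def)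
  qed (use that in \<open>auto simp: joinpaths_def\<close>)
  then have 2: "lift (p +++ q) (1/2) 1 (\<lambda>s i. m \<otimes>\<^bsub>H\<^esub> L' (2 * s + -1) i)"
    by (intro lift_affine[OF L'(1)]) (use m in auto)
  have "transport (p +++ q) 0 (1/2) i \<one>\<^bsub>H\<^esub> i m"
    unfolding transport_def by (rule exI, rule conjI, rule 1) (use L m in auto)
  moreover have "transport (p +++ q) (1/2) 1 i m i (m \<otimes>\<^bsub>H\<^esub> n)"
    unfolding transport_def by (rule exI, rule conjI, rule 2) (use L' m in auto)
  ultimately show ?thesis
    by (rule transport_trans) (use i pq in \<open>auto simp: joinpaths_def pathstart_def pathfinish_def\<close>)
qed

end

section \<open>The fundamental group\<close>

definition path_in :: "'a::topological_space set \<Rightarrow> (real \<Rightarrow> 'a) \<Rightarrow> bool"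
  where "path_in S p \<longleftrightarrow> path p \<and> path_image p \<subseteq> S"

lemma path_in_join [simp]: "path_in S p \<Longrightarrow> path_in S q \<Longrightarrow> pathfinish p = pathstart q \<Longrightarrow> path_in S (p +++ q)"
  by (auto simp: path_in_def path_image_join)

lemma path_in_reverse [simp]: "path_in S (reversepath p) \<longleftrightarrow> path_in S p"
  by (simp add: path_in_def)

lemma path_in_subset: "path_in S p \<Longrightarrow> S \<subseteq> T \<Longrightarrow> path_in T p"
  by (auto simp: path_in_def)

lemma path_in_const [simp]: "x \<in> S \<Longrightarrow> path_in S (linepath x x)" for x :: "'a::real_normed_vector"
  by (simp add: path_in_def)

lemma path_in_endpoints: "path_in S p \<Longrightarrow> pathstart p \<in> S" "path_in S p \<Longrightarrow> pathfinish p \<in> S"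
  by (auto simp: path_in_def)

lemma hp_refl: "path_in S p \<Longrightarrow> homotopic_paths S p p"
  by (simp add: path_in_def)

lemma hp_assoc:
  assumes "path_in S p" "path_in S q" "path_in S r" "pathfinish p = pathstart q" "pathfinish q = pathstart r"
  shows "homotopic_paths S (p +++ (q +++ r)) ((p +++ q) +++ r)"
    and "homotopic_paths S ((p +++ q) +++ r) (p +++ (q +++ r))"
  using homotopic_paths_assoc[of p S q r] assms by (simp_all add: path_in_def homotopic_paths_sym)

lemma hp_cancel_left:
  fixes S :: "'a::real_normed_vector set"
  assumes "path_in S B" "path_in S X" "pathstart X = pathfinish B"
  shows "homotopic_paths S (reversepath B +++ (B +++ X)) X"
proof -
  have "homotopic_paths S (reversepath B +++ (B +++ X)) ((reversepath B +++ B) +++ X)"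
    using assms by (intro homotopic_paths_assoc) (auto simp: path_in_def)
  moreover have "homotopic_paths S ((reversepath B +++ B) +++ X) (linepath (pathstart X) (pathstart X) +++ X)"
    using assms by (intro homotopic_paths_join) (auto simp: path_in_def homotopic_paths_linv)
  moreover have "homotopic_paths S (linepath (pathstart X) (pathstart X) +++ X) X"
    using assms by (intro homotopic_paths_lid) (auto simp: path_in_def)
  ultimately show ?thesis
    using homotopic_paths_trans by blast
qed

locale based_space =
  fixes S :: "'a::real_normed_vector set" and x\<^sub>0 :: 'a
  assumes x\<^sub>0: "x\<^sub>0 \<in> S" and conn: "path_connected S"
begin

abbreviation "FG \<equiv> fundamental_group S x\<^sub>0"
abbreviation "hp \<equiv> homotopic_paths S"
abbreviation "cls p \<equiv> loop_homotopy S x\<^sub>0 `` {p}"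

sublocale FG: group FG by (rule group_fundamental_group[OF x\<^sub>0])

definition connection :: "'a \<Rightarrow> real \<Rightarrow> 'a"
  where "connection y = (SOME p. path_in S p \<and> pathstart p = x\<^sub>0 \<and> pathfinish p = y)"

lemma connection:
  "y \<in> S \<Longrightarrow> path_in S (connection y)" "y \<in> S \<Longrightarrow> pathstart (connection y) = x\<^sub>0"
  "y \<in> S \<Longrightarrow> pathfinish (connection y) = y"
proof -
  assume "y \<in> S"
  then have "\<exists>p. path_in S p \<and> pathstart p = x\<^sub>0 \<and> pathfinish p = y"
    using conn x\<^sub>0 unfolding path_connected_def path_in_def by blast
  from someI_ex[OF this]
  show "path_in S (connection y)" "pathstart (connection y) = x\<^sub>0" "pathfinish (connection y) = y"
    unfolding connection_def by auto
qed

text \<open>Fixed connections to the base point turn every path into a loop class. This retracts the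
  fundamental groupoid onto the group at the base point and is multiplicative on all composable
  paths, not just on loops.\<close>

definition br :: "(real \<Rightarrow> 'a) \<Rightarrow> (real \<Rightarrow> 'a) set"
  where "br p = cls (connection (pathstart p) +++ (p +++ reversepath (connection (pathfinish p))))"

end

lemma loops_at_iff: "p \<in> loops_at S a \<longleftrightarrow> path_in S p \<and> pathstart p = a \<and> pathfinish p = a"
  by (auto simp: loops_at_def path_in_def)

lemma fundamental_group_class_eq:
  assumes "p \<in> loops_at S a" "q \<in> loops_at S a"
  shows "loop_homotopy S a `` {p} = loop_homotopy S a `` {q} \<longleftrightarrow> homotopic_paths S p q"
  using eq_equiv_class_iff[OF equiv_loop_homotopy assms] assms by (simp add: loop_homotopy_def)

lemma fundamental_group_carrier:
  "X \<in> carrier (fundamental_group S a) \<longleftrightarrow> (\<exists>p\<in>loops_at S a. X = loop_homotopy S a `` {p})"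
  by (auto simp: fundamental_group_def quotient_def)

lemma fundamental_group_mult:
  assumes "p \<in> loops_at S a" "q \<in> loops_at S a"
  shows "loop_homotopy S a `` {p} \<otimes>\<^bsub>fundamental_group S a\<^esub> loop_homotopy S a `` {q}
    = loop_homotopy S a `` {p +++ q}"
proof -
  let ?R = "loop_homotopy S a"
  have c: "?R `` {p' +++ q'} = ?R `` {p +++ q}" if "p' \<in> ?R `` {p}" "q' \<in> ?R `` {q}" for p' q'
  proof -
    have *: "p' \<in> loops_at S a" "q' \<in> loops_at S a" "homotopic_paths S p' p" "homotopic_paths S q' q"
      using that by (auto simp: loop_homotopy_def homotopic_paths_sym_eq)
    then have "homotopic_paths S (p' +++ q') (p +++ q)"
      by (intro homotopic_paths_join) (auto simp: loops_at_def)
    then show ?thesis using assms * by (simp add: fundamental_group_class_eq loops_at_join)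
  qed
  have "?R `` {p} \<noteq> {}" "?R `` {q} \<noteq> {}"
    using equiv_class_self[OF equiv_loop_homotopy] assms by blast+
  then have "(\<Union>p'\<in>?R `` {p}. \<Union>q'\<in>?R `` {q}. ?R `` {p' +++ q'}) = ?R `` {p +++ q}"
    by (intro UN_eq_const[OF _ UN_eq_const] c)
  then show ?thesis by (simp add: fundamental_group_def)
qed

lemma fundamental_group_one:
  "\<one>\<^bsub>fundamental_group S a\<^esub> = loop_homotopy S a `` {linepath a a}" for a :: "'a::real_normed_vector"
  by (simp add: fundamental_group_def linepath_refl)

context based_space begin

lemma br_loop: "path_in S p \<Longrightarrow>
  connection (pathstart p) +++ (p +++ reversepath (connection (pathfinish p))) \<in> loops_at S x\<^sub>0"
  using path_in_endpoints[of S p] by (simp add: loops_at_iff connection)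

lemma br_carrier: "path_in S p \<Longrightarrow> br p \<in> carrier FG"
  unfolding br_def fundamental_group_carrier using br_loop by blast

lemma br_cong: assumes "hp p q" shows "br p = br q"
proof -
  have pq: "path_in S p" "path_in S q" "pathstart q = pathstart p" "pathfinish q = pathfinish p"
    using homotopic_paths_imp_path[OF assms] homotopic_paths_imp_subset[OF assms]
      homotopic_paths_imp_pathstart[OF assms] homotopic_paths_imp_pathfinish[OF assms]
    by (auto simp: path_in_def)
  have e: "pathstart p \<in> S" "pathfinish p \<in> S" using path_in_endpoints[OF pq(1)] by auto
  have "hp (connection (pathstart p) +++ (p +++ reversepath (connection (pathfinish p))))
      (connection (pathstart p) +++ (q +++ reversepath (connection (pathfinish p))))"
    by (intro homotopic_paths_join hp_refl assms) (simp_all add: connection e)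
  then show ?thesis
    using fundamental_group_class_eq[OF br_loop[OF pq(1)] br_loop[OF pq(2)]] pq by (simp add: br_def)
qed

lemma br_mult:
  assumes p: "path_in S p" and q: "path_in S q" and pq: "pathfinish p = pathstart q"
  shows "br (p +++ q) = br p \<otimes>\<^bsub>FG\<^esub> br q"
proof -
  let ?A = "connection (pathstart p)" and ?B = "connection (pathstart q)"
    and ?C = "reversepath (connection (pathfinish q))"
  have e: "pathstart p \<in> S" "pathstart q \<in> S" "pathfinish q \<in> S"
    using path_in_endpoints p q by auto
  note [simp] = connection[OF e(1)] connection[OF e(2)] connection[OF e(3)] p q pq
  have "hp ((?A +++ (p +++ reversepath ?B)) +++ (?B +++ (q +++ ?C)))
      (?A +++ ((p +++ reversepath ?B) +++ (?B +++ (q +++ ?C))))"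
    by (rule hp_assoc(2)) simp_all
  moreover have "hp ((p +++ reversepath ?B) +++ (?B +++ (q +++ ?C))) (p +++ (reversepath ?B +++ (?B +++ (q +++ ?C))))"
    by (rule hp_assoc(2)) simp_all
  moreover have "hp (p +++ (reversepath ?B +++ (?B +++ (q +++ ?C)))) (p +++ (q +++ ?C))"
    by (intro homotopic_paths_join hp_refl hp_cancel_left) simp_all
  moreover have "hp (p +++ (q +++ ?C)) ((p +++ q) +++ ?C)"
    by (rule hp_assoc(1)) simp_all
  ultimately have "hp ((p +++ reversepath ?B) +++ (?B +++ (q +++ ?C))) ((p +++ q) +++ ?C)"
    using homotopic_paths_trans by blast
  then have "hp (?A +++ ((p +++ reversepath ?B) +++ (?B +++ (q +++ ?C)))) (?A +++ ((p +++ q) +++ ?C))"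
    by (intro homotopic_paths_join[OF hp_refl]) simp_all
  with \<open>hp ((?A +++ (p +++ reversepath ?B)) +++ (?B +++ (q +++ ?C))) _\<close>
  have "hp ((?A +++ (p +++ reversepath ?B)) +++ (?B +++ (q +++ ?C))) (?A +++ ((p +++ q) +++ ?C))"
    by (rule homotopic_paths_trans)
  moreover have "?A +++ ((p +++ q) +++ ?C) \<in> loops_at S x\<^sub>0" using br_loop[of "p +++ q"] by simp
  moreover have "?A +++ (p +++ reversepath ?B) \<in> loops_at S x\<^sub>0" "?B +++ (q +++ ?C) \<in> loops_at S x\<^sub>0"
    using br_loop[of p] br_loop[of q] by simp_all
  ultimately show ?thesis
    unfolding br_def by (simp add: fundamental_group_mult fundamental_group_class_eq loops_at_join homotopic_paths_sym)
qed

text \<open>A constant path joined to itself is homotopic to itself, so its class is idempotent in a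
  group.\<close>

lemma br_const: assumes "y \<in> S" shows "br (linepath y y) = \<one>\<^bsub>FG\<^esub>"
proof -
  have c: "path_in S (linepath y y)" using assms by simp
  have "hp (linepath y y +++ linepath y y) (linepath y y)"
    using homotopic_paths_lid[of "linepath y y" S] c by (simp add: path_in_def)
  from br_cong[OF this] have "br (linepath y y) \<otimes>\<^bsub>FG\<^esub> br (linepath y y) = br (linepath y y)"
    using br_mult[OF c c] by simp
  then show ?thesis using br_carrier[OF c] FG.l_cancel_one' by (metis FG.r_cancel_one)
qed

text \<open>For a loop at \<open>y\<close> the class is a conjugate by the connection to
  \<open>y\<close>; undoing the conjugation on both sides of the homotopy recovers the loop
  itself.\<close>

lemma br_faithful:
  assumes p: "path_in S p" "pathstart p = y" "pathfinish p = y" and "br p = \<one>\<^bsub>FG\<^esub>"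
  shows "hp p (linepath y y)"
proof -
  have y: "y \<in> S" using path_in_endpoints[OF p(1)] p by simp
  let ?A = "connection y"
  note [simp] = connection[OF y] p y
  have pl: "path_in S (linepath y y)" by simp
  have "br p = br (linepath y y)" using assms br_const by simp
  then have *: "hp (?A +++ (p +++ reversepath ?A)) (?A +++ (linepath y y +++ reversepath ?A))"
    using fundamental_group_class_eq[OF br_loop[OF p(1)] br_loop[OF pl]] by (simp add: br_def)
  have strip: "hp (reversepath ?A +++ ((?A +++ (r +++ reversepath ?A)) +++ ?A)) r"
    if r: "path_in S r" "pathstart r = y" "pathfinish r = y" for r
  proof -
    note [simp] = r
    have linv: "hp (reversepath ?A +++ ?A) (linepath y y)"
      using homotopic_paths_linv[of ?A S] connection[OF y] by (simp add: path_in_def)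
    have "hp ((?A +++ (r +++ reversepath ?A)) +++ ?A) (?A +++ ((r +++ reversepath ?A) +++ ?A))"
      by (rule hp_assoc(2)) simp_all
    then have "hp (reversepath ?A +++ ((?A +++ (r +++ reversepath ?A)) +++ ?A))
        (reversepath ?A +++ (?A +++ ((r +++ reversepath ?A) +++ ?A)))"
      by (intro homotopic_paths_join[OF hp_refl]) simp_all
    moreover have "hp (reversepath ?A +++ (?A +++ ((r +++ reversepath ?A) +++ ?A))) ((r +++ reversepath ?A) +++ ?A)"
      by (rule hp_cancel_left) simp_all
    moreover have "hp ((r +++ reversepath ?A) +++ ?A) (r +++ (reversepath ?A +++ ?A))"
      by (rule hp_assoc(2)) simp_all
    moreover have "hp (r +++ (reversepath ?A +++ ?A)) (r +++ linepath y y)"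
      by (rule homotopic_paths_join[OF hp_refl linv]) simp_all
    moreover have "hp (r +++ linepath y y) r"
      using homotopic_paths_rid[of r S] r by (simp add: path_in_def)
    ultimately show ?thesis by (meson homotopic_paths_trans)
  qed
  have "hp (reversepath ?A +++ ((?A +++ (p +++ reversepath ?A)) +++ ?A))
      (reversepath ?A +++ ((?A +++ (linepath y y +++ reversepath ?A)) +++ ?A))"
    by (intro homotopic_paths_join hp_refl *) simp_all
  from homotopic_paths_trans[OF homotopic_paths_sym[OF strip] homotopic_paths_trans[OF this strip]]
  show ?thesis using p by simp
qed

text \<open>The tautological flat section: at time \<open>s\<close> its value is the class of the
  path travelled so far, continued to the centre of the chart by \<gamma>. The elements
  \<open>g i\<close> change the trivialisation of each chart.\<close>

lemma lift_br:
  assumes p: "path_in S p" and d: "d \<in> carrier FG" and g: "\<And>i. i \<in> I \<Longrightarrow> g i \<in> carrier FG"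
    and open_U: "\<And>i. i \<in> I \<Longrightarrow> openin (top_of_set S) (U i)"
    and \<gamma>: "\<And>i y. i \<in> I \<Longrightarrow> y \<in> U i \<Longrightarrow> path_in S (\<gamma> i y) \<and> pathstart (\<gamma> i y) = y"
    and sc: "\<And>i \<eta>. i \<in> I \<Longrightarrow> path_in (U i) \<eta> \<Longrightarrow>
      pathfinish (\<gamma> i (pathfinish \<eta>)) = pathfinish (\<gamma> i (pathstart \<eta>)) \<and> hp (\<eta> +++ \<gamma> i (pathfinish \<eta>)) (\<gamma> i (pathstart \<eta>))"
  shows "lift_on I U FG
    (\<lambda>i j y. (g i \<otimes>\<^bsub>FG\<^esub> inv\<^bsub>FG\<^esub> br (\<gamma> i y)) \<otimes>\<^bsub>FG\<^esub> (br (\<gamma> j y) \<otimes>\<^bsub>FG\<^esub> inv\<^bsub>FG\<^esub> g j)) p 0 1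
    (\<lambda>s i. d \<otimes>\<^bsub>FG\<^esub> br (subpath 0 s p) \<otimes>\<^bsub>FG\<^esub> (br (\<gamma> i (p s)) \<otimes>\<^bsub>FG\<^esub> inv\<^bsub>FG\<^esub> g i))"
  unfolding lift_on_def
proof (intro ballI impI, goal_cases)
  case (1 s i)
  have sub: "path_in S (subpath s1 s2 p)" if "s1 \<in> {0..1}" "s2 \<in> {0..1}" for s1 s2
    using p path_image_subpath_subset[of s1 s2 p] that by (auto simp: path_in_def)
  have c0: "br (subpath 0 s p) \<in> carrier FG" by (rule br_carrier[OF sub]) (use 1 in auto)
  have c: "br (\<gamma> i (p s)) \<in> carrier FG" by (rule br_carrier) (use \<gamma>[OF 1(2,3)] in auto)
  obtain e where e: "e > 0" "\<forall>s'\<in>{0..1}. \<bar>s' - s\<bar> < e \<longrightarrow> p s' \<in> U i"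
    using openin_path_nbhd[of 0 1 p S "U i" s] p open_U[OF 1(2)] 1 by (auto simp: path_in_def path_def path_image_def)
  \<comment> \<open>Between the two times the path runs inside \<open>U i\<close>; going along it
    and then to the centre is homotopic to going to the centre directly.\<close>
  have eq: "br (subpath 0 s' p) \<otimes>\<^bsub>FG\<^esub> br (\<gamma> i (p s')) = br (subpath 0 s p) \<otimes>\<^bsub>FG\<^esub> br (\<gamma> i (p s))"
    if s': "s' \<in> {0..1}" "\<bar>s' - s\<bar> < e" for s'
  proof -
    let ?\<eta> = "subpath s s' p"
    have "path_image ?\<eta> \<subseteq> U i"
    proof -
      have "path_image ?\<eta> = p ` closed_segment s s'" by (rule path_image_subpath_gen)
      moreover have "p x \<in> U i" if "x \<in> closed_segment s s'" for x
      proof -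
        have "x \<in> {0..1}" "\<bar>x - s\<bar> < e" using that s' 1(1) by (auto simp: closed_segment_eq_real_ivl split: if_splits)
        then show ?thesis using e by blast
      qed
      ultimately show ?thesis by auto
    qed
    then have \<eta>: "path_in (U i) ?\<eta>" using sub[of s s'] s' 1 by (simp add: path_in_def)
    have ends: "pathstart ?\<eta> = p s" "pathfinish ?\<eta> = p s'" by auto
    have \<gamma>': "path_in S (\<gamma> i (p s'))" "pathstart (\<gamma> i (p s')) = p s'" using \<gamma>[OF 1(2), of "p s'"] e s' by auto
    have "br (\<gamma> i (p s)) = br (?\<eta> +++ \<gamma> i (p s'))"
      using sc[OF 1(2) \<eta>] unfolding ends by (intro br_cong[symmetric]) simp
    also have "\<dots> = br ?\<eta> \<otimes>\<^bsub>FG\<^esub> br (\<gamma> i (p s'))"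
      by (rule br_mult) (use sub 1 s' \<gamma>' in auto)
    finally have 2: "br (\<gamma> i (p s)) = br ?\<eta> \<otimes>\<^bsub>FG\<^esub> br (\<gamma> i (p s'))" .
    have "hp (subpath 0 s p +++ ?\<eta>) (subpath 0 s' p)"
      by (rule homotopic_join_subpaths) (use p 1 s' in \<open>auto simp: path_in_def\<close>)
    from br_cong[OF this] have 3: "br (subpath 0 s' p) = br (subpath 0 s p) \<otimes>\<^bsub>FG\<^esub> br ?\<eta>"
      using br_mult[of "subpath 0 s p" ?\<eta>] sub 1 s' by simp
    have "br ?\<eta> \<in> carrier FG" "br (\<gamma> i (p s')) \<in> carrier FG" using sub 1 s' \<gamma>' by (auto intro!: br_carrier)
    then show ?thesis using c0 by (simp add: 2 3 FG.m_assoc)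
  qed
  let ?L = "\<lambda>s i. d \<otimes>\<^bsub>FG\<^esub> br (subpath 0 s p) \<otimes>\<^bsub>FG\<^esub> (br (\<gamma> i (p s)) \<otimes>\<^bsub>FG\<^esub> inv\<^bsub>FG\<^esub> g i)"
  have "\<exists>e>0. \<forall>s'\<in>{0..1}. \<bar>s' - s\<bar> < e \<longrightarrow> p s' \<in> U i \<and> ?L s' i = ?L s i"
  proof (intro exI[of _ e] conjI ballI impI e(1))
    fix s' assume s': "s' \<in> {0..1}" "\<bar>s' - s\<bar> < e"
    show U: "p s' \<in> U i" using e s' by blast
    have "br (subpath 0 s' p) \<in> carrier FG" "br (\<gamma> i (p s')) \<in> carrier FG"
      using sub s' \<gamma>[OF 1(2) U] by (auto intro!: br_carrier)
    then have "?L s' i = d \<otimes>\<^bsub>FG\<^esub> (br (subpath 0 s' p) \<otimes>\<^bsub>FG\<^esub> br (\<gamma> i (p s'))) \<otimes>\<^bsub>FG\<^esub> inv\<^bsub>FG\<^esub> g i"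
      using d g[OF 1(2)] by (simp add: FG.m_assoc)
    also have "\<dots> = ?L s i" unfolding eq[OF s'] using d g[OF 1(2)] c0 c by (simp add: FG.m_assoc)
    finally show "?L s' i = ?L s i" .
  qed
  moreover have "?L s j = ?L s i \<otimes>\<^bsub>FG\<^esub>
      ((g i \<otimes>\<^bsub>FG\<^esub> inv\<^bsub>FG\<^esub> br (\<gamma> i (p s))) \<otimes>\<^bsub>FG\<^esub> (br (\<gamma> j (p s)) \<otimes>\<^bsub>FG\<^esub> inv\<^bsub>FG\<^esub> g j))"
    if j: "j \<in> I" "p s \<in> U j" for j
  proof -
    have "br (\<gamma> j (p s)) \<in> carrier FG" by (rule br_carrier) (use \<gamma>[OF j] in auto)
    then show ?thesis using c0 c d g[OF 1(2)] g[OF j(1)] by (simp add: FG.m_assoc FG.inv_cancel_left)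
  qed
  ultimately show ?case using c0 c d g[OF 1(2)] by auto
qed

end

section \<open>The polygon\<close>

locale polygon =
  fixes g :: nat
  assumes g: "g \<ge> 1"
begin

abbreviation "\<beta> \<equiv> polygon_boundary g"
abbreviation "w\<^sub>0 \<equiv> pi / (4 * real g)"

lemma w\<^sub>0: "w\<^sub>0 > 0" "w\<^sub>0 \<le> pi / 4" "2 * w\<^sub>0 < pi"
proof -
  have "4 * real g \<ge> 4" using g by simp
  then show "w\<^sub>0 > 0" "w\<^sub>0 \<le> pi / 4" by (simp, intro divide_left_mono) auto
  then show "2 * w\<^sub>0 < pi" using pi_gt_zero by linarith
qed

lemma \<beta>_cis: "\<beta> (c + \<tau>) = \<beta> c * cis (2 * w\<^sub>0 * \<tau>)"
  by (simp add: polygon_boundary_def cis_mult add_divide_distrib ring_distribs)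

lemma \<beta>_norm [simp]: "norm (\<beta> s) = 1"
  by (simp add: polygon_boundary_def)

lemma \<beta>_0 [simp]: "\<beta> 0 = 1"
  by (simp add: polygon_boundary_def)

text \<open>The power 4g sends vertices to 1 and midpoints of sides to -1. This tells the two kinds
  of centres apart without computing angles modulo a full turn.\<close>

lemma \<beta>_power: "\<beta> s ^ (4 * g) = cis (2 * pi * s)"
  unfolding polygon_boundary_def Complex.DeMoivre using g by (intro arg_cong[where f = cis]) (simp add: field_simps)

lemma cis_int: "cis (2 * pi * real n) = 1"
  using cis_multiple_2pi[of "real n"] by (simp add: mult_ac)

lemma \<beta>_nat_power: "\<beta> (real n) ^ (4 * g) = 1"
  using \<beta>_power[of "real n"] cis_int by simp

lemma \<beta>_half_power: "\<beta> (real n + 1/2) ^ (4 * g) = -1"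
proof -
  have "2 * pi * (real n + 1/2) = 2 * pi * real n + pi" by (simp add: algebra_simps)
  then show ?thesis unfolding \<beta>_power by (simp add: cis_mult[symmetric] cis_int)
qed

lemma \<beta>_period: "\<beta> (s + 4 * real g) = \<beta> s"
proof -
  have "2 * w\<^sub>0 * (4 * real g) = 2 * pi" using g by (simp add: field_simps)
  then show ?thesis unfolding \<beta>_cis by simp
qed

lemma \<beta>_mod: "\<beta> (real (n mod (4 * g))) = \<beta> (real n)" if "n \<le> 4 * g"
proof (cases "n = 4 * g")
  case True
  then show ?thesis using \<beta>_period[of 0] by simp
qed (use that in simp)

lemma \<beta>_inj:
  assumes "0 \<le> s" "s < 4 * real g" "0 \<le> s'" "s' < 4 * real g" "\<beta> s = \<beta> s'"
  shows "s = s'"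
proof -
  have "Arg2pi (\<beta> s) = 2 * w\<^sub>0 * s" if "0 \<le> s" "s < 4 * real g" for s
    by (rule Arg2pi_unique[of 1])
      (use that g in \<open>auto simp: polygon_boundary_def cis_conv_exp field_simps\<close>)
  then have "2 * w\<^sub>0 * s = 2 * w\<^sub>0 * s'" using assms by metis
  then show ?thesis using w\<^sub>0(1) g by simp
qed

lemma \<beta>_surj:
  assumes "norm z = 1"
  obtains s where "0 \<le> s" "s < 4 * real g" "z = \<beta> s"
proof
  let ?s = "Arg2pi z / (2 * w\<^sub>0)"
  show "0 \<le> ?s" using Arg2pi[of z] w\<^sub>0 by simp
  show "?s < 4 * real g" using Arg2pi[of z] g by (simp add: field_simps)
  have "2 * w\<^sub>0 * ?s = Arg2pi z" using w\<^sub>0 g by simp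
  then have "\<beta> ?s = cis (Arg2pi z)" using \<beta>_cis[of 0 ?s] by simp
  then show "z = \<beta> ?s" using assms Arg2pi_eq[of z] by (simp add: cis_conv_exp)
qed

text \<open>The open sector about \<open>p\<close> of half-width \<open>w\<^sub>0\<close>, half the
  angle of one side. About a vertex it reaches up to the adjacent midpoints, about a midpoint it
  meets the circle in exactly one open side.\<close>

definition Sec :: "complex \<Rightarrow> complex set"
  where "Sec p = {z. z \<noteq> 0 \<and> \<bar>Arg (z * cnj p)\<bar> < w\<^sub>0}"

lemma SecI:
  assumes "norm p = 1" "r > 0" "\<bar>\<theta>\<bar> < w\<^sub>0"
  shows "of_real r * p * cis \<theta> \<in> Sec p" "Arg (of_real r * p * cis \<theta> * cnj p) = \<theta>"
proof -
  have "p * cnj p = 1" using assms(1) by (simp add: complex_norm_square[symmetric])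
  then have *: "of_real r * p * cis \<theta> * cnj p = rcis r \<theta>"
    by (simp add: rcis_def mult_ac)
  have "\<theta> \<in> {-pi<..pi}" using assms(3) w\<^sub>0 by (auto simp: abs_less_iff)
  then show **: "Arg (of_real r * p * cis \<theta> * cnj p) = \<theta>" unfolding * using assms(2) by (rule Arg_rcis)
  have "p \<noteq> 0" using assms(1) by auto
  then show "of_real r * p * cis \<theta> \<in> Sec p" using assms ** by (auto simp: Sec_def)
qed

lemma SecD:
  assumes "norm p = 1" "z \<in> Sec p"
  shows "z = of_real (norm z) * p * cis (Arg (z * cnj p))" "norm z > 0" "\<bar>Arg (z * cnj p)\<bar> < w\<^sub>0"
    "z * cnj p \<notin> \<real>\<^sub>\<le>\<^sub>0"
proof -
  have pp: "cnj p * p = 1" using assms(1) by (simp add: complex_norm_square[symmetric] mult.commute)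
  have z: "z \<noteq> 0" "\<bar>Arg (z * cnj p)\<bar> < w\<^sub>0" using assms(2) by (auto simp: Sec_def)
  then show "norm z > 0" "\<bar>Arg (z * cnj p)\<bar> < w\<^sub>0" by auto
  have "z = (z * cnj p) * p" using pp by (simp add: mult.assoc)
  also have "z * cnj p = rcis (norm z) (Arg (z * cnj p))"
    using rcis_cmod_Arg[of "z * cnj p"] assms(1) by (simp add: norm_mult)
  finally show "z = of_real (norm z) * p * cis (Arg (z * cnj p))" by (simp add: rcis_def mult_ac)
  show "z * cnj p \<notin> \<real>\<^sub>\<le>\<^sub>0"
  proof
    assume neg: "z * cnj p \<in> \<real>\<^sub>\<le>\<^sub>0"
    have "p \<noteq> 0" using assms(1) by auto
    then have "z * cnj p \<noteq> 0" using z by simp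
    then have "Arg (z * cnj p) = pi" using neg
      by (auto simp: Arg_eq_pi complex_nonpos_Reals_iff complex_eq_iff order_less_le)
    then show False using z w\<^sub>0 by (simp add: abs_less_iff)
  qed
qed

lemma open_Sec: assumes "norm p = 1" shows "open (Sec p)"
proof -
  let ?A = "{z. z * cnj p \<notin> \<real>\<^sub>\<le>\<^sub>0}"
  have op: "open ?A"
  proof -
    have "open ((\<lambda>z. z * cnj p) -` (- \<real>\<^sub>\<le>\<^sub>0))"
      by (intro open_vimage continuous_intros) (simp add: closed_nonpos_Reals_complex open_Compl)
    then show ?thesis by (simp add: vimage_def)
  qed
  have "continuous_on ?A (\<lambda>z. Arg (z * cnj p))" by (intro continuous_intros) auto
  then have "open (?A \<inter> (\<lambda>z. Arg (z * cnj p)) -` {- w\<^sub>0<..<w\<^sub>0})"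
    using op by (intro continuous_open_preimage) auto
  also have "?A \<inter> (\<lambda>z. Arg (z * cnj p)) -` {- w\<^sub>0<..<w\<^sub>0} = Sec p"
    using SecD(4)[OF assms] by (auto simp: Sec_def abs_less_iff)
  finally show ?thesis .
qed

lemma Sec_power:
  assumes "norm p = 1" "z \<in> Sec p"
  shows "z ^ (4 * g) = of_real (norm z ^ (4 * g)) * p ^ (4 * g) * cis (4 * real g * Arg (z * cnj p))"
    and "4 * real g * Arg (z * cnj p) \<in> {- pi<..<pi}"
proof -
  have "z ^ (4 * g) = (of_real (norm z) * p * cis (Arg (z * cnj p))) ^ (4 * g)"
    using SecD(1)[OF assms] by simp
  then show "z ^ (4 * g) = of_real (norm z ^ (4 * g)) * p ^ (4 * g) * cis (4 * real g * Arg (z * cnj p))"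
    by (simp add: power_mult_distrib Complex.DeMoivre)
  have "\<bar>4 * real g * Arg (z * cnj p)\<bar> = 4 * real g * \<bar>Arg (z * cnj p)\<bar>" by (simp add: abs_mult)
  also have "\<dots> < 4 * real g * w\<^sub>0"
    using SecD(3)[OF assms] g by (intro mult_strict_left_mono) auto
  also have "\<dots> = pi" using g by simp
  finally show "4 * real g * Arg (z * cnj p) \<in> {- pi<..<pi}" by (simp add: abs_less_iff)
qed

text \<open>Multiplied by 4g, the angle of z relative to the centre lies strictly between -\<pi> and
  \<pi>, so it is determined by the power of z. Both centres then give the same relative angle and
  coincide.\<close>

lemma Sec_disjoint:
  assumes "norm p = 1" "norm p' = 1" "p ^ (4 * g) = p' ^ (4 * g)" "z \<in> Sec p" "z \<in> Sec p'"
  shows "p = p'"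
proof -
  let ?a = "Arg (z * cnj p)" and ?b = "Arg (z * cnj p')"
  have nz: "of_real (norm z ^ (4 * g)) * p ^ (4 * g) \<noteq> 0" using SecD(2)[OF assms(1,4)] assms(1) by auto
  have "of_real (norm z ^ (4 * g)) * p ^ (4 * g) * cis (4 * real g * ?a)
    = of_real (norm z ^ (4 * g)) * p ^ (4 * g) * cis (4 * real g * ?b)"
  proof (rule trans)
    show "of_real (norm z ^ (4 * g)) * p ^ (4 * g) * cis (4 * real g * ?a) = z ^ (4 * g)"
      by (rule Sec_power(1)[OF assms(1,4), symmetric])
    show "z ^ (4 * g) = of_real (norm z ^ (4 * g)) * p ^ (4 * g) * cis (4 * real g * ?b)"
      unfolding assms(3) by (rule Sec_power(1)[OF assms(2,5)])
  qed
  then have "cis (4 * real g * ?a) = cis (4 * real g * ?b)" using nz by (simp only: mult_cancel_left) simp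
  then have "Arg (cis (4 * real g * ?a)) = Arg (cis (4 * real g * ?b))" by simp
  then have "4 * real g * ?a = 4 * real g * ?b"
    using Sec_power(2)[OF assms(1,4)] Sec_power(2)[OF assms(2,5)] by (simp add: Arg_cis)
  then have ab: "?a = ?b" using g by simp
  have "of_real (norm z) * cis ?a \<noteq> 0" using SecD(2)[OF assms(1,4)] by simp
  moreover have "(of_real (norm z) * cis ?a) * p = (of_real (norm z) * cis ?a) * p'"
    using SecD(1)[OF assms(1,4)] SecD(1)[OF assms(2,5)] unfolding ab by (metis mult.assoc mult.commute)
  ultimately show ?thesis by (simp only: mult_cancel_left) simp
qed

text \<open>The opposite value of the power would occur only on the boundary rays, which the open
  sector omits. Hence sectors about vertices contain no midpoints of sides, and conversely.\<close>

lemma Sec_unit_power: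
  assumes "norm p = 1" "z \<in> Sec p" "norm z = 1" shows "z ^ (4 * g) \<noteq> - (p ^ (4 * g))"
proof
  let ?a = "4 * real g * Arg (z * cnj p)"
  assume "z ^ (4 * g) = - (p ^ (4 * g))"
  then have "p ^ (4 * g) * cis ?a = p ^ (4 * g) * (- 1)" using Sec_power(1)[OF assms(1,2)] assms(3) by simp
  moreover have "p ^ (4 * g) \<noteq> 0" using assms(1) by auto
  ultimately have "cis ?a = -1" by (simp only: mult_cancel_left) simp
  then have "Arg (cis ?a) = pi" by (simp add: Arg_eq_pi)
  then show False using Sec_power(2)[OF assms(1,2)] by (simp add: Arg_cis)
qed

lemma \<beta>_Sec:
  assumes "\<bar>\<tau>\<bar> < 1/2"
  shows "\<beta> (c + \<tau>) \<in> Sec (\<beta> c)" "Arg (\<beta> (c + \<tau>) * cnj (\<beta> c)) = 2 * w\<^sub>0 * \<tau>"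
proof -
  have "\<bar>2 * w\<^sub>0 * \<tau>\<bar> = w\<^sub>0 * (2 * \<bar>\<tau>\<bar>)" using w\<^sub>0(1) by (simp add: abs_mult)
  also have "\<dots> < w\<^sub>0 * 1" by (rule mult_strict_left_mono) (use assms w\<^sub>0(1) in auto)
  finally have "\<bar>2 * w\<^sub>0 * \<tau>\<bar> < w\<^sub>0" by simp
  from SecI[of "\<beta> c" 1, OF _ _ this]
  show "\<beta> (c + \<tau>) \<in> Sec (\<beta> c)" "Arg (\<beta> (c + \<tau>) * cnj (\<beta> c)) = 2 * w\<^sub>0 * \<tau>"
    by (simp_all add: \<beta>_cis)
qed

text \<open>
  The surface is covered by the open cell (index 0), the star of the vertex (index 1) and, for each
  of the \<open>2 g\<close> edges, the star of its midpoint (index \<open>2 + e\<close>). Pulled back to the polygon, chart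
  \<open>i\<close> is the union of the sectors \<open>cell i d\<close>, \<open>d \<in> corners i\<close>, with centres \<open>ctr i d\<close>; the edge
  \<open>e\<close> is represented by the sides \<open>first_side e\<close> and \<open>first_side e + 2\<close>.
\<close>

definition first_side :: "nat \<Rightarrow> nat"
  where "first_side e = 4 * (e div 2) + e mod 2"

definition ctr :: "nat \<Rightarrow> nat \<Rightarrow> complex"
  where "ctr i d = (if i = 0 then 0 else if i = 1 then \<beta> (real d) else \<beta> (real d + 1/2))"

definition cell :: "nat \<Rightarrow> nat \<Rightarrow> complex set"
  where "cell i d = (if i = 0 then ball 0 1 else Sec (ctr i d))"

definition corners :: "nat \<Rightarrow> nat set"
  where "corners i = (if i = 0 then {0} else if i = 1 then {..<4 * g}
    else {first_side (i - 2), first_side (i - 2) + 2})"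

definition chart :: "nat \<Rightarrow> complex set"
  where "chart i = cball 0 1 \<inter> (\<Union>d\<in>corners i. cell i d)"

abbreviation "charts \<equiv> {..<2 * g + 2}"

text \<open>Linear in polar coordinates about the centre: the radius tends to 1 and the relative
  angle to 0. The unit circle is preserved and its parameter moves linearly, so the contraction can
  respect the gluing.\<close>

definition contr :: "nat \<Rightarrow> nat \<Rightarrow> real \<Rightarrow> complex \<Rightarrow> complex"
  where "contr i d t z = (if i = 0 then of_real (1 - t) * z
    else of_real ((1 - t) * norm z + t) * ctr i d * cis ((1 - t) * Arg (z * cnj (ctr i d))))"

lemma first_side_div_mod: "first_side e div 4 = e div 2" "first_side e mod 4 = e mod 2"
proof -
  have "e mod 2 < 4" by (rule less_trans[of _ 2]) auto
  then show "first_side e div 4 = e div 2" "first_side e mod 4 = e mod 2"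
    by (simp_all add: first_side_def)
qed

lemma first_side_less: "e < 2 * g \<Longrightarrow> first_side e + 2 < 4 * g"
proof -
  assume "e < 2 * g"
  then have "e div 2 < g" by simp
  moreover have "e mod 2 < 2" by simp
  ultimately show ?thesis unfolding first_side_def by linarith
qed

lemma first_side_mod: "first_side e mod 4 < 2"
  by (simp add: first_side_div_mod)

lemma first_side_ne: "first_side e \<noteq> Suc (Suc (first_side e'))"
proof
  assume eq: "first_side e = Suc (Suc (first_side e'))"
  define k r k' r' where "k = e div 2" "r = e mod 2" "k' = e' div 2" "r' = e' mod 2"
  have "4 * k + r = 4 * k' + r' + 2" "r < 2" "r' < 2"
    using eq by (simp_all add: first_side_def k_r_k'_r'_def)
  then show False by presburger
qed

lemma first_side_inj: "first_side e = first_side e' \<Longrightarrow> e = e'"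
  using first_side_div_mod by (metis mult_div_mod_eq)

lemma ex_first_side:
  assumes "m mod 4 < 2" "m < 4 * g" shows "\<exists>e<2 * g. m = first_side e"
proof (intro exI[of _ "2 * (m div 4) + m mod 4"] conjI)
  have "m div 4 < g" using assms(2) by simp
  then show "2 * (m div 4) + m mod 4 < 2 * g" using assms(1) by linarith
  have "(2 * (m div 4) + m mod 4) div 2 = m div 4" "(2 * (m div 4) + m mod 4) mod 2 = m mod 4"
    using assms(1) by simp_all
  then show "m = first_side (2 * (m div 4) + m mod 4)" by (simp add: first_side_def)
qed

lemma corners_less: "i \<in> charts \<Longrightarrow> d \<in> corners i \<Longrightarrow> d < 4 * g"
proof -
  assume *: "i \<in> charts" "d \<in> corners i"
  then have "i - 2 < 2 * g" using g unfolding lessThan_iff by linarith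
  then show "d < 4 * g" using first_side_less[of "i - 2"] * g by (auto simp: corners_def split: if_splits)
qed

lemma ctr_norm [simp]: "i \<noteq> 0 \<Longrightarrow> norm (ctr i d) = 1"
  by (simp add: ctr_def)

lemma ctr_0 [simp]: "ctr 0 d = 0"
  by (simp add: ctr_def)

lemma ctr_power: "i \<noteq> 0 \<Longrightarrow> ctr i d ^ (4 * g) = (if i = 1 then 1 else -1)"
  using \<beta>_nat_power[of d] \<beta>_half_power[of d] by (simp add: ctr_def)

lemma ctr_inj:
  assumes "i \<noteq> 0" "i = 1 \<longleftrightarrow> j = 1" "j \<noteq> 0" "d < 4 * g" "d' < 4 * g" "ctr i d = ctr j d'" shows "d = d'"
proof -
  have "real d + 1 \<le> 4 * real g" "real d' + 1 \<le> 4 * real g" using assms by linarith+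
  then have "real d = real d'"
    using assms \<beta>_inj[of "real d" "real d'"] \<beta>_inj[of "real d + 1/2" "real d' + 1/2"]
    by (auto simp: ctr_def split: if_splits)
  then show ?thesis by simp
qed

lemma open_cell: "open (cell i d)"
  by (simp add: cell_def open_Sec)

lemma cell_disjoint:
  assumes "i \<in> charts" "j \<in> charts" "i = 0 \<longleftrightarrow> j = 0" "i = 1 \<longleftrightarrow> j = 1"
    and "d \<in> corners i" "d' \<in> corners j" "z \<in> cell i d" "z \<in> cell j d'"
  shows "d = d'"
proof (cases "i = 0")
  case True
  then show ?thesis using assms by (simp add: corners_def)
next
  case False
  have "ctr i d = ctr j d'"
    by (rule Sec_disjoint[where z = z]) (use assms False in \<open>auto simp: cell_def ctr_power\<close>)
  then show ?thesis using ctr_inj[of i j d d'] assms False corners_less by auto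
qed

lemma cell_disjoint':
  assumes "i \<in> charts" "j \<in> charts" "i \<ge> 2" "j \<ge> 2"
    and "d \<in> corners i" "d' \<in> corners j" "z \<in> cell i d" "z \<in> cell j d'"
  shows "i = j"
proof -
  have "d = d'" by (rule cell_disjoint[of i j _ _ z]) (use assms in auto)
  then have "first_side (i - 2) = first_side (j - 2)"
    using assms first_side_ne[of "i - 2" "j - 2"] first_side_ne[of "j - 2" "i - 2"]
    by (auto simp: corners_def)
  then show ?thesis using first_side_inj[of "i - 2" "j - 2"] assms by simp
qed

lemma contr_0: "z \<in> cell i d \<Longrightarrow> contr i d 0 z = z"
  using SecD(1)[of "ctr i d" z] by (auto simp: contr_def cell_def)

lemma contr_1: "contr i d 1 z = ctr i d"
  by (simp add: contr_def)

lemma contr_cell: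
  assumes z: "z \<in> cell i d" "z \<in> cball 0 1" and t: "t \<in> {0..1}"
  shows "contr i d t z \<in> cell i d \<inter> cball 0 1"
proof (cases "i = 0")
  case True
  have "\<bar>1 - t\<bar> * norm z \<le> 1 * norm z" by (rule mult_right_mono) (use t in auto)
  moreover have "norm (contr i d t z) = \<bar>1 - t\<bar> * norm z"
  proof -
    have "contr i d t z = of_real (1 - t) * z" using True by (simp add: contr_def)
    then show ?thesis by (simp only: norm_mult norm_of_real)
  qed
  ultimately show ?thesis using z True by (simp add: cell_def)
next
  case False
  let ?p = "ctr i d"
  have zp: "z \<in> Sec ?p" using z False by (simp add: cell_def)
  have r: "norm z > 0" "norm z \<le> 1" using SecD(2)[of ?p z] zp False z by auto
  have rr: "(1 - t) * norm z + t > 0"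
    using r t by (cases "t = 0") (auto intro!: add_nonneg_pos)
  have "(1 - t) * norm z \<le> (1 - t) * 1" by (rule mult_left_mono) (use r t in auto)
  then have r1: "(1 - t) * norm z + t \<le> 1" by simp
  have "\<bar>(1 - t) * Arg (z * cnj ?p)\<bar> = (1 - t) * \<bar>Arg (z * cnj ?p)\<bar>" using t by (simp add: abs_mult)
  also have "\<dots> \<le> 1 * \<bar>Arg (z * cnj ?p)\<bar>" by (rule mult_right_mono) (use t in auto)
  also have "\<dots> < w\<^sub>0" using SecD(3)[of ?p z] zp False by simp
  finally have "contr i d t z \<in> Sec ?p" unfolding contr_def using False SecI(1)[of ?p, OF _ rr] by simp
  moreover have "norm (contr i d t z) = \<bar>(1 - t) * norm z + t\<bar>"
    unfolding contr_def using False by (simp add: norm_mult del: of_real_add of_real_mult)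
  ultimately show ?thesis using False rr r1 by (simp add: cell_def)
qed

lemma contr_cont: "continuous_on (UNIV \<times> cell i d) (\<lambda>(t, z). contr i d t z)"
proof (cases "i = 0")
  case True
  then show ?thesis unfolding contr_def by (auto intro!: continuous_intros simp: split_beta)
next
  case False
  have "snd x * cnj (ctr i d) \<notin> \<real>\<^sub>\<le>\<^sub>0" if "x \<in> UNIV \<times> cell i d" for x :: "real \<times> complex"
    using that False SecD(4)[of "ctr i d" "snd x"] by (auto simp: cell_def)
  then show ?thesis using False unfolding contr_def split_beta
    by (simp add: split_beta) (intro continuous_intros continuous_on_Arg', auto)
qed

definition which :: "nat \<Rightarrow> complex \<Rightarrow> nat"
  where "which i z = (THE d. d \<in> corners i \<and> z \<in> cell i d)"

lemma which_eq: "i \<in> charts \<Longrightarrow> d \<in> corners i \<Longrightarrow> z \<in> cell i d \<Longrightarrow> which i z = d"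
  unfolding which_def by (rule the_equality) (auto intro: cell_disjoint)

lemma chart_which:
  assumes "i \<in> charts" "z \<in> chart i"
  shows "which i z \<in> corners i" "z \<in> cell i (which i z)"
  using assms which_eq[OF assms(1)] by (auto simp: chart_def)

definition C :: "nat \<Rightarrow> real \<Rightarrow> complex \<Rightarrow> complex"
  where "C i t z = contr i (which i z) t z"

text \<open>The cells of one chart are open and pairwise disjoint, so \<open>which\<close> is
  locally constant and the contractions of the cells fit together.\<close>

lemma C_cont:
  assumes "i \<in> charts" shows "continuous_on ({0..1} \<times> chart i) (\<lambda>(t, z). C i t z)"
proof -
  have "continuous_on (\<Union>d\<in>corners i. UNIV \<times> cell i d) (\<lambda>(t, z). C i t z)"
  proof (rule continuous_on_open_UN)
    fix d assume d: "d \<in> corners i"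
    show "open (UNIV \<times> cell i d :: (real \<times> complex) set)" by (intro open_Times open_cell) simp
    have "continuous_on (UNIV \<times> cell i d) (\<lambda>(t, z). C i t z) \<longleftrightarrow>
        continuous_on (UNIV \<times> cell i d) (\<lambda>(t :: real, z). contr i d t z)"
      by (rule continuous_on_cong) (auto simp: C_def which_eq[OF assms d])
    then show "continuous_on (UNIV \<times> cell i d) (\<lambda>(t, z). C i t z)" using contr_cont by blast
  qed
  then show ?thesis by (rule continuous_on_subset) (auto simp: chart_def)
qed

lemma C_chart: "i \<in> charts \<Longrightarrow> z \<in> chart i \<Longrightarrow> t \<in> {0..1} \<Longrightarrow> C i t z \<in> chart i"
  using contr_cell[of z i "which i z" t] chart_which[of i z] by (auto simp: C_def chart_def)

lemma openin_chart: "openin (top_of_set (cball 0 1)) (chart i)"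
  unfolding chart_def by (intro openin_open_Int open_UN ballI open_cell)

lemma C_0: "i \<in> charts \<Longrightarrow> z \<in> chart i \<Longrightarrow> C i 0 z = z"
  using chart_which by (simp add: C_def contr_0)

lemma C_1: "C i 1 z = ctr i (which i z)"
  by (simp add: C_def contr_1)

text \<open>Both kinds of gluing take one form: side m with m mod 4 < 2 is glued to side m + 2 with
  reversed direction.\<close>

lemma side_pairingE:
  assumes "(z, w) \<in> side_pairing g"
  obtains m x where "m mod 4 < 2" "m < 4 * g" "x \<in> {0..1}" "z = \<beta> (real m + x)" "w = \<beta> (real m + 3 - x)"
proof -
  obtain k t where k: "k < g" "t \<in> {0..1}" and
    *: "(z, w) = (\<beta> (4 * real k + t), \<beta> (4 * real k + 3 - t)) \<or>
     (z, w) = (\<beta> (4 * real k + 1 + t), \<beta> (4 * real k + 4 - t))"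
    using assms unfolding side_pairing_def by blast
  from * show ?thesis
  proof
    assume "(z, w) = (\<beta> (4 * real k + t), \<beta> (4 * real k + 3 - t))"
    then show ?thesis using k by (intro that[of "4 * k" t]) auto
  next
    assume "(z, w) = (\<beta> (4 * real k + 1 + t), \<beta> (4 * real k + 4 - t))"
    moreover have "(4 * k + 1) mod 4 = 1 mod (4 :: nat)" by (rule mod_mult_self4)
    ultimately show ?thesis using k
      by (intro that[of "4 * k + 1" t]) (simp, simp, simp, simp_all add: add_ac)
  qed
qed

lemma side_pairingI:
  assumes "m mod 4 < 2" "m < 4 * g" "x \<in> {0..1}"
  shows "(\<beta> (real m + x), \<beta> (real m + 3 - x)) \<in> side_pairing g"
proof -
  define k where "k = m div 4"
  have k: "k < g" using assms(2) by (simp add: k_def)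
  have "m = 4 * k \<or> m = 4 * k + 1" using mult_div_mod_eq[of 4 m] assms(1) unfolding k_def by linarith
  then have "real m = 4 * real k \<or> real m = 4 * real k + 1" by auto
  moreover have "(\<beta> (4 * real k + x), \<beta> (4 * real k + 3 - x)) \<in> side_pairing g"
    "(\<beta> (4 * real k + 1 + x), \<beta> (4 * real k + 4 - x)) \<in> side_pairing g"
    using k assms(3) unfolding side_pairing_def by blast+
  moreover have "4 * real k + 1 + 3 - x = 4 * real k + 4 - x" by simp
  ultimately show ?thesis by metis
qed

lemma contr_boundary:
  assumes "i \<noteq> 0" "ctr i d = \<beta> c" "\<bar>\<tau>\<bar> < 1/2"
  shows "contr i d t (\<beta> (c + \<tau>)) = \<beta> (c + (1 - t) * \<tau>)" "\<beta> (c + \<tau>) \<in> cell i d"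
proof -
  show "contr i d t (\<beta> (c + \<tau>)) = \<beta> (c + (1 - t) * \<tau>)"
  proof -
    have "(1 - t) * (2 * w\<^sub>0 * \<tau>) = 2 * w\<^sub>0 * ((1 - t) * \<tau>)" by simp
    then show ?thesis unfolding \<beta>_cis[of c "(1 - t) * \<tau>"]
      using assms(1) unfolding contr_def assms(2) \<beta>_Sec(2)[OF assms(3)] by (simp add: mult_ac)
  qed
  show "\<beta> (c + \<tau>) \<in> cell i d" using assms \<beta>_Sec(1)[OF assms(3), of c] by (simp add: cell_def)
qed

lemma chart_0: "chart 0 = ball 0 1"
  by (auto simp: chart_def cell_def corners_def)

text \<open>Glued points lie at opposite offsets from two corners of the same chart, and contraction
  shrinks both offsets at the same rate. The list of corner pairs is what the potentials of the
  local system have to match.\<close>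

lemma pairing_charts:
  assumes m: "m mod 4 < 2" "m < 4 * g" and x: "x \<in> {0..1}"
    and i: "i \<in> charts" and zw: "\<beta> (real m + x) \<in> chart i \<or> \<beta> (real m + 3 - x) \<in> chart i"
  shows "\<exists>d d'. d \<in> corners i \<and> d' \<in> corners i \<and> \<beta> (real m + x) \<in> cell i d \<and> \<beta> (real m + 3 - x) \<in> cell i d' \<and>
    (\<forall>t\<in>{0..1}. (contr i d t (\<beta> (real m + x)), contr i d' t (\<beta> (real m + 3 - x))) \<in> side_pairing g) \<and>
    (i = 1 \<and> d = m \<and> d' = (m + 3) mod (4 * g) \<or> i = 1 \<and> d = m + 1 \<and> d' = m + 2 \<or> i \<ge> 2 \<and> d = m \<and> d' = m + 2)"
proof -
  let ?z = "\<beta> (real m + x)" and ?w = "\<beta> (real m + 3 - x)"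
  have "m div 4 < g" using m(2) by simp
  then have m3: "m + 2 < 4 * g" using m(1) mult_div_mod_eq[of 4 m] by linarith
  have i0: "i \<noteq> 0" using zw by (intro notI) (simp add: chart_0)
  \<comment> \<open>The part common to all cases: \<open>c\<close> and \<open>c'\<close> are the
    boundary parameters of the two corners, and \<tau> is the offset of the first point.\<close>
  have ex: "?thesis" if d: "d \<in> corners i" "d' \<in> corners i" and c: "ctr i d = \<beta> c" "ctr i d' = \<beta> c'"
      and \<tau>: "\<bar>\<tau>\<bar> < 1/2" "real m + x = c + \<tau>" "real m + 3 - x = c' - \<tau>" "c \<in> {real m..real m + 1}"
      and dd: "i = 1 \<and> d = m \<and> d' = (m + 3) mod (4 * g) \<or> i = 1 \<and> d = m + 1 \<and> d' = m + 2 \<or> i \<ge> 2 \<and> d = m \<and> d' = m + 2"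
    for d d' c c' \<tau>
  proof (rule exI[of _ d], rule exI[of _ d'], intro conjI)
    show "d \<in> corners i" "d' \<in> corners i" by (rule d)+
    show "i = 1 \<and> d = m \<and> d' = (m + 3) mod (4 * g) \<or> i = 1 \<and> d = m + 1 \<and> d' = m + 2 \<or> i \<ge> 2 \<and> d = m \<and> d' = m + 2"
      by (rule dd)
    have w: "?w = \<beta> (c' + (- \<tau>))" "?z = \<beta> (c + \<tau>)" using \<tau> by simp_all
    show "?z \<in> cell i d" "?w \<in> cell i d'"
      unfolding w by (rule contr_boundary(2)[OF i0 c(1) \<tau>(1)], rule contr_boundary(2)[OF i0 c(2)], use \<tau>(1) in simp)
    show "\<forall>t\<in>{0..1}. (contr i d t ?z, contr i d' t ?w) \<in> side_pairing g"
    proof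
      fix t :: real assume t: "t \<in> {0..1}"
      have "contr i d t ?z = \<beta> (c + (1 - t) * \<tau>)" "contr i d' t ?w = \<beta> (c' + (1 - t) * (- \<tau>))"
        unfolding w using c \<tau>(1) by (intro contr_boundary(1)[OF i0]; simp)+
      \<comment> \<open>The contracted parameter is a convex combination of the parameters of the
        point and of the corner, so it stays on the same side.\<close>
      moreover have "(1 - t) * (c + \<tau> - m) + t * (c - m) \<in> {0..1}"
      proof -
        have "c + \<tau> - m \<in> {0..1}" "c - m \<in> {0..1}" using \<tau> x by auto
        then show ?thesis using t convexD[OF convex_real_interval(5)[of 0 1], of "c + \<tau> - m" "c - m" "1 - t" t]
          by (simp add: convex_def)
      qed
      then have "(\<beta> (real m + ((1 - t) * (c + \<tau> - m) + t * (c - m))),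
          \<beta> (real m + 3 - ((1 - t) * (c + \<tau> - m) + t * (c - m)))) \<in> side_pairing g"
        by (rule side_pairingI[OF m])
      moreover have "real m + ((1 - t) * (c + \<tau> - m) + t * (c - m)) = c + (1 - t) * \<tau>"
        by (simp add: algebra_simps)
      moreover have "real m + 3 - ((1 - t) * (c + \<tau> - m) + t * (c - m)) = c' + (1 - t) * (- \<tau>)"
        using \<tau>(2,3) by (simp add: algebra_simps)
      ultimately show "(contr i d t ?z, contr i d' t ?w) \<in> side_pairing g" by simp
    qed
  qed
  \<comment> \<open>The vertex chart contains no midpoint and an edge chart no vertex; this disposes
    of the borderline values of \<open>x\<close>.\<close>
  have not_unit: False if "y \<in> chart i" "y ^ (4 * g) = (if i = 1 then -1 else 1)" "norm y = 1" for y
    using that chart_which[OF i that(1)] Sec_unit_power[of "ctr i (which i y)" y] i0 ctr_power[OF i0]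
    by (auto simp: cell_def split: if_splits)
  show ?thesis
  proof (cases "i = 1")
    case i1: True
    \<comment> \<open>Before the midpoint the nearest vertices are m and m + 3, the latter taken
      modulo 4g because vertex 4g is vertex 0; after it they are m + 1 and m + 2.\<close>
    consider "x < 1/2" | "x = 1/2" | "x > 1/2" by linarith
    then show ?thesis
    proof cases
      case 1
      have "(m + 3) mod (4 * g) < 4 * g" using g by simp
      then show ?thesis using 1 x m i1 m3 \<beta>_mod[of "m + 3"]
        by (intro ex[of m "(m + 3) mod (4 * g)" "real m" "real m + 3" x]) (auto simp: corners_def ctr_def add_ac)
    next
      case 2
      have "?w = \<beta> (real (m + 2) + 1/2)" by (rule arg_cong[where f = \<beta>]) (use 2 in simp)
      moreover have "?z = \<beta> (real m + 1/2)" by (rule arg_cong[where f = \<beta>]) (use 2 in simp)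
      ultimately have "?z ^ (4 * g) = -1" "?w ^ (4 * g) = -1"
        using \<beta>_half_power[of m] \<beta>_half_power[of "m + 2"] by metis+
      then have False using zw not_unit[of ?z] not_unit[of ?w] i1 by auto
      then show ?thesis by blast
    next
      case 3
      then show ?thesis using x m i1 m3
        by (intro ex[of "m + 1" "m + 2" "real m + 1" "real m + 2" "x - 1"]) (auto simp: corners_def ctr_def add_ac)
    qed
  next
    case False
    then have i2: "i \<ge> 2" using i0 by simp
    obtain e where e: "e < 2 * g" "m = first_side e" using ex_first_side m by blast
    let ?j = "e + 2"
    have j: "?j \<in> charts" "m \<in> corners ?j" "m + 2 \<in> corners ?j" using e by (auto simp: corners_def)
    consider "x \<in> {0, 1}" | "0 < x" "x < 1" using x by fastforce
    then show ?thesis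
    proof cases
      case 1
      have "?z = \<beta> (real (m + (if x = 0 then 0 else 1)))" "?w = \<beta> (real (m + (if x = 0 then 3 else 2)))"
        using 1 by (auto simp: add_ac)
      then have "?z ^ (4 * g) = 1" "?w ^ (4 * g) = 1" using \<beta>_nat_power by (metis, metis)
      then have "?z \<notin> chart i" "?w \<notin> chart i" using not_unit[of ?z] not_unit[of ?w] False by auto
      then show ?thesis using zw by blast
    next
      case 2
      have \<tau>: "\<bar>x - 1/2\<bar> < 1/2" using 2 by linarith
      have "\<beta> ((real m + 1/2) + (x - 1/2)) \<in> cell ?j m" "\<beta> ((real (m + 2) + 1/2) + (1/2 - x)) \<in> cell ?j (m + 2)"
        by (rule contr_boundary(2); use \<tau> in \<open>simp add: ctr_def abs_minus_commute\<close>)+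
      moreover have "(real m + 1/2) + (x - 1/2) = real m + x" "(real (m + 2) + 1/2) + (1/2 - x) = real m + 3 - x" by simp_all
      ultimately have zw': "?z \<in> cell ?j m" "?w \<in> cell ?j (m + 2)" by (simp_all only:)
      have "i = ?j"
        using zw
      proof
        assume z: "?z \<in> chart i"
        show ?thesis
          by (rule cell_disjoint'[OF i j(1) i2 _ chart_which(1)[OF i z] j(2) chart_which(2)[OF i z] zw'(1)]) simp
      next
        assume w: "?w \<in> chart i"
        show ?thesis
          by (rule cell_disjoint'[OF i j(1) i2 _ chart_which(1)[OF i w] j(3) chart_which(2)[OF i w] zw'(2)]) simp
      qed
      then show ?thesis using j \<tau> i2
        by (intro ex[of m "m + 2" "real m + 1/2" "real m + 2 + 1/2" "x - 1/2"]) (auto simp: ctr_def add_ac)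
    qed
  qed
qed

text \<open>A boundary point that is not the midpoint of its side is nearer to one end of the side
  and lies in the vertex chart; a midpoint lies in the chart of its edge.\<close>

lemma chart_cover: assumes "z \<in> cball 0 1" shows "\<exists>i\<in>charts. z \<in> chart i"
proof (cases "norm z < 1")
  case True
  then have "z \<in> chart 0" by (simp add: chart_0)
  then show ?thesis by (intro bexI[of _ 0]) auto
next
  case False
  then have nz: "norm z = 1" using assms by simp
  then obtain s where s: "0 \<le> s" "s < 4 * real g" "z = \<beta> s" by (rule \<beta>_surj)
  define n where "n = nat \<lfloor>s\<rfloor>"
  have n: "real n \<le> s" "s < real n + 1" using s by (auto simp: n_def)
  then have ng: "n < 4 * g" using s by linarith
  consider "s < n + 1/2" | "s = n + 1/2" | "s > n + 1/2" by linarith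
  then show ?thesis
  proof cases
    case 1
    then have "\<beta> (real n + (s - n)) \<in> cell 1 n" using n by (intro contr_boundary(2)) (auto simp: ctr_def)
    then have "z \<in> chart 1" using s ng assms by (auto simp: chart_def corners_def)
    then show ?thesis using g by (intro bexI[of _ 1]) auto
  next
    case 3
    have c: "ctr 1 ((n + 1) mod (4 * g)) = \<beta> (real (n + 1))" using \<beta>_mod[of "n + 1"] ng by (simp add: ctr_def)
    have "\<beta> (real (n + 1) + (s - real (n + 1))) \<in> cell 1 ((n + 1) mod (4 * g))"
      by (rule contr_boundary(2)[OF _ c]) (use 3 n in auto)
    then have "z \<in> cell 1 ((n + 1) mod (4 * g))" using s by simp
    moreover have "(n + 1) mod (4 * g) \<in> corners 1" using g by (simp add: corners_def)
    ultimately have "z \<in> chart 1" using assms unfolding chart_def by blast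
    then show ?thesis using g by (intro bexI[of _ 1]) auto
  next
    case 2
    obtain m where m: "m mod 4 < 2" "m < 4 * g" "n = m \<or> n = m + 2"
    proof (cases "n mod 4 < 2")
      case False
      have r: "n mod 4 - 2 < 4" "n mod 4 - 2 < 2" using mod_less_divisor[of 4 n] by linarith+
      have n': "n = (4 * (n div 4) + (n mod 4 - 2)) + 2" using False mult_div_mod_eq[of 4 n] by linarith
      show ?thesis
      proof (rule that)
        show "(4 * (n div 4) + (n mod 4 - 2)) mod 4 < 2" using r by simp
        show "4 * (n div 4) + (n mod 4 - 2) < 4 * g" using n' ng by linarith
        show "n = 4 * (n div 4) + (n mod 4 - 2) \<or> n = 4 * (n div 4) + (n mod 4 - 2) + 2" using n' by blast
      qed
    qed (use that ng in blast)
    then obtain e where e: "e < 2 * g" "m = first_side e" using ex_first_side by blast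
    have "\<beta> ((real n + 1/2) + 0) \<in> cell (2 + e) n" by (rule contr_boundary(2)) (auto simp: ctr_def)
    then have "z \<in> cell (2 + e) n" using s 2 by simp
    moreover have "n \<in> corners (2 + e)" using m e by (auto simp: corners_def)
    ultimately have "z \<in> chart (2 + e)" using assms unfolding chart_def by blast
    then show ?thesis using e by (intro bexI[of _ "2 + e"]) auto
  qed
qed

end

section \<open>Charts of the surface\<close>

locale polygon_surface = polygon +
  fixes S :: "'a::real_normed_vector set" and q :: "complex \<Rightarrow> 'a"
  assumes quo: "quotient_map (top_of_set (cball 0 1)) (top_of_set S) q"
    and glue: "z \<in> cball 0 1 \<Longrightarrow> w \<in> cball 0 1 \<Longrightarrow> q z = q w \<longleftrightarrow> (z, w) \<in> polygon_gluing g"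
begin

abbreviation "pairing \<equiv> side_pairing g \<union> (side_pairing g)\<inverse>"

lemma q_cont: "continuous_on (cball 0 1) q" and q_image: "q ` cball 0 1 = S"
  using quotient_imp_continuous_map[OF quo] quotient_imp_surjective_map[OF quo] by auto

lemma pairing_norm: "(z, w) \<in> pairing \<Longrightarrow> norm z = 1 \<and> norm w = 1"
  by (auto elim!: side_pairingE)

lemma q_pairing: "(z, w) \<in> pairing \<Longrightarrow> q z = q w"
  using glue[of z w] pairing_norm[of z w] by (auto simp: polygon_gluing_def)

lemma pairing_chart:
  assumes "(z, w) \<in> pairing" "i \<in> charts" "z \<in> chart i"
  shows "w \<in> chart i" "t \<in> {0..1} \<Longrightarrow> q (C i t z) = q (C i t w)"
proof -
  have *: "z \<in> chart i \<and> w \<in> chart i \<and> (\<forall>t\<in>{0..1}. (C i t z, C i t w) \<in> side_pairing g)"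
    if zw: "(z, w) \<in> side_pairing g" and zw': "z \<in> chart i \<or> w \<in> chart i" for z w
  proof -
    have n: "norm z = 1" "norm w = 1" using pairing_norm[of z w] zw by auto
    obtain m x where m: "m mod 4 < 2" "m < 4 * g" "x \<in> {0..1}" "z = \<beta> (real m + x)" "w = \<beta> (real m + 3 - x)"
      using zw by (rule side_pairingE)
    obtain d d' where d: "d \<in> corners i" "d' \<in> corners i" "z \<in> cell i d" "w \<in> cell i d'"
      "\<forall>t\<in>{0..1}. (contr i d t z, contr i d' t w) \<in> side_pairing g"
      using pairing_charts[OF m(1-3) assms(2)] zw' m(4,5) by blast
    then show ?thesis using n by (auto simp: chart_def C_def which_eq[OF assms(2)])
  qed
  show "w \<in> chart i" using *[of z w] *[of w z] assms by auto
  show "q (C i t z) = q (C i t w)" if "t \<in> {0..1}"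
    using *[of z w] *[of w z] assms that q_pairing[of "C i t z" "C i t w"] q_pairing[of "C i t w" "C i t z"] by auto
qed

lemma gluing_chart:
  assumes "(z, w) \<in> polygon_gluing g" "i \<in> charts" "z \<in> chart i"
  shows "w \<in> chart i \<and> (\<forall>t\<in>{0..1}. q (C i t z) = q (C i t w))"
  using assms(1) unfolding polygon_gluing_def
proof (induction rule: rtrancl_induct)
  case (step y w)
  then show ?case using pairing_chart[OF step(2) assms(2)] by auto
qed (use assms in auto)

lemma chart_cball: "z \<in> chart i \<Longrightarrow> z \<in> cball 0 1"
  by (simp add: chart_def)

definition U :: "nat \<Rightarrow> 'a set"
  where "U i = q ` chart i"

lemma U_iff: "i \<in> charts \<Longrightarrow> z \<in> cball 0 1 \<Longrightarrow> q z \<in> U i \<longleftrightarrow> z \<in> chart i"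
  unfolding U_def using glue gluing_chart chart_cball by (metis (no_types, lifting) image_iff)

lemma openin_saturated:
  assumes "openin (top_of_set (cball 0 1)) A" "\<And>z w. (z, w) \<in> polygon_gluing g \<Longrightarrow> z \<in> A \<Longrightarrow> w \<in> A"
  shows "openin (top_of_set S) (q ` A)"
proof -
  have A: "A \<subseteq> cball 0 1" using assms(1) by (rule openin_imp_subset)
  have "{z \<in> cball 0 1. q z \<in> q ` A} = A"
  proof (intro equalityI subsetI)
    fix z assume "z \<in> {z \<in> cball 0 1. q z \<in> q ` A}"
    then obtain w where "z \<in> cball 0 1" "w \<in> A" "q w = q z" by auto
    then show "z \<in> A" using glue[of w z] A assms(2) by auto
  qed (use A in auto)
  moreover have "q ` A \<subseteq> S" using A q_image by blast
  moreover have "openin (top_of_set (cball 0 1)) {z \<in> cball 0 1. q z \<in> B} = openin (top_of_set S) B" if "B \<subseteq> S" for B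
    using quo that unfolding quotient_map_def by simp
  ultimately show ?thesis using assms(1) by metis
qed

lemma openin_U: "i \<in> charts \<Longrightarrow> openin (top_of_set S) (U i)"
  unfolding U_def by (rule openin_saturated[OF openin_chart]) (use gluing_chart in blast)

lemma U_subset: "i \<in> charts \<Longrightarrow> U i \<subseteq> S"
  using openin_U openin_imp_subset by blast

lemma U_cover: "S \<subseteq> (\<Union>i\<in>charts. U i)"
proof
  fix y assume "y \<in> S"
  then obtain z where "z \<in> cball 0 1" "y = q z" using q_image by blast
  then show "y \<in> (\<Union>i\<in>charts. U i)" using chart_cover[of z] by (auto simp: U_def)
qed

lemma q_side:
  assumes "m mod 4 < 2" "m < 4 * g" "x \<in> {0..1}"
  shows "q (\<beta> (real m + x)) = q (\<beta> (real m + 3 - x))"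
  by (rule q_pairing) (use side_pairingI[OF assms] in blast)

text \<open>In the block of four sides starting at 4k, the end points of the glued sides link the
  vertices in the chain 4k, 4k + 3, 4k + 2, 4k + 1, 4k + 4, and consecutive blocks share a
  vertex.\<close>

lemma q_vertex: "n \<le> 4 * g \<Longrightarrow> q (\<beta> (real n)) = q 1"
proof -
  have four: "q (\<beta> (real (4 * k))) = q 1" if "k \<le> g" for k
    using that
  proof (induction k)
    case (Suc k)
    have m: "(4 * k) mod 4 < (2 :: nat)" "(4 * k + 1) mod 4 < (2 :: nat)" "4 * k < 4 * g" "4 * k + 1 < 4 * g"
      using Suc.prems mod_mult_self4[of 4 k 1] by auto
    have "q (\<beta> (real (4 * k + 1) + 0)) = q (\<beta> (real (4 * k + 1) + 3 - 0))" by (rule q_side) (use m in auto)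
    moreover have "q (\<beta> (real (4 * k + 1) + 1)) = q (\<beta> (real (4 * k + 1) + 3 - 1))" by (rule q_side) (use m in auto)
    moreover have "q (\<beta> (real (4 * k) + 0)) = q (\<beta> (real (4 * k) + 3 - 0))" by (rule q_side) (use m in auto)
    moreover have "q (\<beta> (real (4 * k) + 1)) = q (\<beta> (real (4 * k) + 3 - 1))" by (rule q_side) (use m in auto)
    ultimately show ?case using Suc by (simp add: algebra_simps)
  qed simp
  assume n: "n \<le> 4 * g"
  define k r where "k = n div 4" and "r = n mod 4"
  have nk: "n = 4 * k + r" "r < 4" by (auto simp: k_def r_def)
  show ?thesis
  proof (cases "r = 0")
    case False
    then have kg: "k < g" using nk n by linarith
    have m: "(4 * k) mod 4 < (2 :: nat)" "(4 * k + 1) mod 4 < (2 :: nat)" "4 * k < 4 * g" "4 * k + 1 < 4 * g"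
      using kg mod_mult_self4[of 4 k 1] by auto
    have "q (\<beta> (real (4 * k + 1) + 1)) = q (\<beta> (real (4 * k + 1) + 3 - 1))" by (rule q_side) (use m in auto)
    moreover have "q (\<beta> (real (4 * k) + 0)) = q (\<beta> (real (4 * k) + 3 - 0))" by (rule q_side) (use m in auto)
    moreover have "q (\<beta> (real (4 * k) + 1)) = q (\<beta> (real (4 * k) + 3 - 1))" by (rule q_side) (use m in auto)
    moreover have "q (\<beta> (real (4 * k))) = q 1" using four kg by simp
    moreover have "r = 1 \<or> r = 2 \<or> r = 3" using False nk by linarith
    ultimately show ?thesis using nk by (auto simp: algebra_simps)
  qed (use four nk n in simp)
qed

lemma q_ctr:
  assumes "i \<in> charts" "d \<in> corners i" "d' \<in> corners i" shows "q (ctr i d) = q (ctr i d')"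
proof -
  have "q (ctr i d) = q (ctr i d')" if "i \<ge> 2"
  proof -
    let ?m = "first_side (i - 2)"
    have "i - 2 < 2 * g" using assms(1) g unfolding lessThan_iff by linarith
    then have "q (\<beta> (real ?m + 1/2)) = q (\<beta> (real ?m + 3 - 1/2))"
      using first_side_mod first_side_less[of "i - 2"] by (intro q_side) auto
    moreover have "real ?m + 3 - 1/2 = real (?m + 2) + 1/2" by simp
    ultimately show ?thesis using assms that by (auto simp: corners_def ctr_def)
  qed
  moreover have "q (ctr 1 d) = q (ctr 1 d')" if "i = 1"
    using that assms q_vertex[of d] q_vertex[of d'] by (auto simp: corners_def ctr_def)
  ultimately show ?thesis using assms by (cases "i = 0"; cases "i = 1") auto
qed

definition centre :: "nat \<Rightarrow> 'a"
  where "centre i = q (ctr i (SOME d. d \<in> corners i))"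

lemma centre: "i \<in> charts \<Longrightarrow> d \<in> corners i \<Longrightarrow> q (ctr i d) = centre i"
  unfolding centre_def using q_ctr someI_ex[of "\<lambda>d. d \<in> corners i"] by blast

lemma quotient_chart: "i \<in> charts \<Longrightarrow> quotient_map (top_of_set (chart i)) (top_of_set (U i)) q"
proof -
  assume i: "i \<in> charts"
  have "{z \<in> topspace (top_of_set (cball 0 1)). q z \<in> U i} = chart i" using U_iff[OF i] chart_cball by auto
  from quotient_map_restriction[OF quo this] openin_U[OF i] show ?thesis
    using chart_cball U_subset[OF i] by (simp add: subtopology_subtopology inf.absorb2 subset_iff Int_absorb1)
qed

text \<open>\<open>C i\<close> respects the gluing and so induces a map on \<open>U i\<close>. Its
  continuity can be tested upstairs because the product of a quotient map with the compact interval
  is again a quotient map.\<close>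

lemma contractible_U:
  assumes i: "i \<in> charts" shows "contractible (U i)"
proof -
  let ?T = "top_of_set {0..1::real}" and ?X = "top_of_set (chart i)" and ?Y = "top_of_set (U i)"
  define h where "h = (\<lambda>(t, y). q (C i t (SOME z. z \<in> chart i \<and> q z = y)))"
  have h: "h (t, q z) = q (C i t z)" if "t \<in> {0..1}" "z \<in> chart i" for t z
  proof -
    have ex: "\<exists>w. w \<in> chart i \<and> q w = q z" using that by blast
    let ?w = "SOME w. w \<in> chart i \<and> q w = q z"
    from someI_ex[OF ex] have w: "?w \<in> chart i" "q ?w = q z" by auto
    then have "(?w, z) \<in> polygon_gluing g" using glue[of ?w z] that chart_cball by auto
    then show ?thesis using gluing_chart[OF _ i w(1)] that by (simp add: h_def)
  qed
  have "quotient_map (prod_topology ?T ?X) (prod_topology ?T ?Y) (\<lambda>(t, z). (t, q z))"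
    by (rule quotient_map_prod_right[OF _ _ quotient_chart[OF i]])
      (auto simp: Hausdorff_space_subtopology intro!: compact_imp_locally_compact_space compact_space_subtopology)
  moreover have "continuous_map (prod_topology ?T ?X) ?Y (h \<circ> (\<lambda>(t, z). (t, q z)))"
  proof (rule continuous_map_eq)
    have "continuous_on ({0..1} \<times> chart i) (\<lambda>p. q (case p of (t, z) \<Rightarrow> C i t z))"
      by (rule continuous_on_compose2[OF q_cont C_cont[OF i]])
        (use chart_cball[OF C_chart[OF i]] in auto)
    moreover have "(\<lambda>p. q (case p of (t, z) \<Rightarrow> C i t z)) ` ({0..1} \<times> chart i) \<subseteq> U i"
      using C_chart[OF i] by (auto simp: U_def)
    ultimately show "continuous_map (prod_topology ?T ?X) ?Y (\<lambda>p. q (case p of (t, z) \<Rightarrow> C i t z))"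
      by (simp add: prod_topology_subtopology[symmetric] euclidean_product_topology[symmetric]
          subtopology_Times[symmetric] prod_topology_euclidean image_subset_iff_funcset)
  qed (auto simp: h)
  ultimately have cont: "continuous_map (prod_topology ?T ?Y) ?Y h"
    using continuous_compose_quotient_map by blast
  have h0: "h (0, y) = y" and h1: "h (1, y) = centre i" if y: "y \<in> U i" for y
  proof -
    obtain z where z: "z \<in> chart i" "y = q z" using y by (auto simp: U_def)
    show "h (0, y) = y" using h[of 0 z] z C_0[OF i] by simp
    show "h (1, y) = centre i" using h[of 1 z] z C_1 centre[OF i] chart_which(1)[OF i] by simp
  qed
  have "homotopic_with_canon (\<lambda>x. True) (U i) (U i) id (\<lambda>x. centre i)"
    unfolding homotopic_with_def
  \<comment> \<open>The end conditions of a homotopy are stated for all points of the type, so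
    outside \<open>U i\<close> it is given values that satisfy them.\<close>
  proof (intro exI[of _ "\<lambda>(t, y). if y \<in> U i then h (t, y) else if t = 0 then y else centre i"] conjI allI ballI TrueI)
    show "continuous_map (prod_topology ?T ?Y) ?Y (\<lambda>(t, y). if y \<in> U i then h (t, y) else if t = 0 then y else centre i)"
      by (rule continuous_map_eq[OF cont]) auto
  qed (auto simp: h0 h1)
  then show ?thesis by (auto simp: contractible_def)
qed

lemma simply_connected_U: "i \<in> charts \<Longrightarrow> simply_connected (U i)"
  using contractible_U contractible_imp_simply_connected by blast

lemma path_connected_S: "path_connected S"
  using path_connected_continuous_image[OF q_cont] convex_imp_path_connected[OF convex_cball] q_image by metis

lemma hp_U:
  assumes "i \<in> charts" "path_in (U i) p" "path_in (U i) p'" "pathstart p = pathstart p'" "pathfinish p = pathfinish p'"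
  shows "homotopic_paths S p p'"
proof -
  have "homotopic_paths (U i) p p'"
    using simply_connected_U[OF assms(1)] assms unfolding simply_connected_eq_homotopic_paths path_in_def
    by metis
  then show ?thesis by (rule homotopic_paths_subset[OF _ U_subset[OF assms(1)]])
qed

end

section \<open>Potentials read off from the boundary word\<close>

definition side_elt :: "('h, 'm) monoid_scheme \<Rightarrow> (nat \<Rightarrow> 'h) \<Rightarrow> (nat \<Rightarrow> 'h) \<Rightarrow> nat \<Rightarrow> 'h"
  where "side_elt H a b n =
    (let c = (if even n then a (n div 4) else b (n div 4)) in if n mod 4 < 2 then c else inv\<^bsub>H\<^esub> c)"

text \<open>The boundary word a, b, inverse of a, inverse of b, and so on, evaluated in
  \<open>H\<close> up to vertex \<open>n\<close>.\<close>

primrec vertex_elt :: "('h, 'm) monoid_scheme \<Rightarrow> (nat \<Rightarrow> 'h) \<Rightarrow> (nat \<Rightarrow> 'h) \<Rightarrow> nat \<Rightarrow> 'h"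
  where "vertex_elt H a b 0 = \<one>\<^bsub>H\<^esub>"
  | "vertex_elt H a b (Suc n) = vertex_elt H a b n \<otimes>\<^bsub>H\<^esub> side_elt H a b n"

text \<open>For an edge chart both glued sides refer to the start of the edge. On the second side,
  which is traversed backwards, that is the end vertex \<open>Suc d\<close>.\<close>

definition pot :: "('h, 'm) monoid_scheme \<Rightarrow> (nat \<Rightarrow> 'h) \<Rightarrow> (nat \<Rightarrow> 'h) \<Rightarrow> nat \<Rightarrow> nat \<Rightarrow> 'h"
  where "pot H a b i d = (if i = 0 then \<one>\<^bsub>H\<^esub> else if i = 1 then vertex_elt H a b d
    else vertex_elt H a b (if d mod 4 < 2 then d else Suc d))"

lemma mod4_plus2:
  assumes "m mod 4 < (2 :: nat)"
  shows "Suc (Suc m) mod 4 = m mod 4 + 2" "Suc (Suc m) div 4 = m div 4"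
proof -
  have "Suc (Suc m) = 4 * (m div 4) + (m mod 4 + 2)" using mult_div_mod_eq[of 4 m] by linarith
  moreover have "(4 * (m div 4) + (m mod 4 + 2)) mod 4 = m mod 4 + 2"
    "(4 * (m div 4) + (m mod 4 + 2)) div 4 = m div 4"
    using assms by (simp_all only: mod_mult_self4 div_mult_self4) simp_all
  ultimately show "Suc (Suc m) mod 4 = m mod 4 + 2" "Suc (Suc m) div 4 = m div 4" by simp_all
qed

context
  fixes H :: "('h, 'm) monoid_scheme" and a b :: "nat \<Rightarrow> 'h" and g :: nat
  assumes H: "group H" and ab: "\<And>k. k < g \<Longrightarrow> a k \<in> carrier H \<and> b k \<in> carrier H"
begin

interpretation H: group H by (rule H)

lemma side_elt_carrier: "n < 4 * g \<Longrightarrow> side_elt H a b n \<in> carrier H"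
  using ab[of "n div 4"] by (auto simp: side_elt_def Let_def)

lemma side_elt_inv: "m mod 4 < 2 \<Longrightarrow> side_elt H a b (Suc (Suc m)) = inv\<^bsub>H\<^esub> side_elt H a b m"
  by (simp add: side_elt_def mod4_plus2)

lemma vertex_elt_carrier: "n \<le> 4 * g \<Longrightarrow> vertex_elt H a b n \<in> carrier H"
  by (induction n) (auto intro!: H.m_closed side_elt_carrier)

lemma vertex_elt_commutators: "k \<le> g \<Longrightarrow> vertex_elt H a b (4 * k) = commutator_prod H a b k"
proof (induction k)
  case (Suc k)
  have s: "side_elt H a b (4 * k) = a k" "side_elt H a b (Suc (4 * k)) = b k"
  proof -
    have "(4 * k + 1) mod 4 = 1 mod (4 :: nat)" "(4 * k + 1) div 4 = k" by (rule mod_mult_self4) simp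
    then show "side_elt H a b (4 * k) = a k" "side_elt H a b (Suc (4 * k)) = b k"
      by (simp_all add: side_elt_def)
  qed
  have s': "side_elt H a b (Suc (Suc (4 * k))) = inv\<^bsub>H\<^esub> a k" "side_elt H a b (Suc (Suc (Suc (4 * k)))) = inv\<^bsub>H\<^esub> b k"
  proof -
    have "(4 * k + 1) mod 4 = 1 mod (4 :: nat)" by (rule mod_mult_self4)
    then have "(4 * k) mod 4 < (2 :: nat)" "Suc (4 * k) mod 4 < (2 :: nat)" by simp_all
    then show "side_elt H a b (Suc (Suc (4 * k))) = inv\<^bsub>H\<^esub> a k"
      "side_elt H a b (Suc (Suc (Suc (4 * k)))) = inv\<^bsub>H\<^esub> b k"
      by (simp_all only: side_elt_inv s)
  qed
  have "4 * Suc k = Suc (Suc (Suc (Suc (4 * k))))" by simp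
  moreover have "a k \<in> carrier H" "b k \<in> carrier H" using ab[of k] Suc.prems by auto
  moreover have "commutator_prod H a b k \<in> carrier H" using vertex_elt_carrier[of "4 * k"] Suc by simp
  ultimately show ?case using Suc by (simp only: vertex_elt.simps s s') (simp add: commutator_def H.m_assoc)
qed simp

lemma pot_carrier: "d < 4 * g \<Longrightarrow> pot H a b i d \<in> carrier H"
  by (auto simp: pot_def intro!: vertex_elt_carrier simp del: vertex_elt.simps)

text \<open>The left factor depends on the pair of sides but not on the chart, so it drops out of
  differences of potentials. The relation enters when m + 3 = 4g, where the boundary word has to
  close up.\<close>

lemma pot_pair:
  assumes m: "m mod 4 < 2" "m < 4 * g" and rel: "commutator_prod H a b g = \<one>\<^bsub>H\<^esub>"
    and d: "i = 1 \<and> d = m \<and> d' = (m + 3) mod (4 * g) \<or> i = 1 \<and> d = m + 1 \<and> d' = m + 2 \<or> i \<ge> 2 \<and> d = m \<and> d' = m + 2"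
  shows "pot H a b i d' = vertex_elt H a b (m + 3) \<otimes>\<^bsub>H\<^esub> inv\<^bsub>H\<^esub> vertex_elt H a b m \<otimes>\<^bsub>H\<^esub> pot H a b i d"
proof -
  have "m div 4 < g" using m(2) by simp
  then have m3: "m + 3 \<le> 4 * g" using m(1) mult_div_mod_eq[of 4 m] by linarith
  let ?v = "vertex_elt H a b"
  have c: "?v m \<in> carrier H" "?v (Suc m) \<in> carrier H" "?v (m + 2) \<in> carrier H" "?v (m + 3) \<in> carrier H"
    "side_elt H a b m \<in> carrier H"
    using m3 by (auto intro!: vertex_elt_carrier side_elt_carrier simp del: vertex_elt.simps)
  consider "i = 1" "d = m" "d' = (m + 3) mod (4 * g)" | "i = 1" "d = m + 1" "d' = m + 2" | "i \<ge> 2" "d = m" "d' = m + 2"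
    using d by blast
  then show ?thesis
  proof cases
    case 1
    have "?v ((m + 3) mod (4 * g)) = ?v (m + 3)"
    proof (cases "m + 3 = 4 * g")
      case True
      then show ?thesis using vertex_elt_commutators[of g] rel by simp
    qed (use m3 in simp)
    then show ?thesis using 1 c by (simp add: pot_def H.m_assoc)
  next
    case 2
    have "?v (m + 3) = ?v (m + 2) \<otimes>\<^bsub>H\<^esub> inv\<^bsub>H\<^esub> side_elt H a b m"
      using side_elt_inv[OF m(1)] by (simp add: numeral_3_eq_3 numeral_2_eq_2)
    moreover have "?v (Suc m) = ?v m \<otimes>\<^bsub>H\<^esub> side_elt H a b m" by simp
    ultimately show ?thesis using 2 c
      by (simp add: pot_def H.m_assoc H.inv_cancel_left del: vertex_elt.simps)
  next
    case 3
    then show ?thesis using c m mod4_plus2[OF m(1)]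
      by (simp add: pot_def H.m_assoc numeral_3_eq_3 numeral_2_eq_2 del: vertex_elt.simps)
  qed
qed

end

text \<open>The two potentials are the same word in corresponding generators, and a subgroup of the
  product contains all such pairs once it contains the generators.\<close>

lemma pot_subgroup:
  assumes H: "group H" and H': "group H'" and Z: "subgroup Z (H \<times>\<times> H')"
    and ab: "\<And>k. k < g \<Longrightarrow> (a k, a' k) \<in> Z \<and> (b k, b' k) \<in> Z"
    and d: "d < 4 * g"
  shows "(pot H a b i d, pot H' a' b' i d) \<in> Z"
proof -
  interpret Z: subgroup Z "H \<times>\<times> H'" by (rule Z)
  have inv: "(inv\<^bsub>H\<^esub> x, inv\<^bsub>H'\<^esub> y) \<in> Z" if "(x, y) \<in> Z" for x y
  proof -
    have "x \<in> carrier H" "y \<in> carrier H'" using Z.mem_carrier[OF that] by auto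
    then show ?thesis using Z.m_inv_closed[OF that] by (simp add: inv_DirProd[OF H H'])
  qed
  have s: "(side_elt H a b n, side_elt H' a' b' n) \<in> Z" if "n < 4 * g" for n
    using ab[of "n div 4"] that inv by (auto simp: side_elt_def Let_def)
  have v: "(vertex_elt H a b n, vertex_elt H' a' b' n) \<in> Z" if "n \<le> 4 * g" for n
    using that
  proof (induction n)
    case (Suc n)
    then have "(vertex_elt H a b n, vertex_elt H' a' b' n) \<otimes>\<^bsub>H \<times>\<times> H'\<^esub> (side_elt H a b n, side_elt H' a' b' n) \<in> Z"
      by (intro Z.m_closed s) auto
    then show ?case by simp
  qed (use Z.one_closed in simp)
  show ?thesis using d v[of d] v[of "Suc d"] v[of 0] by (auto simp: pot_def)
qed

context polygon_surface begin

definition rep :: "'a \<Rightarrow> complex"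
  where "rep y = (SOME z. z \<in> cball 0 1 \<and> q z = y)"

definition jump :: "('h, 'm) monoid_scheme \<Rightarrow> (nat \<Rightarrow> 'h) \<Rightarrow> (nat \<Rightarrow> 'h) \<Rightarrow> nat \<Rightarrow> nat \<Rightarrow> complex \<Rightarrow> 'h"
  where "jump H a b i j z = inv\<^bsub>H\<^esub> pot H a b i (which i z) \<otimes>\<^bsub>H\<^esub> pot H a b j (which j z)"

context
  fixes H :: "('h, 'm) monoid_scheme" and a b :: "nat \<Rightarrow> 'h"
  assumes H: "group H" and ab: "\<And>k. k < g \<Longrightarrow> a k \<in> carrier H \<and> b k \<in> carrier H"
    and rel: "commutator_prod H a b g = \<one>\<^bsub>H\<^esub>"
begin

interpretation H: group H by (rule H)

lemma pot_which_carrier: "i \<in> charts \<Longrightarrow> z \<in> chart i \<Longrightarrow> pot H a b i (which i z) \<in> carrier H"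
  by (rule pot_carrier[OF H ab corners_less]) (auto intro: chart_which)

text \<open>Passing to the glued point multiplies the potentials of both charts on the left by the
  same element, which cancels in the quotient.\<close>

lemma jump_pairing:
  assumes "(z, w) \<in> side_pairing g" "i \<in> charts" "j \<in> charts" "z \<in> chart i \<and> z \<in> chart j \<or> w \<in> chart i \<and> w \<in> chart j"
  shows "jump H a b i j z = jump H a b i j w"
proof -
  obtain m x where m: "m mod 4 < 2" "m < 4 * g" "x \<in> {0..1}" "z = \<beta> (real m + x)" "w = \<beta> (real m + 3 - x)"
    using assms(1) by (rule side_pairingE)
  let ?c = "vertex_elt H a b (m + 3) \<otimes>\<^bsub>H\<^esub> inv\<^bsub>H\<^esub> vertex_elt H a b m"
  have "m div 4 < g" using m(2) by simp
  then have m3: "m + 3 \<le> 4 * g" using m(1) mult_div_mod_eq[of 4 m] by linarith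
  have c: "?c \<in> carrier H" using m3 by (intro H.m_closed H.inv_closed vertex_elt_carrier[OF H ab]) auto
  have *: "pot H a b l (which l w) = ?c \<otimes>\<^bsub>H\<^esub> pot H a b l (which l z) \<and> pot H a b l (which l z) \<in> carrier H"
    if l: "l \<in> charts" "z \<in> chart l \<or> w \<in> chart l" for l
  proof -
    have nz: "z \<in> cball 0 1" "w \<in> cball 0 1" using m(4,5) by auto
    obtain d d' where d: "d \<in> corners l" "d' \<in> corners l" "z \<in> cell l d" "w \<in> cell l d'"
      "l = 1 \<and> d = m \<and> d' = (m + 3) mod (4 * g) \<or> l = 1 \<and> d = m + 1 \<and> d' = m + 2 \<or> l \<ge> 2 \<and> d = m \<and> d' = m + 2"
      using pairing_charts[OF m(1-3) l(1)] l(2) m(4,5) by blast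
    then have wd: "which l z = d" "which l w = d'" using which_eq[OF l(1)] by auto
    have "z \<in> chart l" using d nz by (auto simp: chart_def)
    from pot_which_carrier[OF l(1) this] show ?thesis
      using pot_pair[OF H ab m(1,2) rel d(5)] unfolding wd by simp
  qed
  show ?thesis
    using *[of i] *[of j] assms c unfolding jump_def
    by (auto simp: H.inv_mult_group H.m_assoc H.inv_cancel_left simp del: vertex_elt.simps)
qed

lemma jump_gluing:
  assumes "(z, w) \<in> polygon_gluing g" and ij: "i \<in> charts" "j \<in> charts" and z: "z \<in> chart i" "z \<in> chart j"
  shows "jump H a b i j z = jump H a b i j w"
  using assms(1) unfolding polygon_gluing_def
proof (induction rule: rtrancl_induct)
  case (step y w)
  have "(z, y) \<in> polygon_gluing g" using step(1) by (simp add: polygon_gluing_def)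
  then have "y \<in> chart i" "y \<in> chart j" using gluing_chart[OF _ ij(1) z(1)] gluing_chart[OF _ ij(2) z(2)] by blast+
  then have "jump H a b i j y = jump H a b i j w"
    using step(2) jump_pairing[OF _ ij, of y w] jump_pairing[OF _ ij, of w y] by auto
  then show ?case using step(3) by simp
qed simp

lemma jump_rep:
  assumes "i \<in> charts" "j \<in> charts" "z \<in> chart i" "z \<in> chart j"
  shows "jump H a b i j (rep (q z)) = jump H a b i j z"
proof -
  have "\<exists>w. w \<in> cball 0 1 \<and> q w = q z" using assms chart_cball by blast
  from someI_ex[OF this] have "rep (q z) \<in> cball 0 1" "q (rep (q z)) = q z" by (auto simp: rep_def)
  then have "(z, rep (q z)) \<in> polygon_gluing g" using glue[of z "rep (q z)"] assms chart_cball by auto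
  then show ?thesis using jump_gluing assms by metis
qed

text \<open>Differences of potentials satisfy the cocycle rule automatically, and
  \<open>jump_gluing\<close> makes them independent of the preimage chosen by \<open>rep\<close>.
  What takes work is local constancy on the quotient.\<close>

lemma local_system_jump: "local_system S charts U H (\<lambda>i j y. jump H a b i j (rep y))"
proof
  have U: "\<exists>z. z \<in> chart i \<and> z \<in> chart j \<and> y = q z"
    if "i \<in> charts" "j \<in> charts" "y \<in> U i" "y \<in> U j" for i j y
  proof -
    obtain z where z: "z \<in> chart i" "y = q z" using \<open>y \<in> U i\<close> by (auto simp: U_def)
    then show ?thesis using U_iff[OF \<open>j \<in> charts\<close>, of z] \<open>y \<in> U j\<close> chart_cball by blast
  qed
  show "openin (top_of_set S) (U i)" if "i \<in> charts" for i by (rule openin_U[OF that])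
  show "S \<subseteq> (\<Union>i\<in>charts. U i)" by (rule U_cover)
  show "jump H a b i j (rep y) \<in> carrier H"
    if ij: "i \<in> charts" "j \<in> charts" "y \<in> U i" "y \<in> U j" for i j y
  proof -
    obtain z where z: "z \<in> chart i" "z \<in> chart j" "y = q z" using U[OF ij] by blast
    show ?thesis unfolding z(3) jump_rep[OF ij(1,2) z(1,2)]
      using ij z by (simp add: jump_def pot_which_carrier)
  qed
  show "jump H a b i i (rep y) = \<one>\<^bsub>H\<^esub>" if i: "i \<in> charts" "y \<in> U i" for i y
  proof -
    obtain z where z: "z \<in> chart i" "y = q z" using U[OF i(1,1,2,2)] by blast
    show ?thesis unfolding z(2) jump_rep[OF i(1,1) z(1,1)]
      using i z by (simp add: jump_def pot_which_carrier)
  qed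
  show "jump H a b i k (rep y) = jump H a b i j (rep y) \<otimes>\<^bsub>H\<^esub> jump H a b j k (rep y)"
    if ijk: "i \<in> charts" "j \<in> charts" "k \<in> charts" "y \<in> U i" "y \<in> U j" "y \<in> U k" for i j k y
  proof -
    obtain z where z: "z \<in> chart i" "z \<in> chart j" "y = q z" using U[of i j y] ijk by blast
    have "z \<in> chart k" using U_iff[OF ijk(3)] ijk(6) z chart_cball by blast
    with ijk z show ?thesis
      unfolding z(3) jump_rep[OF ijk(1,2) z(1,2)] jump_rep[OF ijk(1,3) z(1) \<open>z \<in> chart k\<close>]
        jump_rep[OF ijk(2,3) z(2) \<open>z \<in> chart k\<close>]
      by (simp add: jump_def pot_which_carrier H.m_assoc H.inv_cancel_left)
  qed
  show "\<exists>O'. openin (top_of_set S) O' \<and> y \<in> O' \<and> O' \<subseteq> U i \<inter> U j \<and>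
      (\<forall>y'\<in>O'. jump H a b i j (rep y') = jump H a b i j (rep y))"
    if ij: "i \<in> charts" "j \<in> charts" "y \<in> U i" "y \<in> U j" for i j y
  proof -
    obtain z where z: "z \<in> chart i" "z \<in> chart j" "y = q z" using U[OF ij] by blast
    \<comment> \<open>This set is open in the disc, since on the intersection of two cells the
      corners are fixed, and it is saturated, so its image is open in S.\<close>
    define A where "A = {w. w \<in> chart i \<and> w \<in> chart j \<and> jump H a b i j w = jump H a b i j z}"
    have "openin (top_of_set (cball 0 1)) A"
    proof (subst openin_subopen, intro ballI)
      fix w assume w: "w \<in> A"
      let ?B = "cball 0 1 \<inter> (cell i (which i w) \<inter> cell j (which j w))"
      have wi: "which i w \<in> corners i" "w \<in> cell i (which i w)" "which j w \<in> corners j" "w \<in> cell j (which j w)"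
        using w ij by (auto simp: A_def intro: chart_which)
      have "?B \<subseteq> A"
      proof
        fix v assume v: "v \<in> ?B"
        have "which i v = which i w" by (rule which_eq[OF ij(1) wi(1)]) (use v in blast)
        moreover have "which j v = which j w" by (rule which_eq[OF ij(2) wi(3)]) (use v in blast)
        moreover have "v \<in> chart i" "v \<in> chart j" using v wi unfolding chart_def by blast+
        ultimately
        show "v \<in> A" using w by (simp add: A_def jump_def)
      qed
      moreover have "openin (top_of_set (cball 0 1)) ?B" by (intro openin_open_Int open_Int open_cell)
      moreover have "w \<in> ?B" using w wi chart_cball by (auto simp: A_def)
      ultimately show "\<exists>T. openin (top_of_set (cball 0 1)) T \<and> w \<in> T \<and> T \<subseteq> A" by blast
    qed
    then have "openin (top_of_set S) (q ` A)"
    proof (rule openin_saturated)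
      fix v w assume vw: "(v, w) \<in> polygon_gluing g" "v \<in> A"
      then show "w \<in> A" using gluing_chart[OF vw(1) ij(1)] gluing_chart[OF vw(1) ij(2)] jump_gluing[OF vw(1) ij(1,2)]
        by (auto simp: A_def)
    qed
    moreover have "y \<in> q ` A" using z by (auto simp: A_def)
    moreover have "q ` A \<subseteq> U i \<inter> U j" by (auto simp: A_def U_def)
    moreover have "\<forall>y'\<in>q ` A. jump H a b i j (rep y') = jump H a b i j (rep y)"
    proof
      fix y' assume "y' \<in> q ` A"
      then obtain w where "w \<in> A" "y' = q w" by blast
      then show "jump H a b i j (rep y') = jump H a b i j (rep y)"
        using jump_rep[OF ij(1,2)] z by (simp add: A_def)
    qed
    ultimately show ?thesis by blast
  qed
qed

end

section \<open>The side classes in the fundamental group and the tautological local system\<close>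

sublocale based_space S "q 1"
  by unfold_locales (use q_image path_connected_S in auto)

lemma path_in_q: "path_in (cball 0 1) r \<Longrightarrow> path_in S (q \<circ> r)"
  using path_continuous_image[of r q] continuous_on_subset[OF q_cont, of "path_image r"] q_image
  by (auto simp: path_in_def path_image_compose)

definition Ez :: "complex \<Rightarrow> (real \<Rightarrow> 'a) set"
  where "Ez z = br (q \<circ> linepath 0 z)"

lemma linepath_cball: "z \<in> cball 0 1 \<Longrightarrow> w \<in> cball 0 1 \<Longrightarrow> path_in (cball 0 1) (linepath z w)" for z w :: complex
  using closed_segment_subset[of z "cball 0 1" w] by (auto simp: path_in_def)

lemma Ez_carrier: "z \<in> cball 0 1 \<Longrightarrow> Ez z \<in> carrier FG"
  unfolding Ez_def by (intro br_carrier path_in_q linepath_cball) auto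

text \<open>The disc is simply connected, so a path in it may be replaced by the two radii to its
  end points.\<close>

lemma br_q:
  assumes r: "path_in (cball 0 1) r"
  shows "br (q \<circ> r) = inv\<^bsub>FG\<^esub> Ez (pathstart r) \<otimes>\<^bsub>FG\<^esub> Ez (pathfinish r)"
proof -
  let ?l = "linepath 0 (pathstart r)" and ?l' = "linepath 0 (pathfinish r)"
  have e: "pathstart r \<in> cball 0 1" "pathfinish r \<in> cball 0 1" using path_in_endpoints[OF r] by auto
  have l: "path_in (cball 0 1) ?l" "path_in (cball 0 1) ?l'" using e by (auto intro: linepath_cball)
  have j: "path_in (cball 0 1) (?l +++ r)" using l r by simp
  have "simply_connected (cball 0 1 :: complex set)" by (simp add: convex_imp_simply_connected)
  then have "homotopic_paths (cball 0 1) (?l +++ r) ?l'"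
    using j l unfolding simply_connected_eq_homotopic_paths path_in_def by auto
  then have "hp (q \<circ> (?l +++ r)) (q \<circ> ?l')"
    by (rule homotopic_paths_continuous_image[OF _ q_cont]) (use q_image in auto)
  from br_cong[OF this] have "Ez (pathfinish r) = br ((q \<circ> ?l) +++ (q \<circ> r))"
    by (simp add: Ez_def path_compose_join)
  also have "\<dots> = Ez (pathstart r) \<otimes>\<^bsub>FG\<^esub> br (q \<circ> r)"
    unfolding Ez_def using path_in_q l r by (intro br_mult) (auto simp: pathfinish_compose pathstart_compose)
  finally show ?thesis using br_carrier[OF path_in_q[OF r]] Ez_carrier[OF e(1)]
    by (simp add: FG.inv_cancel_left)
qed

definition arc :: "real \<Rightarrow> real \<Rightarrow> real \<Rightarrow> complex"
  where "arc c d t = \<beta> (c + t * d)"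

lemma arc: "path_in (cball 0 1) (arc c d)" "pathstart (arc c d) = \<beta> c" "pathfinish (arc c d) = \<beta> (c + d)"
proof -
  have "continuous_on {0..1} (arc c d)"
    unfolding arc_def polygon_boundary_def cis_conv_exp by (intro continuous_intros)  (use g in auto)
  then show "path_in (cball 0 1) (arc c d)" by (auto simp: path_in_def path_def path_image_def arc_def)
qed (auto simp: pathstart_def pathfinish_def arc_def)

text \<open>The class of side \<open>n\<close>, expressed by radii so that products over consecutive
  sides telescope.\<close>

definition X :: "nat \<Rightarrow> (real \<Rightarrow> 'a) set"
  where "X n = inv\<^bsub>FG\<^esub> Ez (\<beta> (real n)) \<otimes>\<^bsub>FG\<^esub> Ez (\<beta> (real n + 1))"

lemma E\<beta>_carrier: "Ez (\<beta> s) \<in> carrier FG"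
  by (rule Ez_carrier) simp

text \<open>Corresponding halves of glued sides have pointwise equal images in S, hence equal
  classes. Halves are used because edge charts are centred at midpoints.\<close>

lemma half_sides:
  assumes "m mod 4 < 2" "m < 4 * g"
  shows "inv\<^bsub>FG\<^esub> Ez (\<beta> (real m)) \<otimes>\<^bsub>FG\<^esub> Ez (\<beta> (real m + 1/2))
      = inv\<^bsub>FG\<^esub> Ez (\<beta> (real m + 3)) \<otimes>\<^bsub>FG\<^esub> Ez (\<beta> (real m + 2 + 1/2))"
    and "inv\<^bsub>FG\<^esub> Ez (\<beta> (real m + 1)) \<otimes>\<^bsub>FG\<^esub> Ez (\<beta> (real m + 1/2))
      = inv\<^bsub>FG\<^esub> Ez (\<beta> (real m + 2)) \<otimes>\<^bsub>FG\<^esub> Ez (\<beta> (real m + 2 + 1/2))"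
proof -
  have 1: "br (q \<circ> arc (real m) (1/2)) = br (q \<circ> arc (real m + 3) (- 1/2))"
  proof (rule br_cong, rule homotopic_paths_eq)
    fix t :: real assume "t \<in> {0..1}"
    then show "(q \<circ> arc (real m) (1/2)) t = (q \<circ> arc (real m + 3) (- 1/2)) t"
      using q_side[OF assms, of "t / 2"] by (simp add: arc_def)
  qed (use path_in_q[OF arc(1)] in \<open>auto simp: path_in_def\<close>)
  have 2: "br (q \<circ> arc (real m + 1) (- 1/2)) = br (q \<circ> arc (real m + 2) (1/2))"
  proof (rule br_cong, rule homotopic_paths_eq)
    fix t :: real assume t: "t \<in> {0..1}"
    have eq: "real m + 1 + t * (- 1/2) = real m + (1 - t / 2)" "real m + 2 + t * (1/2) = real m + 3 - (1 - t / 2)"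
      by simp_all
    show "(q \<circ> arc (real m + 1) (- 1/2)) t = (q \<circ> arc (real m + 2) (1/2)) t"
      unfolding arc_def o_def eq by (rule q_side[OF assms]) (use t in auto)
  qed (use path_in_q[OF arc(1)] in \<open>auto simp: path_in_def\<close>)
  have e: "real m + 3 + - 1/2 = real m + 2 + 1/2" "real m + 1 + - 1/2 = real m + 1/2" by simp_all
  show "inv\<^bsub>FG\<^esub> Ez (\<beta> (real m)) \<otimes>\<^bsub>FG\<^esub> Ez (\<beta> (real m + 1/2))
      = inv\<^bsub>FG\<^esub> Ez (\<beta> (real m + 3)) \<otimes>\<^bsub>FG\<^esub> Ez (\<beta> (real m + 2 + 1/2))"
    using 1 unfolding br_q[OF arc(1)] arc(2,3) e .
  show "inv\<^bsub>FG\<^esub> Ez (\<beta> (real m + 1)) \<otimes>\<^bsub>FG\<^esub> Ez (\<beta> (real m + 1/2))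
      = inv\<^bsub>FG\<^esub> Ez (\<beta> (real m + 2)) \<otimes>\<^bsub>FG\<^esub> Ez (\<beta> (real m + 2 + 1/2))"
    using 2 unfolding br_q[OF arc(1)] arc(2,3) e .
qed

lemma X_carrier: "X n \<in> carrier FG"
  by (simp add: X_def E\<beta>_carrier)

text \<open>A side goes along its first half and back along its second. On the glued side the same
  two half classes appear in the opposite order.\<close>

lemma X_inv: assumes "m mod 4 < 2" "m < 4 * g" shows "X (Suc (Suc m)) = inv\<^bsub>FG\<^esub> X m"
proof -
  let ?y = "inv\<^bsub>FG\<^esub> Ez (\<beta> (real m)) \<otimes>\<^bsub>FG\<^esub> Ez (\<beta> (real m + 1/2))"
  let ?y' = "inv\<^bsub>FG\<^esub> Ez (\<beta> (real m + 1)) \<otimes>\<^bsub>FG\<^esub> Ez (\<beta> (real m + 1/2))"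
  have c: "?y \<in> carrier FG" "?y' \<in> carrier FG" by (simp_all add: E\<beta>_carrier)
  have "X m = ?y \<otimes>\<^bsub>FG\<^esub> inv\<^bsub>FG\<^esub> ?y'"
    by (simp add: X_def FG.inv_mult_group FG.m_assoc FG.inv_cancel_left E\<beta>_carrier)
  moreover have "X (Suc (Suc m)) = ?y' \<otimes>\<^bsub>FG\<^esub> inv\<^bsub>FG\<^esub> ?y"
  proof -
    have "real (Suc (Suc m)) = real m + 2" "real (Suc (Suc m)) + 1 = real m + 3" by simp_all
    then show ?thesis unfolding half_sides[OF assms] X_def
      by (simp only:) (simp add: FG.inv_mult_group FG.m_assoc FG.inv_cancel_left E\<beta>_carrier)
  qed
  ultimately show ?thesis using c by (simp only: FG.inv_mult_group FG.inv_inv FG.inv_closed)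
qed

abbreviation "\<alpha> \<equiv> \<lambda>k. X (4 * k)"
abbreviation "\<alpha>' \<equiv> \<lambda>k. X (Suc (4 * k))"

lemma side_elt_X: assumes n: "n < 4 * g" shows "side_elt FG \<alpha> \<alpha>' n = X n"
proof -
  have *: "side_elt FG \<alpha> \<alpha>' m = X m" if m: "m mod 4 < 2" for m
  proof -
    consider "m = 4 * (m div 4)" | "m = 4 * (m div 4) + 1"
      using m mult_div_mod_eq[of 4 m] by linarith
    then show ?thesis
    proof cases
      case 1
      then have "even m" by (metis even_mult_iff even_numeral)
      then show ?thesis using 1 m by (simp add: side_elt_def)
    next
      case 2
      then have "odd m" by (metis even_mult_iff even_numeral even_plus_one_iff)
      then show ?thesis using 2 m by (simp add: side_elt_def)
    qed
  qed
  show ?thesis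
  proof (cases "n mod 4 < 2")
    case False
    define m where "m = n - 2"
    have nm: "n = Suc (Suc m)" using False by (cases n; cases "n - 1") (auto simp: m_def)
    have m: "m mod 4 < 2"
    proof (rule ccontr)
      assume "\<not> m mod 4 < 2"
      define k r where "k = m div 4" and "r = m mod 4"
      have "m = 4 * k + r" "r < 4" "\<not> r < 2" using \<open>\<not> m mod 4 < 2\<close> by (auto simp: k_def r_def)
      then have "n = 4 * Suc k + (r - 2)" "r - 2 < 2" using nm by auto
      then have "n mod 4 = r - 2" by (simp only: mod_mult_self4) simp
      then show False using False \<open>r - 2 < 2\<close> by simp
    qed
    then have "side_elt FG \<alpha> \<alpha>' n = inv\<^bsub>FG\<^esub> X m"
      using side_elt_inv[OF FG.is_group, where g = g, of \<alpha> \<alpha>' m] *[OF m] X_carrier nm by simp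
    then show ?thesis using X_inv[OF m] nm n by simp
  qed (use * in simp)
qed

lemma vertex_elt_X: "n \<le> 4 * g \<Longrightarrow> vertex_elt FG \<alpha> \<alpha>' n = inv\<^bsub>FG\<^esub> Ez (\<beta> 0) \<otimes>\<^bsub>FG\<^esub> Ez (\<beta> (real n))"
proof (induction n)
  case 0
  then show ?case using E\<beta>_carrier[of 0] by simp
next
  case (Suc n)
  then have "vertex_elt FG \<alpha> \<alpha>' (Suc n) = (inv\<^bsub>FG\<^esub> Ez (\<beta> 0) \<otimes>\<^bsub>FG\<^esub> Ez (\<beta> (real n))) \<otimes>\<^bsub>FG\<^esub> X n"
    by (simp add: side_elt_X del: \<beta>_0)
  then show ?case
    by (simp add: X_def FG.m_assoc FG.inv_cancel_left E\<beta>_carrier add.commute del: \<beta>_0)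
qed

text \<open>The boundary is traversed once and closes up in the disc, so its class telescopes to the
  unit. This is the surface relation, and it is all that is required about relations in
  \<open>FG\<close>.\<close>

lemma commutator_prod_X: "commutator_prod FG \<alpha> \<alpha>' g = \<one>\<^bsub>FG\<^esub>"
proof -
  have "commutator_prod FG \<alpha> \<alpha>' g = vertex_elt FG \<alpha> \<alpha>' (4 * g)"
    by (rule vertex_elt_commutators[OF FG.is_group, symmetric, where g = g]) (auto simp: X_carrier)
  also have "\<dots> = inv\<^bsub>FG\<^esub> Ez (\<beta> 0) \<otimes>\<^bsub>FG\<^esub> Ez (\<beta> (0 + 4 * real g))" by (simp add: vertex_elt_X del: \<beta>_0)
  also have "\<dots> = \<one>\<^bsub>FG\<^esub>" unfolding \<beta>_period using FG.l_inv[OF E\<beta>_carrier] by blast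
  finally show ?thesis .
qed

text \<open>The class of a path from the vertex of the surface to the centre of the chart: a radius,
  a constant path or half an edge. It converts trivialisations at the centres into those given by
  the potentials.\<close>

definition gauge :: "nat \<Rightarrow> (real \<Rightarrow> 'a) set"
  where "gauge i = (if i = 0 then inv\<^bsub>FG\<^esub> Ez (\<beta> 0) \<otimes>\<^bsub>FG\<^esub> Ez 0 else if i = 1 then \<one>\<^bsub>FG\<^esub>
    else inv\<^bsub>FG\<^esub> Ez (\<beta> (real (first_side (i - 2)))) \<otimes>\<^bsub>FG\<^esub> Ez (\<beta> (real (first_side (i - 2)) + 1/2)))"

lemma gauge_carrier: "gauge i \<in> carrier FG"
  using Ez_carrier[of 0] by (simp add: gauge_def E\<beta>_carrier del: \<beta>_0)

text \<open>To reach a corner, go to vertex 0, along the boundary to the base vertex of the corner,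
  and then by the gauge path. For the second side of an edge the gauge, defined on the first, is
  carried over by \<open>half_sides\<close>.\<close>

lemma Ez_ctr:
  assumes "i \<in> charts" "d \<in> corners i"
  shows "Ez (ctr i d) = Ez (\<beta> 0) \<otimes>\<^bsub>FG\<^esub> pot FG \<alpha> \<alpha>' i d \<otimes>\<^bsub>FG\<^esub> gauge i"
proof -
  have v: "Ez (\<beta> 0) \<otimes>\<^bsub>FG\<^esub> vertex_elt FG \<alpha> \<alpha>' n = Ez (\<beta> (real n))" if "n \<le> 4 * g" for n
    using that by (simp add: vertex_elt_X FG.inv_cancel_left E\<beta>_carrier del: \<beta>_0)
  have d: "d < 4 * g" by (rule corners_less[OF assms])
  consider "i = 0" | "i = 1" | "i \<ge> 2" by linarith
  then show ?thesis
  proof cases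
    case 1
    then show ?thesis using Ez_carrier[of 0]
      by (simp add: pot_def gauge_def ctr_def FG.inv_cancel_left E\<beta>_carrier del: \<beta>_0)
  next
    case 2
    then show ?thesis using v[of d] d by (simp add: pot_def gauge_def ctr_def E\<beta>_carrier del: \<beta>_0)
  next
    case 3
    let ?m = "first_side (i - 2)"
    have i2: "i - 2 < 2 * g" using assms(1) g unfolding lessThan_iff by linarith
    have m: "?m mod 4 < 2" "?m < 4 * g" "?m + 2 < 4 * g" using first_side_mod first_side_less[OF i2] by auto
    have "d = ?m \<or> d = ?m + 2" using assms(2) 3 by (simp add: corners_def)
    then show ?thesis
    proof
      assume "d = ?m"
      then show ?thesis using 3 m v[of ?m]
        by (simp add: pot_def gauge_def ctr_def FG.inv_cancel_left E\<beta>_carrier del: \<beta>_0)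
    next
      assume d: "d = ?m + 2"
      have "\<not> d mod 4 < 2" using mod4_plus2[OF m(1)] d by simp
      then have "pot FG \<alpha> \<alpha>' i d = vertex_elt FG \<alpha> \<alpha>' (?m + 3)"
        using 3 d by (simp add: pot_def numeral_3_eq_3 numeral_2_eq_2 del: vertex_elt.simps)
      moreover have "gauge i = inv\<^bsub>FG\<^esub> Ez (\<beta> (real ?m + 3)) \<otimes>\<^bsub>FG\<^esub> Ez (\<beta> (real ?m + 2 + 1/2))"
        using 3 half_sides(1)[OF m(1,2)] by (simp add: gauge_def)
      moreover have "ctr i d = \<beta> (real ?m + 2 + 1/2)" using 3 d by (simp add: ctr_def add_ac)
      moreover have "Ez (\<beta> 0) \<otimes>\<^bsub>FG\<^esub> vertex_elt FG \<alpha> \<alpha>' (?m + 3) = Ez (\<beta> (real ?m + 3))"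
        using v[of "?m + 3"] m by (simp add: add_ac del: vertex_elt.simps \<beta>_0)
      ultimately show ?thesis
        by (simp only:) (simp add: FG.inv_cancel_left E\<beta>_carrier)
    qed
  qed
qed

lemma chart_subset: "chart i \<subseteq> cball 0 1"
  by (simp add: chart_def)

definition \<gamma> :: "nat \<Rightarrow> 'a \<Rightarrow> real \<Rightarrow> 'a"
  where "\<gamma> i y = (SOME p. path_in (U i) p \<and> pathstart p = y \<and> pathfinish p = centre i)"

lemma track:
  assumes i: "i \<in> charts" and z: "z \<in> chart i"
  shows "path_in (chart i) (\<lambda>t. C i t z)" "pathstart (\<lambda>t. C i t z) = z" "pathfinish (\<lambda>t. C i t z) = ctr i (which i z)"
    "path_in (U i) (q \<circ> (\<lambda>t. C i t z))"
proof -
  have "continuous_on {0..1} (\<lambda>t. case (t, z) of (t, z) \<Rightarrow> C i t z)"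
    by (rule continuous_on_compose2[OF C_cont[OF i]]) (use z in \<open>auto intro!: continuous_intros\<close>)
  then show *: "path_in (chart i) (\<lambda>t. C i t z)"
    using C_chart[OF i z] by (auto simp: path_in_def path_def path_image_def)
  show "pathstart (\<lambda>t. C i t z) = z" "pathfinish (\<lambda>t. C i t z) = ctr i (which i z)"
    by (simp_all add: pathstart_def pathfinish_def C_0[OF i z] C_1)
  show "path_in (U i) (q \<circ> (\<lambda>t. C i t z))"
    using path_in_q[OF path_in_subset[OF * chart_subset]] *
    by (auto simp: path_in_def path_image_compose U_def)
qed

lemma \<gamma>:
  assumes "i \<in> charts" "y \<in> U i"
  shows "path_in (U i) (\<gamma> i y)" "pathstart (\<gamma> i y) = y" "pathfinish (\<gamma> i y) = centre i"
proof -
  obtain z where z: "z \<in> chart i" "y = q z" using assms by (auto simp: U_def)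
  have "\<exists>p. path_in (U i) p \<and> pathstart p = y \<and> pathfinish p = centre i"
    by (rule exI[of _ "q \<circ> (\<lambda>t. C i t z)"])
      (use track[OF assms(1) z(1)] z centre[OF assms(1) chart_which(1)[OF assms(1) z(1)]] in
        \<open>simp add: pathstart_compose pathfinish_compose\<close>)
  from someI_ex[OF this]
  show "path_in (U i) (\<gamma> i y)" "pathstart (\<gamma> i y) = y" "pathfinish (\<gamma> i y) = centre i"
    by (auto simp: \<gamma>_def)
qed

lemma br_\<gamma>:
  assumes i: "i \<in> charts" and z: "z \<in> chart i"
  shows "br (\<gamma> i (q z)) = inv\<^bsub>FG\<^esub> Ez z \<otimes>\<^bsub>FG\<^esub> Ez (ctr i (which i z))"
proof -
  have qz: "q z \<in> U i" using z by (simp add: U_def)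
  have "hp (\<gamma> i (q z)) (q \<circ> (\<lambda>t. C i t z))"
    using \<gamma>[OF i qz] track[OF i z] centre[OF i chart_which(1)[OF i z]]
    by (intro hp_U[OF i]) (simp_all add: pathstart_compose pathfinish_compose)
  from br_cong[OF this] show ?thesis
    using br_q[OF path_in_subset[OF track(1)[OF i z] chart_subset]] track(2,3)[OF i z] by simp
qed

text \<open>After substituting \<open>Ez_ctr\<close> the factors \<open>Ez z\<close>,
  \<open>Ez (\<beta> 0)\<close> and both gauges cancel. The tautological cocycle is thus the
  difference of potentials for the side classes, the same formula that defines \<open>jump\<close>
  in the Coxeter group.\<close>

lemma transition_FG:
  assumes ij: "i \<in> charts" "j \<in> charts" and z: "z \<in> chart i" "z \<in> chart j"
  shows "(gauge i \<otimes>\<^bsub>FG\<^esub> inv\<^bsub>FG\<^esub> br (\<gamma> i (q z))) \<otimes>\<^bsub>FG\<^esub> (br (\<gamma> j (q z)) \<otimes>\<^bsub>FG\<^esub> inv\<^bsub>FG\<^esub> gauge j)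
    = inv\<^bsub>FG\<^esub> pot FG \<alpha> \<alpha>' i (which i z) \<otimes>\<^bsub>FG\<^esub> pot FG \<alpha> \<alpha>' j (which j z)"
proof -
  have c: "pot FG \<alpha> \<alpha>' i (which i z) \<in> carrier FG" "pot FG \<alpha> \<alpha>' j (which j z) \<in> carrier FG"
    by (rule pot_which_carrier[OF FG.is_group _ commutator_prod_X]; use X_carrier ij z in simp)+
  have z1: "Ez z \<in> carrier FG" using Ez_carrier chart_cball[OF z(1)] by blast
  show ?thesis
    unfolding br_\<gamma>[OF ij(1) z(1)] br_\<gamma>[OF ij(2) z(2)]
      Ez_ctr[OF ij(1) chart_which(1)[OF ij(1) z(1)]] Ez_ctr[OF ij(2) chart_which(1)[OF ij(2) z(2)]]
    using c z1 by (simp add: FG.inv_mult_group FG.m_assoc FG.inv_cancel_left E\<beta>_carrier gauge_carrier del: \<beta>_0)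
qed


text \<open>Loops are based at an arbitrary \<open>y\<^sub>0\<close> while \<open>FG\<close> is
  based at \<open>q 1\<close>; \<open>br\<close> mediates between the two.\<close>

lemma fundamental_group_mon_racg:
  assumes y\<^sub>0: "y\<^sub>0 \<in> S"
  shows "mon (fundamental_group S y\<^sub>0) (racg (2 * g + 2)) \<noteq> {}"
proof -
  let ?W = "racg (2 * g + 2)" and ?F = "fundamental_group S y\<^sub>0"
  have W: "group ?W" by (rule group_racg)
  have F: "group ?F" by (rule group_fundamental_group[OF y\<^sub>0])
  obtain a b where *: "(\<forall>k<g. a k \<in> carrier ?W \<and> b k \<in> carrier ?W) \<and> commutator_prod ?W a b g = \<one>\<^bsub>?W\<^esub> \<and>
    (\<forall>(\<Pi>' :: (real \<Rightarrow> 'a) set monoid) \<alpha> \<beta>. group \<Pi>' \<longrightarrow> (\<forall>k<g. \<alpha> k \<in> carrier \<Pi>' \<and> \<beta> k \<in> carrier \<Pi>') \<longrightarrow>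
      commutator_prod \<Pi>' \<alpha> \<beta> g = \<one>\<^bsub>\<Pi>'\<^esub> \<longrightarrow>
      (\<exists>Z. subgroup Z (?W \<times>\<times> \<Pi>') \<and> (\<forall>k<g. (a k, \<alpha> k) \<in> Z \<and> (b k, \<beta> k) \<in> Z) \<and>
        (\<forall>\<pi>. (\<one>\<^bsub>?W\<^esub>, \<pi>) \<in> Z \<longrightarrow> \<pi> = \<one>\<^bsub>\<Pi>'\<^esub>)))"
    using surface_word_group[OF g] by (elim exE)
  have ab: "\<forall>k<g. a k \<in> carrier ?W \<and> b k \<in> carrier ?W" and rel: "commutator_prod ?W a b g = \<one>\<^bsub>?W\<^esub>"
    using * by simp_all
  have "\<forall>k<g. \<alpha> k \<in> carrier FG \<and> \<alpha>' k \<in> carrier FG" using X_carrier by simp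
  from *[THEN conjunct2, THEN conjunct2, THEN spec, THEN spec, THEN spec, THEN mp, OF FG.is_group,
      THEN mp, OF this, THEN mp, OF commutator_prod_X]
  obtain Z where Z: "subgroup Z (?W \<times>\<times> FG)" "\<And>k. k < g \<Longrightarrow> (a k, \<alpha> k) \<in> Z \<and> (b k, \<alpha>' k) \<in> Z"
    "\<And>\<pi>. (\<one>\<^bsub>?W\<^esub>, \<pi>) \<in> Z \<Longrightarrow> \<pi> = \<one>\<^bsub>FG\<^esub>"
    by (elim exE conjE) simp
  have ab': "\<And>k. k < g \<Longrightarrow> a k \<in> carrier ?W \<and> b k \<in> carrier ?W" using ab by blast
  define t where "t = (\<lambda>i j y. jump ?W a b i j (rep y))"
  interpret L: local_system S charts U ?W t
    unfolding t_def by (rule local_system_jump[OF W ab' rel])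
  define t' where "t' = (\<lambda>i j y. (gauge i \<otimes>\<^bsub>FG\<^esub> inv\<^bsub>FG\<^esub> br (\<gamma> i y)) \<otimes>\<^bsub>FG\<^esub> (br (\<gamma> j y) \<otimes>\<^bsub>FG\<^esub> inv\<^bsub>FG\<^esub> gauge j))"
  have tZ: "(t i j y, t' i j y) \<in> Z" if ij: "i \<in> charts" "j \<in> charts" "y \<in> U i" "y \<in> U j" for i j y
  proof -
    obtain z where z: "z \<in> chart i" "y = q z" using ij(3) by (auto simp: U_def)
    then have zj: "z \<in> chart j" using U_iff[OF ij(2)] ij(4) chart_cball by blast
    have pZ: "(pot ?W a b l (which l z), pot FG \<alpha> \<alpha>' l (which l z)) \<in> Z" if "l \<in> charts" "z \<in> chart l" for l
      by (rule pot_subgroup[OF W FG.is_group Z(1,2) corners_less[OF that(1) chart_which(1)[OF that]]])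
    have "(inv\<^bsub>?W \<times>\<times> FG\<^esub> (pot ?W a b i (which i z), pot FG \<alpha> \<alpha>' i (which i z))) \<otimes>\<^bsub>?W \<times>\<times> FG\<^esub>
        (pot ?W a b j (which j z), pot FG \<alpha> \<alpha>' j (which j z)) \<in> Z"
      by (intro subgroup.m_closed[OF Z(1)] subgroup.m_inv_closed[OF Z(1)] pZ ij z zj)
    moreover have "pot ?W a b i (which i z) \<in> carrier ?W" "pot FG \<alpha> \<alpha>' i (which i z) \<in> carrier FG"
      using subgroup.mem_carrier[OF Z(1) pZ[OF ij(1) z(1)]] by auto
    ultimately have "(inv\<^bsub>?W\<^esub> pot ?W a b i (which i z) \<otimes>\<^bsub>?W\<^esub> pot ?W a b j (which j z),
        inv\<^bsub>FG\<^esub> pot FG \<alpha> \<alpha>' i (which i z) \<otimes>\<^bsub>FG\<^esub> pot FG \<alpha> \<alpha>' j (which j z)) \<in> Z"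
      by (simp only: inv_DirProd[OF W FG.is_group] mult_DirProd)
    moreover have "t i j y = inv\<^bsub>?W\<^esub> pot ?W a b i (which i z) \<otimes>\<^bsub>?W\<^esub> pot ?W a b j (which j z)"
      using jump_rep[OF W ab' rel ij(1,2) z(1) zj] by (simp only: t_def z(2) jump_def[of ?W a b i j z])
    moreover have "t' i j y = inv\<^bsub>FG\<^esub> pot FG \<alpha> \<alpha>' i (which i z) \<otimes>\<^bsub>FG\<^esub> pot FG \<alpha> \<alpha>' j (which j z)"
      unfolding t'_def z(2) by (rule transition_FG[OF ij(1,2) z(1) zj])
    ultimately show ?thesis by (simp only:)
  qed
  obtain i where i: "i \<in> charts" "y\<^sub>0 \<in> U i" using U_cover y\<^sub>0 by blast
  let ?tr = "\<lambda>p m. L.transport p 0 1 i \<one>\<^bsub>?W\<^esub> i m"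
  let ?cl = "\<lambda>p. loop_homotopy S y\<^sub>0 `` {p}"
  have loop: "path_in S p" "p 0 = y\<^sub>0" "p 1 = y\<^sub>0" "continuous_on {0..1} p" "p ` {0..1} \<subseteq> S"
    "pathstart p = y\<^sub>0" "pathfinish p = y\<^sub>0"
    if "p \<in> loops_at S y\<^sub>0" for p
    using that by (auto simp: loops_at_iff pathstart_def pathfinish_def path_in_def path_def path_image_def)
  have ex_tr: "\<exists>m\<in>carrier ?W. ?tr p m" if "p \<in> loops_at S y\<^sub>0" for p
    using L.ex_transport[OF loop(4,5)[OF that], of i i "\<one>\<^bsub>?W\<^esub>"] loop(2,3)[OF that] i
      group.is_monoid[OF W] monoid.one_closed by auto
  have uniq: "m = m'" if "p \<in> loops_at S y\<^sub>0" "?tr p m" "?tr p m'" for p m m'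
    using L.transport_unique[OF loop(5)[OF that(1)], of i i "\<one>\<^bsub>?W\<^esub>" m m'] that loop(2,3)[OF that(1)] i by auto
  \<comment> \<open>Holonomy from chart \<open>i\<close> back to chart \<open>i\<close>; homotopy
    invariance makes it independent of the loop that represents the class.\<close>
  define \<Phi> where "\<Phi> Q = (THE m. \<exists>p\<in>loops_at S y\<^sub>0. Q = ?cl p \<and> ?tr p m)" for Q
  have \<Phi>: "\<Phi> (?cl p) = m" if p: "p \<in> loops_at S y\<^sub>0" and m: "?tr p m" for p m
    unfolding \<Phi>_def
  proof (rule the_equality)
    show "\<exists>p'\<in>loops_at S y\<^sub>0. ?cl p = ?cl p' \<and> ?tr p' m" using p m by blast
    fix n assume "\<exists>p'\<in>loops_at S y\<^sub>0. ?cl p = ?cl p' \<and> ?tr p' n"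
    then obtain p' where p': "p' \<in> loops_at S y\<^sub>0" "?cl p = ?cl p'" "?tr p' n" by blast
    have "homotopic_paths S p' p"
      using fundamental_group_class_eq[OF p p'(1)] p'(2) homotopic_paths_sym by blast
    from L.transport_homotopic[OF this i(1) _ i(1) _ _ p'(3)] have "?tr p n"
      using loop(6,7)[OF p'(1)] i(2) group.is_monoid[OF W] monoid.one_closed by auto
    then show "n = m" using uniq[OF p] m by blast
  qed
  have hom: "\<Phi> \<in> hom ?F ?W"
  proof (rule homI)
    fix P assume "P \<in> carrier ?F"
    then obtain p where p: "p \<in> loops_at S y\<^sub>0" "P = ?cl p" by (auto simp: fundamental_group_carrier)
    obtain m where m: "m \<in> carrier ?W" "?tr p m" using ex_tr[OF p(1)] by blast
    show "\<Phi> P \<in> carrier ?W" using \<Phi>[OF p(1) m(2)] m(1) p(2) by simp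
    fix Q assume "Q \<in> carrier ?F"
    then obtain r where r: "r \<in> loops_at S y\<^sub>0" "Q = ?cl r" by (auto simp: fundamental_group_carrier)
    obtain n where n: "n \<in> carrier ?W" "?tr r n" using ex_tr[OF r(1)] by blast
    have "?tr (p +++ r) (m \<otimes>\<^bsub>?W\<^esub> n)"
      by (rule L.transport_join[OF m(2) n(2) i(1)]) (use loop(6,7)[OF p(1)] loop(6,7)[OF r(1)] i in auto)
    from \<Phi>[OF loops_at_join[OF p(1) r(1)] this]
    show "\<Phi> (P \<otimes>\<^bsub>?F\<^esub> Q) = \<Phi> P \<otimes>\<^bsub>?W\<^esub> \<Phi> Q"
      unfolding p(2) r(2) fundamental_group_mult[OF p(1) r(1)] \<Phi>[OF p(1) m(2)] \<Phi>[OF r(1) n(2)] .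
  qed
  have "P = \<one>\<^bsub>?F\<^esub>" if P: "P \<in> carrier ?F" "\<Phi> P = \<one>\<^bsub>?W\<^esub>" for P
  proof -
    obtain p where p: "p \<in> loops_at S y\<^sub>0" "P = ?cl p" using P(1) by (auto simp: fundamental_group_carrier)
    obtain m where m: "?tr p m" using ex_tr[OF p(1)] by blast
    then have "?tr p \<one>\<^bsub>?W\<^esub>" using \<Phi>[OF p(1) m] p(2) P(2) by simp
    then obtain K where K: "lift_on charts U ?W t p 0 1 K" "K 0 i = \<one>\<^bsub>?W\<^esub>" "K 1 i = \<one>\<^bsub>?W\<^esub>"
      unfolding L.transport_def by blast
    have c: "br (\<gamma> i y\<^sub>0) \<in> carrier FG"
      by (rule br_carrier) (use path_in_subset[OF \<gamma>(1)[OF i] U_subset[OF i(1)]] in simp)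
    \<comment> \<open>Chosen so that the tautological section starts at the unit in chart
      \<open>i\<close>, as \<open>K\<close> does.\<close>
    let ?d = "gauge i \<otimes>\<^bsub>FG\<^esub> inv\<^bsub>FG\<^esub> br (\<gamma> i y\<^sub>0)"
    define K' where "K' = (\<lambda>s l. ?d \<otimes>\<^bsub>FG\<^esub> br (subpath 0 s p) \<otimes>\<^bsub>FG\<^esub> (br (\<gamma> l (p s)) \<otimes>\<^bsub>FG\<^esub> inv\<^bsub>FG\<^esub> gauge l))"
    have K': "lift_on charts U FG t' p 0 1 K'"
      unfolding t'_def K'_def
    proof (rule lift_br[OF loop(1)[OF p(1)]])
      show "?d \<in> carrier FG" using c gauge_carrier by simp
      show "path_in S (\<gamma> l y) \<and> pathstart (\<gamma> l y) = y" if "l \<in> charts" "y \<in> U l" for l y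
        using \<gamma>[OF that] path_in_subset U_subset[OF that(1)] by blast
      show "pathfinish (\<gamma> l (pathfinish \<eta>)) = pathfinish (\<gamma> l (pathstart \<eta>)) \<and>
          hp (\<eta> +++ \<gamma> l (pathfinish \<eta>)) (\<gamma> l (pathstart \<eta>))"
        if l: "l \<in> charts" "path_in (U l) \<eta>" for l \<eta>
        using \<gamma>[OF l(1) path_in_endpoints(1)[OF l(2)]] \<gamma>[OF l(1) path_in_endpoints(2)[OF l(2)]] l
        by (auto intro!: hp_U[OF l(1)])
    qed (auto simp: gauge_carrier openin_U)
    have "K' 0 i = ?d \<otimes>\<^bsub>FG\<^esub> \<one>\<^bsub>FG\<^esub> \<otimes>\<^bsub>FG\<^esub> (br (\<gamma> i y\<^sub>0) \<otimes>\<^bsub>FG\<^esub> inv\<^bsub>FG\<^esub> gauge i)"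
      using br_const[OF y\<^sub>0] loop(2)[OF p(1)] by (simp add: K'_def subpath_refl)
    also have "\<dots> = \<one>\<^bsub>FG\<^esub>" using c gauge_carrier[of i] by (simp add: FG.m_assoc FG.inv_cancel_left)
    finally have K'0: "K' 0 i = \<one>\<^bsub>FG\<^esub>" .
    have cov: "\<exists>l\<in>charts. p s \<in> U l" if "s \<in> {0..1}" for s
    proof -
      have "p s \<in> S" using loop(5)[OF p(1)] that by blast
      then show ?thesis using U_cover by blast
    qed
    have "(\<one>\<^bsub>?W\<^esub>, \<one>\<^bsub>FG\<^esub>) \<in> Z" using subgroup.one_closed[OF Z(1)] by simp
    then have start: "(K 0 i, K' 0 i) \<in> Z" unfolding K(2) K'0 .
    have p01: "p 0 \<in> U i" "p 1 \<in> U i" using loop(2,3)[OF p(1)] i(2) by simp_all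
    \<comment> \<open>Both sections start at the unit and have corresponding transitions, so their
      end values are related by \<open>Z\<close>. The value of \<open>K\<close> there is the unit,
      which forces that of \<open>K'\<close>.\<close>
    have "(K 1 i, K' 1 i) \<in> Z"
      by (rule lift_on_compare[OF K(1) K' Z(1) tZ cov i(1) p01(1) start _ i(1) p01(2)]) simp_all
    then have "K' 1 i = \<one>\<^bsub>FG\<^esub>" using Z(3) K(3) by simp
    moreover have bp: "br p \<in> carrier FG" by (rule br_carrier[OF loop(1)[OF p(1)]])
    ultimately have eq: "?d \<otimes>\<^bsub>FG\<^esub> br p \<otimes>\<^bsub>FG\<^esub> (br (\<gamma> i y\<^sub>0) \<otimes>\<^bsub>FG\<^esub> inv\<^bsub>FG\<^esub> gauge i) = \<one>\<^bsub>FG\<^esub>"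
      using loop(3)[OF p(1)] by (simp add: K'_def)
    \<comment> \<open>The end value of the tautological section is the conjugate of
      \<open>br p\<close> by this element, so \<open>br p\<close> is trivial.\<close>
    let ?e = "br (\<gamma> i y\<^sub>0) \<otimes>\<^bsub>FG\<^esub> inv\<^bsub>FG\<^esub> gauge i"
    have e: "?e \<in> carrier FG" "?d = inv\<^bsub>FG\<^esub> ?e" using c gauge_carrier[of i] by (simp_all add: FG.inv_mult_group)
    have "br p = ?e \<otimes>\<^bsub>FG\<^esub> (inv\<^bsub>FG\<^esub> ?e \<otimes>\<^bsub>FG\<^esub> br p \<otimes>\<^bsub>FG\<^esub> ?e) \<otimes>\<^bsub>FG\<^esub> inv\<^bsub>FG\<^esub> ?e"
      using e(1) bp by (simp only: FG.m_assoc FG.inv_cancel_left FG.m_closed FG.inv_closed FG.r_inv FG.r_one)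
    also have "\<dots> = \<one>\<^bsub>FG\<^esub>" using eq e by simp
    finally have "hp p (linepath y\<^sub>0 y\<^sub>0)"
      using br_faithful[OF loop(1,6,7)[OF p(1)]] by blast
    moreover have "linepath y\<^sub>0 y\<^sub>0 \<in> loops_at S y\<^sub>0" using y\<^sub>0 by (simp add: loops_at_iff)
    ultimately show ?thesis
      using fundamental_group_class_eq[OF p(1)] by (simp add: p(2) fundamental_group_one)
  qed
  then have "\<Phi> \<in> mon ?F ?W" using hom mon_iff_hom_one[OF F W] by blast
  then show ?thesis by blast
qed

end

text \<open>The index type does not depend on the genus, so vertices carrying different surface
  groups can enter one graph product.\<close>

lemma surface_group_pair_rep:
  assumes "surface_group G"
  shows "\<exists>(I :: (nat \<times> bool) option set) \<rho> u lam phi. pair_rep G {\<one>\<^bsub>G\<^esub>} I \<rho> u lam phi"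
proof -
  obtain g and S :: "(real ^ 3) set" and a where g: "g \<ge> 2" and S: "closed_orientable_surface g S"
    and a: "a \<in> S" and iso: "G \<cong> fundamental_group S a" and G: "group G"
    using assms by (auto simp: surface_group_def)
  obtain q where q: "quotient_map (top_of_set (cball 0 1)) (top_of_set S) q"
    "\<forall>z\<in>cball 0 1. \<forall>w\<in>cball 0 1. q z = q w \<longleftrightarrow> (z, w) \<in> polygon_gluing g"
    using S by (auto simp: closed_orientable_surface_def)
  interpret polygon_surface g S q
    by unfold_locales (use g q in auto)
  obtain h where h: "h \<in> hom (fundamental_group S a) (racg (2 * g + 2))" "inj_on h (carrier (fundamental_group S a))"
    using fundamental_group_mon_racg[OF a] by (auto simp: mon_def)
  obtain f where f: "f \<in> hom G (fundamental_group S a)" "bij_betw f (carrier G) (carrier (fundamental_group S a))"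
    using iso by (auto simp: is_iso_def iso_def)
  have hf: "h \<circ> f \<in> hom G (racg (2 * g + 2))" by (rule hom_compose[OF f(1) h(1)])
  have "inj_on (h \<circ> f) (carrier G)"
    using f(2) h(2) by (intro comp_inj_on) (auto simp: bij_betw_def)
  moreover obtain I :: "(nat \<times> bool) option set" and \<rho> u lam phi
    where "pair_rep (racg (2 * g + 2)) {\<one>\<^bsub>racg (2 * g + 2)\<^esub>} I \<rho> u lam phi"
    using pair_rep_racg[of "2 * g + 2"] by auto
  ultimately show ?thesis using pair_rep_pullback[OF G group_racg _ hf] by blast
qed

theorem corollary5p18:
  fixes V :: "'v set" and E :: "'v rel"
    and G :: "'v \<Rightarrow> 'a monoid"
    and F :: "'v \<Rightarrow> 'b monoid" and A :: "'v \<Rightarrow> 'b set"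
  assumes "finite_graph V E"
  shows "((\<forall>v\<in>V. surface_group (G v)) \<longrightarrow> linear_group (graph_product V E G)) \<and>
    ((\<forall>v\<in>V. group (F v) \<and> finite (carrier (F v)) \<and> subgroup (A v) (F v)) \<longrightarrow>
      linear_group (graph_product_of_pairs V E F A))"
proof (intro conjI impI)
  assume G: "\<forall>v\<in>V. surface_group (G v)"
  then have "\<forall>v\<in>V. \<exists>I :: (nat \<times> bool) option set. \<exists>\<rho> u lam phi. pair_rep (G v) {\<one>\<^bsub>G v\<^esub>} I \<rho> u lam phi"
    using surface_group_pair_rep by blast
  from bchoice[OF this] obtain I :: "'v \<Rightarrow> (nat \<times> bool) option set" where
    I: "\<And>v. v \<in> V \<Longrightarrow> \<exists>\<rho> u lam phi. pair_rep (G v) {\<one>\<^bsub>G v\<^esub>} (I v) \<rho> u lam phi"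
    by blast
  show "linear_group (graph_product V E G)"
    unfolding graph_product_def
  proof (rule linear_graph_product[OF assms])
    show "group (G v) \<and> subgroup {\<one>\<^bsub>G v\<^esub>} (G v)" if "v \<in> V" for v
      using G that group.triv_subgroup by (auto simp: surface_group_def)
  qed (rule I)
next
  assume "\<forall>v\<in>V. group (F v) \<and> finite (carrier (F v)) \<and> subgroup (A v) (F v)"
  then show "linear_group (graph_product_of_pairs V E F A)"
    by (rule linear_graph_product_finite[OF assms])
qed

end
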